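(* Let $M$ be an $n$-dimensional smooth manifold and let $(\mathcal{E},\phi,\nabla^{\mathcal{E}})$ be a coherent tangent bundle over $M$. Assume that $\operatorname{rank}\phi\ge 2$ almost everywhere on $M$ and that $\operatorname{tr}\{\eta\mapsto R^{\nabla^{\mathcal{E}}}(X,Y)\eta\}=0$ for all $X,Y\in\Gamma(TM)$ (trace over $\eta\in\mathcal{E}$). Then the following two conditions are equivalent: (i) the connection $\nabla^{\mathcal{E}}$ is projectively flat with respect to $\phi$; (ii) there exists a tensor field $A\in\Gamma(T^*M\otimes\mathcal{E}^* )$ such that, for all $X,Y\in\Gamma(TM)$ and $\eta\in\Gamma(\mathcal{E})$, $$R^{\nabla^{\mathcal{E}}}(X,Y)\eta=\frac{1}{n-1}\{A(Y,\eta)\phi(X)-A(X,\eta)\phi(Y)\}$$ and $$XA(Y,\eta)-YA(X,\eta)-A([X,Y],\eta)=A(Y,\nabla^{\mathcal{E}}_X\eta)-A(X,\nabla^{\mathcal{E}}_Y\eta).$$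
   Context: All objects are $C^\infty$. $R^{\nabla}(X,Y)=\nabla_X\nabla_Y-\nabla_Y\nabla_X-\nabla_{[X,Y]}$ is the curvature of a connection on a vector bundle. Let $\mathcal{E}$ be a rank $n$ vector bundle over $M$ and $\phi:TM\to\mathcal{E}$ a bundle map over $\mathrm{id}_M$ (fiberwise linear; the rank of $\phi_p$ may vary with $p$). A connection $\nabla^{\mathcal{E}}$ on $\mathcal{E}$ is relatively torsion-free with respect to $\phi$ if $\nabla^{\mathcal{E}}_X\phi(Y)-\nabla^{\mathcal{E}}_Y\phi(X)-\phi([X,Y])=0$ for all $X,Y\in\Gamma(TM)$; then $(\mathcal{E},\phi,\nabla^{\mathcal{E}})$ is called a coherent tangent bundle. Two connections $\nabla^{\mathcal{E}},\widehat\nabla^{\mathcal{E}}$, both relatively torsion-free with respect to $\phi$, are projectively equivalent with respect to $\phi$ if there is $\rho\in\Gamma(\mathcal{E}^* )$ with $\widehat\nabla^{\mathcal{E}}_X\eta=\nabla^{\mathcal{E}}_X\eta+\rho(\phi(X))\eta+\rho(\eta)\phi(X)$ for all $X\in\Gamma(TM)$, $\eta\in\Gamma(\mathcal{E})$. $\nabla^{\mathcal{E}}$ is projectively flat with respect to $\phi$ if every point of $M$ has a neighborhood on which $\nabla^{\mathcal{E}}$ is projectively equivalent with respect to $\phi$ to a connection with vanishing curvature. *)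

theory Defs
  imports "HOL-Analysis.Analysis"
begin

section \<open>Smooth maps between Euclidean spaces\<close>

text \<open>Only used on open sets \<open>S\<close>.\<close>

primrec Ck_on :: "nat \<Rightarrow> 'v::euclidean_space set \<Rightarrow> ('v \<Rightarrow> 'w::real_normed_vector) \<Rightarrow> bool" where
  "Ck_on 0 S f \<longleftrightarrow> continuous_on S f"
| "Ck_on (Suc k) S f \<longleftrightarrow>
     (\<forall>x\<in>S. f differentiable (at x)) \<and> (\<forall>v. Ck_on k S (\<lambda>x. frechet_derivative f (at x) v))"

definition smooth_on :: "'v::euclidean_space set \<Rightarrow> ('v \<Rightarrow> 'w::real_normed_vector) \<Rightarrow> bool" where
  "smooth_on S f \<longleftrightarrow> (\<forall>k. Ck_on k S f)"


section \<open>Smooth manifolds\<close>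

text \<open>
  The manifold is the whole of a Hausdorff, second countable type \<open>'a\<close>. Its dimension is
  \<open>CARD('n)\<close>. The smooth structure is given by an atlas, not required to be maximal. A chart is
  a pair of its domain and the coordinate map; the values of the map outside the domain are
  irrelevant.
\<close>

type_synonym ('a, 'n) chart = "'a set \<times> ('a \<Rightarrow> real ^ 'n)"

definition is_chart :: "('a::topological_space, 'n::finite) chart \<Rightarrow> bool" where
  "is_chart = (\<lambda>(V, c). open V \<and> open (c ` V) \<and> homeomorphism V (c ` V) c (inv_into V c))"

definition smooth_manifold ::
    "('a::{t2_space, second_countable_topology}, 'n::finite) chart set \<Rightarrow> bool" where
  "smooth_manifold \<A> \<longleftrightarrow>
     (\<Union>(V, c)\<in>\<A>. V) = UNIV \<and>
     (\<forall>k\<in>\<A>. is_chart k) \<and>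
     (\<forall>(V, c)\<in>\<A>. \<forall>(W, d)\<in>\<A>. smooth_on (c ` (V \<inter> W)) (d \<circ> inv_into V c))"

definition smooth_map :: "('a::topological_space, 'n::finite) chart set \<Rightarrow> 'a set \<Rightarrow>
    ('a \<Rightarrow> 'w::real_normed_vector) \<Rightarrow> bool" where
  "smooth_map \<A> U f \<longleftrightarrow> (\<forall>(V, c)\<in>\<A>. smooth_on (c ` (U \<inter> V)) (f \<circ> inv_into V c))"

text \<open>Subsets of measure zero, a notion that does not depend on the choice of charts.\<close>

definition null_subset :: "('a::topological_space, 'n::finite) chart set \<Rightarrow> 'a set \<Rightarrow> bool" where
  "null_subset \<A> N \<longleftrightarrow> (\<forall>(V, c)\<in>\<A>. negligible (c ` (V \<inter> N)))"


section \<open>Tangent vectors and vector fields\<close>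

text \<open>
  The tangent space at \<open>p\<close> is \<open>real ^ 'n\<close>: a tangent vector is given by its components in a chart
  chosen once and for all at \<open>p\<close>. Hence its components in any other chart \<open>(V, c)\<close> are obtained
  by applying the derivative of the transition map, that is, by deriving the map \<open>c\<close> along it.
  As the chosen chart may jump from point to point, smoothness of a vector field is tested on
  these components in the charts of the atlas, and not on the function \<open>X\<close> itself.
\<close>

definition chart_at :: "('a, 'n::finite) chart set \<Rightarrow> 'a \<Rightarrow> ('a, 'n) chart" where
  "chart_at \<A> p = (SOME k. k \<in> \<A> \<and> p \<in> fst k)"

text \<open>The derivative \<open>v f\<close> of \<open>f\<close> at \<open>p\<close> along the tangent vector \<open>v\<close>.\<close>

definition tderiv :: "('a, 'n::finite) chart set \<Rightarrow> ('a \<Rightarrow> 'w::real_normed_vector) \<Rightarrow> 'a \<Rightarrow>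
    real ^ 'n \<Rightarrow> 'w" where
  "tderiv \<A> f p v =
     (case chart_at \<A> p of (V, c) \<Rightarrow> frechet_derivative (f \<circ> inv_into V c) (at (c p)) v)"

definition vector_fields :: "('a::topological_space, 'n::finite) chart set \<Rightarrow> 'a set \<Rightarrow>
    ('a \<Rightarrow> real ^ 'n) set" where
  "vector_fields \<A> U =
     {X. \<forall>(V, c)\<in>\<A>. smooth_map \<A> (U \<inter> V) (\<lambda>p. tderiv \<A> c p (X p))}"

text \<open>The vector field over the chart domain whose components in the chart \<open>c\<close> are
  constantly \<open>w\<close>.\<close>

definition coord_field :: "('a, 'n::finite) chart set \<Rightarrow> ('a \<Rightarrow> real ^ 'n) \<Rightarrow> real ^ 'n \<Rightarrow>
    'a \<Rightarrow> real ^ 'n" where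
  "coord_field \<A> c w p = inv (tderiv \<A> c p) w"

text \<open>In a chart, the components of \<open>[X, Y]\<close> are \<open>X (Y\<^sup>i) - Y (X\<^sup>i)\<close>; at \<open>p\<close> the chart to
  use is the one chosen at \<open>p\<close>.\<close>

definition lie_bracket :: "('a, 'n::finite) chart set \<Rightarrow> ('a \<Rightarrow> real ^ 'n) \<Rightarrow> ('a \<Rightarrow> real ^ 'n) \<Rightarrow>
    'a \<Rightarrow> real ^ 'n" where
  "lie_bracket \<A> X Y p =
     (let c = snd (chart_at \<A> p)
      in tderiv \<A> (\<lambda>q. tderiv \<A> c q (Y q)) p (X p) - tderiv \<A> (\<lambda>q. tderiv \<A> c q (X q)) p (Y p))"


section \<open>Vector bundles\<close>

text \<open>
  The fibres \<open>E p\<close> are subspaces of a real vector space \<open>'e\<close>, which may be of infinite dimension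
  and carries no topology. Fibres over different points are not related in any way (the total
  space is \<open>Sigma UNIV E\<close>), so this covers every family of vector spaces: embed each of them into
  their direct sum. The smooth structure is given by local trivialisations \<open>(V, \<Phi>)\<close> with
  smooth transition functions, \<open>\<Phi> p\<close> being a linear isomorphism of \<open>E p\<close> onto \<open>real ^ 'm\<close>
  for \<open>p \<in> V\<close>. The rank is \<open>CARD('m)\<close>.
\<close>

type_synonym ('a, 'e, 'm) triv = "'a set \<times> ('a \<Rightarrow> 'e \<Rightarrow> real ^ 'm)"

definition fibre_linear :: "'e::real_vector set \<Rightarrow> ('e \<Rightarrow> 'w::real_vector) \<Rightarrow> bool" where
  "fibre_linear F h \<longleftrightarrow>
     (\<forall>x\<in>F. \<forall>y\<in>F. h (x + y) = h x + h y) \<and> (\<forall>r. \<forall>x\<in>F. h (r *\<^sub>R x) = r *\<^sub>R h x)"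

text \<open>The section over the domain of a trivialisation \<open>\<Phi>\<close> that is constantly \<open>v\<close> in it.\<close>

definition frame :: "('a \<Rightarrow> 'e set) \<Rightarrow> ('a \<Rightarrow> 'e \<Rightarrow> real ^ 'm) \<Rightarrow> real ^ 'm \<Rightarrow> 'a \<Rightarrow> 'e" where
  "frame E \<Phi> v p = inv_into (E p) (\<Phi> p) v"

definition vector_bundle :: "('a::topological_space, 'n::finite) chart set \<Rightarrow>
    ('a \<Rightarrow> 'e::real_vector set) \<Rightarrow> ('a, 'e, 'm::finite) triv set \<Rightarrow> bool" where
  "vector_bundle \<A> E \<T> \<longleftrightarrow>
     (\<forall>p. subspace (E p)) \<and>
     (\<Union>(V, \<Phi>)\<in>\<T>. V) = UNIV \<and>
     (\<forall>(V, \<Phi>)\<in>\<T>. open V \<and> (\<forall>p\<in>V. fibre_linear (E p) (\<Phi> p) \<and> bij_betw (\<Phi> p) (E p) UNIV)) \<and>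
     (\<forall>(V, \<Phi>)\<in>\<T>. \<forall>(W, \<Psi>)\<in>\<T>. \<forall>v. smooth_map \<A> (V \<inter> W) (\<lambda>p. \<Psi> p (frame E \<Phi> v p)))"

text \<open>Sections of \<open>E\<close>, of its dual, and of \<open>T\<^sup>*M \<otimes> E\<^sup>*\<close> over an open set \<open>U\<close>; the values of these
  functions outside \<open>U\<close> are irrelevant.\<close>

definition sections :: "('a::topological_space, 'n::finite) chart set \<Rightarrow>
    ('a \<Rightarrow> 'e::real_vector set) \<Rightarrow> ('a, 'e, 'm::finite) triv set \<Rightarrow> 'a set \<Rightarrow> ('a \<Rightarrow> 'e) set" where
  "sections \<A> E \<T> U =
     {\<eta>. (\<forall>p\<in>U. \<eta> p \<in> E p) \<and> (\<forall>(V, \<Phi>)\<in>\<T>. smooth_map \<A> (U \<inter> V) (\<lambda>p. \<Phi> p (\<eta> p)))}"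

definition dual_sections :: "('a::topological_space, 'n::finite) chart set \<Rightarrow>
    ('a \<Rightarrow> 'e::real_vector set) \<Rightarrow> ('a, 'e, 'm::finite) triv set \<Rightarrow> 'a set \<Rightarrow>
    ('a \<Rightarrow> 'e \<Rightarrow> real) set" where
  "dual_sections \<A> E \<T> U =
     {\<rho>. (\<forall>p\<in>U. fibre_linear (E p) (\<rho> p)) \<and>
         (\<forall>(V, \<Phi>)\<in>\<T>. \<forall>v. smooth_map \<A> (U \<inter> V) (\<lambda>p. \<rho> p (frame E \<Phi> v p)))}"

definition cotangent_dual_sections :: "('a::topological_space, 'n::finite) chart set \<Rightarrow>
    ('a \<Rightarrow> 'e::real_vector set) \<Rightarrow> ('a, 'e, 'm::finite) triv set \<Rightarrow> 'a set \<Rightarrow>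
    ('a \<Rightarrow> real ^ 'n \<Rightarrow> 'e \<Rightarrow> real) set" where
  "cotangent_dual_sections \<A> E \<T> U =
     {A. (\<forall>p\<in>U. (\<forall>e\<in>E p. linear (\<lambda>w. A p w e)) \<and> (\<forall>w. fibre_linear (E p) (A p w))) \<and>
         (\<forall>(V, c)\<in>\<A>. \<forall>(W, \<Phi>)\<in>\<T>. \<forall>w v.
            smooth_map \<A> (U \<inter> V \<inter> W) (\<lambda>p. A p (coord_field \<A> c w p) (frame E \<Phi> v p)))}"

text \<open>Smooth bundle maps from the tangent bundle to \<open>E\<close> over the identity.\<close>

definition bundle_map :: "('a::topological_space, 'n::finite) chart set \<Rightarrow>
    ('a \<Rightarrow> 'e::real_vector set) \<Rightarrow> ('a, 'e, 'm::finite) triv set \<Rightarrow> ('a \<Rightarrow> real ^ 'n \<Rightarrow> 'e) \<Rightarrow> bool"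
  where
  "bundle_map \<A> E \<T> \<phi> \<longleftrightarrow>
     (\<forall>p. linear (\<phi> p) \<and> range (\<phi> p) \<subseteq> E p) \<and>
     (\<forall>(V, c)\<in>\<A>. \<forall>(W, \<Phi>)\<in>\<T>. \<forall>w.
        smooth_map \<A> (V \<inter> W) (\<lambda>p. \<Phi> p (\<phi> p (coord_field \<A> c w p))))"


section \<open>Connections\<close>

text \<open>A connection on the restriction of \<open>E\<close> to an open set \<open>U\<close> is an operator
  \<open>D X \<eta> = \<nabla>\<^sub>X \<eta>\<close> on vector fields and sections over \<open>U\<close>. The clause on agreement says
  that \<open>D\<close> ignores the irrelevant values outside \<open>U\<close>.\<close>

definition connection :: "('a::topological_space, 'n::finite) chart set \<Rightarrow>
    ('a \<Rightarrow> 'e::real_vector set) \<Rightarrow> ('a, 'e, 'm::finite) triv set \<Rightarrow> 'a set \<Rightarrow>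
    (('a \<Rightarrow> real ^ 'n) \<Rightarrow> ('a \<Rightarrow> 'e) \<Rightarrow> 'a \<Rightarrow> 'e) \<Rightarrow> bool" where
  "connection \<A> E \<T> U D \<longleftrightarrow>
     (\<forall>X\<in>vector_fields \<A> U. \<forall>\<eta>\<in>sections \<A> E \<T> U. D X \<eta> \<in> sections \<A> E \<T> U) \<and>
     (\<forall>X\<in>vector_fields \<A> U. \<forall>Y\<in>vector_fields \<A> U. \<forall>\<eta>\<in>sections \<A> E \<T> U. \<forall>\<zeta>\<in>sections \<A> E \<T> U.
        (\<forall>p\<in>U. X p = Y p \<and> \<eta> p = \<zeta> p) \<longrightarrow> (\<forall>p\<in>U. D X \<eta> p = D Y \<zeta> p)) \<and>
     (\<forall>X\<in>vector_fields \<A> U. \<forall>Y\<in>vector_fields \<A> U. \<forall>\<eta>\<in>sections \<A> E \<T> U. \<forall>p\<in>U.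
        D (\<lambda>q. X q + Y q) \<eta> p = D X \<eta> p + D Y \<eta> p) \<and>
     (\<forall>f. smooth_map \<A> U f \<longrightarrow> (\<forall>X\<in>vector_fields \<A> U. \<forall>\<eta>\<in>sections \<A> E \<T> U. \<forall>p\<in>U.
        D (\<lambda>q. f q *\<^sub>R X q) \<eta> p = f p *\<^sub>R D X \<eta> p)) \<and>
     (\<forall>X\<in>vector_fields \<A> U. \<forall>\<eta>\<in>sections \<A> E \<T> U. \<forall>\<zeta>\<in>sections \<A> E \<T> U. \<forall>p\<in>U.
        D X (\<lambda>q. \<eta> q + \<zeta> q) p = D X \<eta> p + D X \<zeta> p) \<and>
     (\<forall>f. smooth_map \<A> U f \<longrightarrow> (\<forall>X\<in>vector_fields \<A> U. \<forall>\<eta>\<in>sections \<A> E \<T> U. \<forall>p\<in>U.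
        D X (\<lambda>q. f q *\<^sub>R \<eta> q) p = f p *\<^sub>R D X \<eta> p + tderiv \<A> f p (X p) *\<^sub>R \<eta> p))"

definition restricts_to :: "('a::topological_space, 'n::finite) chart set \<Rightarrow>
    ('a \<Rightarrow> 'e::real_vector set) \<Rightarrow> ('a, 'e, 'm::finite) triv set \<Rightarrow> 'a set \<Rightarrow>
    (('a \<Rightarrow> real ^ 'n) \<Rightarrow> ('a \<Rightarrow> 'e) \<Rightarrow> 'a \<Rightarrow> 'e) \<Rightarrow>
    (('a \<Rightarrow> real ^ 'n) \<Rightarrow> ('a \<Rightarrow> 'e) \<Rightarrow> 'a \<Rightarrow> 'e) \<Rightarrow> bool" where
  "restricts_to \<A> E \<T> U D D' \<longleftrightarrow>
     connection \<A> E \<T> U D' \<and>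
     (\<forall>X\<in>vector_fields \<A> UNIV. \<forall>\<eta>\<in>sections \<A> E \<T> UNIV. \<forall>p\<in>U. D' X \<eta> p = D X \<eta> p)"

definition curvature :: "('a, 'n::finite) chart set \<Rightarrow>
    (('a \<Rightarrow> real ^ 'n) \<Rightarrow> ('a \<Rightarrow> 'e::real_vector) \<Rightarrow> 'a \<Rightarrow> 'e) \<Rightarrow>
    ('a \<Rightarrow> real ^ 'n) \<Rightarrow> ('a \<Rightarrow> real ^ 'n) \<Rightarrow> ('a \<Rightarrow> 'e) \<Rightarrow> 'a \<Rightarrow> 'e" where
  "curvature \<A> D X Y \<eta> p = D X (D Y \<eta>) p - D Y (D X \<eta>) p - D (lie_bracket \<A> X Y) \<eta> p"

definition flat :: "('a::topological_space, 'n::finite) chart set \<Rightarrow>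
    ('a \<Rightarrow> 'e::real_vector set) \<Rightarrow> ('a, 'e, 'm::finite) triv set \<Rightarrow> 'a set \<Rightarrow>
    (('a \<Rightarrow> real ^ 'n) \<Rightarrow> ('a \<Rightarrow> 'e) \<Rightarrow> 'a \<Rightarrow> 'e) \<Rightarrow> bool" where
  "flat \<A> E \<T> U D \<longleftrightarrow>
     (\<forall>X\<in>vector_fields \<A> U. \<forall>Y\<in>vector_fields \<A> U. \<forall>\<eta>\<in>sections \<A> E \<T> U. \<forall>p\<in>U.
        curvature \<A> D X Y \<eta> p = 0)"

text \<open>The endomorphism of the fibre \<open>E p\<close> induced by the curvature. As the curvature is
  tensorial, the choice of the section \<open>\<eta>\<close> through \<open>e\<close> is immaterial.\<close>

definition curvature_endo :: "('a::topological_space, 'n::finite) chart set \<Rightarrow>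
    ('a \<Rightarrow> 'e::real_vector set) \<Rightarrow> ('a, 'e, 'm::finite) triv set \<Rightarrow>
    (('a \<Rightarrow> real ^ 'n) \<Rightarrow> ('a \<Rightarrow> 'e) \<Rightarrow> 'a \<Rightarrow> 'e) \<Rightarrow>
    ('a \<Rightarrow> real ^ 'n) \<Rightarrow> ('a \<Rightarrow> real ^ 'n) \<Rightarrow> 'a \<Rightarrow> 'e \<Rightarrow> 'e" where
  "curvature_endo \<A> E \<T> D X Y p e =
     curvature \<A> D X Y (SOME \<eta>. \<eta> \<in> sections \<A> E \<T> UNIV \<and> \<eta> p = e) p"

text \<open>The trace of a linear endomorphism \<open>L\<close> of a finite-dimensional subspace \<open>F\<close>, computed in
  any basis of \<open>F\<close>.\<close>

definition fibre_trace :: "'e::real_vector set \<Rightarrow> ('e \<Rightarrow> 'e) \<Rightarrow> real" where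
  "fibre_trace F L =
     (let B = SOME B. B \<subseteq> F \<and> independent B \<and> F \<subseteq> span B in \<Sum>b\<in>B. representation B (L b) b)"


section \<open>Coherent tangent bundles and projective equivalence\<close>

definition relatively_torsion_free :: "('a::topological_space, 'n::finite) chart set \<Rightarrow> 'a set \<Rightarrow>
    ('a \<Rightarrow> real ^ 'n \<Rightarrow> 'e::real_vector) \<Rightarrow>
    (('a \<Rightarrow> real ^ 'n) \<Rightarrow> ('a \<Rightarrow> 'e) \<Rightarrow> 'a \<Rightarrow> 'e) \<Rightarrow> bool" where
  "relatively_torsion_free \<A> U \<phi> D \<longleftrightarrow>
     (\<forall>X\<in>vector_fields \<A> U. \<forall>Y\<in>vector_fields \<A> U. \<forall>p\<in>U.
        D X (\<lambda>q. \<phi> q (Y q)) p - D Y (\<lambda>q. \<phi> q (X q)) p - \<phi> p (lie_bracket \<A> X Y p) = 0)"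

definition coherent_tangent_bundle :: "('a::topological_space, 'n::finite) chart set \<Rightarrow>
    ('a \<Rightarrow> 'e::real_vector set) \<Rightarrow> ('a, 'e, 'n) triv set \<Rightarrow> ('a \<Rightarrow> real ^ 'n \<Rightarrow> 'e) \<Rightarrow>
    (('a \<Rightarrow> real ^ 'n) \<Rightarrow> ('a \<Rightarrow> 'e) \<Rightarrow> 'a \<Rightarrow> 'e) \<Rightarrow> bool" where
  "coherent_tangent_bundle \<A> E \<T> \<phi> D \<longleftrightarrow>
     vector_bundle \<A> E \<T> \<and> bundle_map \<A> E \<T> \<phi> \<and>
     connection \<A> E \<T> UNIV D \<and> relatively_torsion_free \<A> UNIV \<phi> D"

definition projectively_equivalent :: "('a::topological_space, 'n::finite) chart set \<Rightarrow>
    ('a \<Rightarrow> 'e::real_vector set) \<Rightarrow> ('a, 'e, 'n) triv set \<Rightarrow> ('a \<Rightarrow> real ^ 'n \<Rightarrow> 'e) \<Rightarrow> 'a set \<Rightarrow>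
    (('a \<Rightarrow> real ^ 'n) \<Rightarrow> ('a \<Rightarrow> 'e) \<Rightarrow> 'a \<Rightarrow> 'e) \<Rightarrow>
    (('a \<Rightarrow> real ^ 'n) \<Rightarrow> ('a \<Rightarrow> 'e) \<Rightarrow> 'a \<Rightarrow> 'e) \<Rightarrow> bool" where
  "projectively_equivalent \<A> E \<T> \<phi> U D D' \<longleftrightarrow>
     connection \<A> E \<T> U D \<and> relatively_torsion_free \<A> U \<phi> D \<and>
     connection \<A> E \<T> U D' \<and> relatively_torsion_free \<A> U \<phi> D' \<and>
     (\<exists>\<rho>\<in>dual_sections \<A> E \<T> U.
        \<forall>X\<in>vector_fields \<A> U. \<forall>\<eta>\<in>sections \<A> E \<T> U. \<forall>p\<in>U.
          D' X \<eta> p = D X \<eta> p + \<rho> p (\<phi> p (X p)) *\<^sub>R \<eta> p + \<rho> p (\<eta> p) *\<^sub>R \<phi> p (X p))"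

definition projectively_flat :: "('a::topological_space, 'n::finite) chart set \<Rightarrow>
    ('a \<Rightarrow> 'e::real_vector set) \<Rightarrow> ('a, 'e, 'n) triv set \<Rightarrow> ('a \<Rightarrow> real ^ 'n \<Rightarrow> 'e) \<Rightarrow>
    (('a \<Rightarrow> real ^ 'n) \<Rightarrow> ('a \<Rightarrow> 'e) \<Rightarrow> 'a \<Rightarrow> 'e) \<Rightarrow> bool" where
  "projectively_flat \<A> E \<T> \<phi> D \<longleftrightarrow>
     (\<forall>p. \<exists>U. open U \<and> p \<in> U \<and>
        (\<exists>D\<^sub>U D'. restricts_to \<A> E \<T> U D D\<^sub>U \<and>
           projectively_equivalent \<A> E \<T> \<phi> U D\<^sub>U D' \<and> flat \<A> E \<T> U D'))"

end

theory Submission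
  imports Defs
begin

text \<open>
  Suppose that two relatively torsion-free connections \<open>D\<close> and \<open>D'\<close> are related by a section
  \<open>\<rho>\<close> of the dual bundle, and put \<open>P(X, \<eta>) = (\<nabla>\<^sub>X \<rho>)(\<eta>) - \<rho>(\<phi> X) \<rho>(\<eta>)\<close>. A direct computation gives
    \<open>R'(X, Y) \<eta> = R(X, Y) \<eta> + (P(X, \<phi> Y) - P(Y, \<phi> X)) \<eta> + P(X, \<eta>) \<phi> Y - P(Y, \<eta>) \<phi> X\<close>.

  If \<open>R' = 0\<close> and \<open>R\<close> is trace free, the trace of this identity is \<open>n + 1\<close> times the coefficient of
  \<open>\<eta>\<close>, which therefore vanishes; so \<open>A = (n - 1) P\<close> satisfies the curvature identity, and the second
  identity of the theorem follows by differentiating \<open>P\<close> covariantly and inserting the curvature identity.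
  This yields \<open>A\<close> only locally. Where \<open>\<phi>\<close> has rank at least 2 the curvature identity determines
  \<open>A\<close>; such points are dense, so by continuity the local tensors agree on overlaps and glue.

  Conversely, given \<open>A\<close>, a local \<open>\<rho>\<close> with \<open>(\<nabla>\<^sub>X \<rho>)(\<eta>) - \<rho>(\<phi> X) \<rho>(\<eta>) = P(X, \<eta>)\<close> for
  \<open>P = A / (n - 1)\<close> is needed. The substitution \<open>\<rho> = - \<tau> / f\<close> turns this quadratic equation into
  the linear total differential equation \<open>\<nabla>\<^sub>X \<tau> = - f P(X, -)\<close>, \<open>X f = \<tau>(\<phi> X)\<close>. Its integrability
  conditions are precisely the two identities satisfied by \<open>A\<close>, the vanishing of the torsion, and the symmetry
  \<open>P(X, \<phi> Y) = P(Y, \<phi> X)\<close>, which is the vanishing of the trace. Hence there is a solution with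
  \<open>\<tau> = 0\<close> and \<open>f = 1\<close> at a given point, and the changed connection is flat by the formula for \<open>R'\<close>.

  The two computations are carried out in a chart and a trivialisation, where a connection becomes its
  coefficients \<open>\<Gamma>\<close> (\<open>local_rep\<close> and \<open>conn_of_connection\<close> pass between the two). The formula for
  \<open>R'\<close> is \<open>curv_proj_change\<close>, the existence of \<open>\<rho>\<close> is \<open>rho_exists\<close>; it rests on the
  Frobenius theorem for linear equations, \<open>linear_total_differential_equation\<close>.
\<close>

section \<open>Calculus of smooth maps\<close>

text \<open>
  Writing the derivative with a fixed direction makes the derivative of a vector valued map another vector valued
  map on the same set, so that it can be iterated without operator valued maps.
\<close>

abbreviation dir_deriv :: "'v::real_normed_vector \<Rightarrow> ('v \<Rightarrow> 'w::real_normed_vector) \<Rightarrow> 'v \<Rightarrow> 'w" ("\<partial>")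
  where "\<partial> a f x \<equiv> frechet_derivative f (at x) a"

lemma has_derivative_dir_deriv:
  "f differentiable (at x) \<Longrightarrow> (f has_derivative (\<lambda>a. \<partial> a f x)) (at x)"
  by (simp add: frechet_derivative_works)

lemma dir_deriv_eq:
  "(f has_derivative f') (at x) \<Longrightarrow> \<partial> a f x = f' a"
  by (metis frechet_derivative_at)

lemma linear_dir_deriv:
  "f differentiable (at x) \<Longrightarrow> linear (\<lambda>a. \<partial> a f x)"
  using has_derivative_dir_deriv has_derivative_linear by blast

lemma differentiable_cong_open:
  assumes "open S" "x \<in> S" "\<And>y. y \<in> S \<Longrightarrow> f y = g y" "f differentiable (at x)"
  shows "g differentiable (at x)"
  using assms has_derivative_transform_within_open unfolding differentiable_def by blast

lemma dir_deriv_cong_open: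
  assumes "open S" "x \<in> S" "\<And>y. y \<in> S \<Longrightarrow> f y = g y"
  shows "\<partial> a f x = \<partial> a g x"
proof -
  have "(f has_derivative D) (at x) \<longleftrightarrow> (g has_derivative D) (at x)" for D
    using assms has_derivative_transform_within_open[of f D x UNIV S g]
       has_derivative_transform_within_open[of g D x UNIV S f] by auto
  then show ?thesis unfolding frechet_derivative_def by simp
qed

lemma Ck_on_cong:
  assumes "open S" "\<And>x. x \<in> S \<Longrightarrow> f x = g x" "Ck_on k S f"
  shows "Ck_on k S g"
  using assms(2,3)
proof (induction k arbitrary: f g)
  case 0
  then show ?case by (auto cong: continuous_on_cong)
next
  case (Suc k)
  have 1: "\<partial> v f x = \<partial> v g x" if "x \<in> S" for x v
    using dir_deriv_cong_open[OF assms(1) that] Suc.prems(1) by blast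
  have "Ck_on k S (\<lambda>x. \<partial> v g x)" for v
    by (rule Suc.IH[of "\<lambda>x. \<partial> v f x"]) (use 1 Suc.prems in auto)
  moreover have "\<forall>x\<in>S. g differentiable (at x)"
    using differentiable_cong_open[OF assms(1)] Suc.prems by (metis Ck_on.simps(2))
  ultimately show ?case by simp
qed

lemma Ck_on_subset: "Ck_on k S f \<Longrightarrow> T \<subseteq> S \<Longrightarrow> Ck_on k T f"
  by (induction k arbitrary: f) (auto intro: continuous_on_subset)

lemma Ck_on_imp_continuous: "Ck_on k S f \<Longrightarrow> continuous_on S f"
  by (cases k) (auto intro!: continuous_at_imp_continuous_on differentiable_imp_continuous_within)

lemma Ck_on_SucD: "Ck_on (Suc k) S f \<Longrightarrow> Ck_on k S f"
proof (induction k arbitrary: f)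
  case 0
  then show ?case using Ck_on_imp_continuous by (metis Ck_on.simps(1))
qed simp

lemma Ck_on_local:
  assumes "\<And>x. x \<in> S \<Longrightarrow> \<exists>T. open T \<and> x \<in> T \<and> Ck_on k T f"
  shows "Ck_on k S f"
  using assms
proof (induction k arbitrary: f)
  case 0
  then show ?case
    unfolding Ck_on.simps by (meson continuous_at_imp_continuous_on continuous_on_eq_continuous_at)
next
  case (Suc k)
  have "f differentiable at x" if "x \<in> S" for x
    using Suc.prems[OF that] by auto
  moreover have "Ck_on k S (\<lambda>x. \<partial> v f x)" for v
    by (rule Suc.IH) (use Suc.prems in fastforce)
  ultimately show ?case by simp
qed

lemma Ck_on_const: "Ck_on k S (\<lambda>x. c)"
  by (induction k arbitrary: c) auto

lemma Ck_on_add: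
  assumes "open S" "Ck_on k S f" "Ck_on k S g"
  shows "Ck_on k S (\<lambda>x. f x + g x)"
  using assms(2,3)
proof (induction k arbitrary: f g)
  case 0
  then show ?case by (auto intro: continuous_intros)
next
  case (Suc k)
  have "Ck_on k S (\<lambda>x. \<partial> v (\<lambda>x. f x + g x) x)" for v
    by (rule Ck_on_cong[OF assms(1) _ Suc.IH[of "\<lambda>x. \<partial> v f x" "\<lambda>x. \<partial> v g x"]])
      (use Suc.prems in \<open>simp_all add: dir_deriv_eq[OF has_derivative_add[OF has_derivative_dir_deriv has_derivative_dir_deriv]]\<close>)
  then show ?case using Suc.prems by simp
qed

lemma Ck_on_bounded_linear:
  assumes "open S" "bounded_linear h" "Ck_on k S f"
  shows "Ck_on k S (\<lambda>x. h (f x))"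
  using assms(3)
proof (induction k arbitrary: f)
  case 0
  then show ?case using bounded_linear.continuous_on[OF assms(2), of S f] by simp
next
  case (Suc k)
  have d: "((\<lambda>x. h (f x)) has_derivative (\<lambda>a. h (\<partial> a f x))) (at x)" if "x \<in> S" for x
    by (rule bounded_linear.has_derivative[OF assms(2) has_derivative_dir_deriv]) (use Suc.prems that in simp)
  have "Ck_on k S (\<lambda>x. \<partial> v (\<lambda>x. h (f x)) x)" for v
    by (rule Ck_on_cong[OF assms(1) _ Suc.IH[of "\<lambda>x. \<partial> v f x"]])
      (use Suc.prems in \<open>simp_all add: dir_deriv_eq[OF d]\<close>)
  moreover have "\<forall>x\<in>S. (\<lambda>x. h (f x)) differentiable (at x)" by (intro ballI Derivative.differentiableI[OF d]) auto
  ultimately show ?case by simp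
qed

lemma Ck_on_bounded_bilinear:
  assumes "open S" "bounded_bilinear h" "Ck_on k S f" "Ck_on k S g"
  shows "Ck_on k S (\<lambda>x. h (f x) (g x))"
  using assms(3,4)
proof (induction k arbitrary: f g)
  case 0
  then show ?case using bounded_bilinear.continuous_on[OF assms(2), of S f g] by simp
next
  case (Suc k)
  have d: "((\<lambda>x. h (f x) (g x)) has_derivative (\<lambda>a. h (f x) (\<partial> a g x) + h (\<partial> a f x) (g x))) (at x)"
    if "x \<in> S" for x
    by (rule bounded_bilinear.FDERIV[OF assms(2) has_derivative_dir_deriv has_derivative_dir_deriv])
       (use Suc.prems that in simp_all)
  have "Ck_on k S (\<lambda>x. \<partial> v (\<lambda>x. h (f x) (g x)) x)" for v
    by (rule Ck_on_cong[OF assms(1) _ Ck_on_add[OF assms(1) Suc.IH[of f "\<lambda>x. \<partial> v g x"]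
            Suc.IH[of "\<lambda>x. \<partial> v f x" g]]])
      (use Suc.prems d Ck_on_SucD[OF Suc.prems(1)] Ck_on_SucD[OF Suc.prems(2)]
        in \<open>simp_all add: dir_deriv_eq[OF d]\<close>)
  moreover have "\<forall>x\<in>S. (\<lambda>x. h (f x) (g x)) differentiable (at x)" by (intro ballI Derivative.differentiableI[OF d]) auto
  ultimately show ?case by simp
qed

lemma Ck_on_sum:
  assumes "open S" "\<And>i. i \<in> I \<Longrightarrow> Ck_on k S (f i)"
  shows "Ck_on k S (\<lambda>x. \<Sum>i\<in>I. f i x)"
  using assms(2)
proof (induction I rule: infinite_finite_induct)
  case (insert i I)
  then show ?case using Ck_on_add[OF assms(1), of k "f i" "\<lambda>x. \<Sum>i\<in>I. f i x"] by simp
qed (simp_all add: Ck_on_const)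

lemma dir_deriv_basis:
  fixes f :: "'v::euclidean_space \<Rightarrow> 'w::real_normed_vector"
  assumes "f differentiable (at x)"
  shows "\<partial> a f x = (\<Sum>b\<in>Basis. (a \<bullet> b) *\<^sub>R \<partial> b f x)"
  by (subst euclidean_representation[of a, symmetric])
     (simp add: linear_sum[OF linear_dir_deriv[OF assms]] linear_scale[OF linear_dir_deriv[OF assms]])

text \<open>
  The chain rule is expanded in a basis: a directional derivative of the composition is a finite sum of products of
  components of derivatives of \<open>g\<close> with compositions \<open>\<partial> b f \<circ> g\<close>, to which the induction hypothesis
  applies.
\<close>

lemma Ck_on_compose:
  fixes g :: "'v::euclidean_space \<Rightarrow> 'u::euclidean_space" and f :: "'u \<Rightarrow> 'w::real_normed_vector"
  assumes "open S" "open T" "g ` S \<subseteq> T" "Ck_on k S g" "Ck_on k T f"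
  shows "Ck_on k S (\<lambda>x. f (g x))"
  using assms(4,5)
proof (induction k arbitrary: f)
  case 0
  then show ?case using continuous_on_compose2[of T f S g] assms(3) by simp
next
  case (Suc k)
  have d: "((\<lambda>x. f (g x)) has_derivative (\<lambda>a. \<partial> (\<partial> a g x) f (g x))) (at x)" if "x \<in> S" for x
    using diff_chain_at[OF has_derivative_dir_deriv[of g x] has_derivative_dir_deriv[of f "g x"]]
      Suc.prems that assms(3) by (auto simp: o_def)
  have "Ck_on k S (\<lambda>x. \<Sum>b\<in>Basis. (\<partial> v g x \<bullet> b) *\<^sub>R \<partial> b f (g x))" for v
    by (intro Ck_on_sum Ck_on_bounded_bilinear[OF assms(1) bounded_bilinear_scaleR]
           Ck_on_bounded_linear[OF _ bounded_linear_inner_left] Suc.IH assms(1))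
       (use Suc.prems Ck_on_SucD[OF Suc.prems(1)] in auto)
  then have "Ck_on k S (\<lambda>x. \<partial> v (\<lambda>x. f (g x)) x)" for v
    by (rule Ck_on_cong[OF assms(1), rotated, where f="\<lambda>x. \<Sum>b\<in>Basis. (\<partial> v g x \<bullet> b) *\<^sub>R \<partial> b f (g x)"])
      (use Suc.prems assms(3) in \<open>auto simp: dir_deriv_eq[OF d] intro!: dir_deriv_basis[symmetric]\<close>)
  moreover have "\<forall>x\<in>S. (\<lambda>x. f (g x)) differentiable (at x)" by (intro ballI Derivative.differentiableI[OF d]) auto
  ultimately show ?case by simp
qed

lemma smooth_onD:
  assumes "smooth_on S f"
  shows "x \<in> S \<Longrightarrow> f differentiable (at x)" "smooth_on S (\<lambda>x. \<partial> v f x)" "continuous_on S f"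
proof -
  have *: "Ck_on k S f" for k using assms by (simp add: smooth_on_def)
  show "x \<in> S \<Longrightarrow> f differentiable (at x)" using *[of "Suc 0"] by simp
  show "smooth_on S (\<lambda>x. \<partial> v f x)" unfolding smooth_on_def using *[of "Suc k" for k] by simp
  show "continuous_on S f" using *[of 0] by simp
qed

lemma smooth_onI:
  assumes "\<And>x. x \<in> S \<Longrightarrow> f differentiable (at x)" "\<And>v. smooth_on S (\<lambda>x. \<partial> v f x)"
  shows "smooth_on S f"
proof -
  have "Ck_on (Suc k) S f" for k using assms unfolding smooth_on_def by simp
  then have "Ck_on k S f" for k by (rule Ck_on_SucD)
  then show ?thesis unfolding smooth_on_def by simp
qed

lemma smooth_on_cong:
  assumes "open S" "\<And>x. x \<in> S \<Longrightarrow> f x = g x" "smooth_on S f"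
  shows "smooth_on S g"
  unfolding smooth_on_def
proof
  fix k
  have "Ck_on k S f" using assms(3) by (simp only: smooth_on_def)
  then show "Ck_on k S g" by (rule Ck_on_cong[OF assms(1), where f=f and g=g, rotated]) (rule assms(2))
qed

lemma smooth_on_subset: "smooth_on S f \<Longrightarrow> T \<subseteq> S \<Longrightarrow> smooth_on T f"
  unfolding smooth_on_def using Ck_on_subset[of _ S f T] by blast

lemma smooth_on_local:
  assumes "\<And>x. x \<in> S \<Longrightarrow> \<exists>T. open T \<and> x \<in> T \<and> smooth_on T f"
  shows "smooth_on S f"
  unfolding smooth_on_def
proof
  fix k
  have "\<exists>T. open T \<and> x \<in> T \<and> Ck_on k T f" if "x \<in> S" for x
    using assms[OF that] by (auto simp only: smooth_on_def)
  then show "Ck_on k S f" by (rule Ck_on_local)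
qed

named_theorems smooth_intros

lemma smooth_on_const [smooth_intros]: "smooth_on S (\<lambda>x. c)"
  by (simp add: smooth_on_def Ck_on_const)

lemma smooth_on_dir_deriv [smooth_intros]: "smooth_on S f \<Longrightarrow> smooth_on S (\<lambda>x. \<partial> v f x)"
  by (rule smooth_onD)

lemma smooth_on_add [smooth_intros]:
  "open S \<Longrightarrow> smooth_on S f \<Longrightarrow> smooth_on S g \<Longrightarrow> smooth_on S (\<lambda>x. f x + g x)"
  unfolding smooth_on_def using Ck_on_add[of S _ f g] by blast

lemma smooth_on_bounded_linear:
  "open S \<Longrightarrow> bounded_linear h \<Longrightarrow> smooth_on S f \<Longrightarrow> smooth_on S (\<lambda>x. h (f x))"
  unfolding smooth_on_def using Ck_on_bounded_linear[of S h _ f] by blast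

lemma smooth_on_bounded_bilinear:
  "open S \<Longrightarrow> bounded_bilinear h \<Longrightarrow> smooth_on S f \<Longrightarrow> smooth_on S g \<Longrightarrow> smooth_on S (\<lambda>x. h (f x) (g x))"
  unfolding smooth_on_def using Ck_on_bounded_bilinear[of S h _ f g] by blast

lemmas smooth_on_minus [smooth_intros] = smooth_on_bounded_linear[OF _ bounded_linear_minus[OF bounded_linear_ident]]
lemmas smooth_on_fst [smooth_intros] = smooth_on_bounded_linear[OF _ bounded_linear_fst]
lemmas smooth_on_snd [smooth_intros] = smooth_on_bounded_linear[OF _ bounded_linear_snd]
lemmas smooth_on_scaleR [smooth_intros] = smooth_on_bounded_bilinear[OF _ bounded_bilinear_scaleR]
lemmas smooth_on_inner [smooth_intros] = smooth_on_bounded_bilinear[OF _ bounded_bilinear_inner]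
lemmas smooth_on_mult [smooth_intros] = smooth_on_bounded_bilinear[OF _ bounded_bilinear_mult]

lemma smooth_on_diff [smooth_intros]:
  "open S \<Longrightarrow> smooth_on S f \<Longrightarrow> smooth_on S g \<Longrightarrow> smooth_on S (\<lambda>x. f x - g x)"
  using smooth_on_add[of S f "\<lambda>x. - g x"] smooth_on_minus[of S g] by simp

lemma smooth_on_sum [smooth_intros]:
  "open S \<Longrightarrow> (\<And>i. i \<in> I \<Longrightarrow> smooth_on S (f i)) \<Longrightarrow> smooth_on S (\<lambda>x. \<Sum>i\<in>I. f i x)"
  unfolding smooth_on_def using Ck_on_sum[of S I _ f] by blast

lemma smooth_on_id [smooth_intros]: "smooth_on S (\<lambda>x. x)"
  by (rule smooth_onI) (auto simp: smooth_on_const)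

lemma smooth_on_compose:
  "open S \<Longrightarrow> open T \<Longrightarrow> g ` S \<subseteq> T \<Longrightarrow> smooth_on S g \<Longrightarrow> smooth_on T f \<Longrightarrow> smooth_on S (\<lambda>x. f (g x))"
  unfolding smooth_on_def using Ck_on_compose[of S T g _ f] by blast

lemma smooth_on_Pair [smooth_intros]:
  assumes "open S" "smooth_on S f" "smooth_on S g"
  shows "smooth_on S (\<lambda>x. (f x, g x))"
proof -
  have "smooth_on S (\<lambda>x. (f x, 0) + (0, g x))"
    by (intro smooth_on_add smooth_on_bounded_linear[OF _ _ assms(2)] smooth_on_bounded_linear[OF _ _ assms(3)] assms)
      (auto intro!: bounded_linear_Pair bounded_linear_ident bounded_linear_zero)
  then show ?thesis by simp
qed

lemma Ck_on_inverse: "Ck_on k (- {0}) (inverse :: real \<Rightarrow> real)"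
proof (induction k)
  case 0
  then show ?case by (auto intro!: continuous_intros)
next
  case (Suc k)
  have d: "((inverse :: real \<Rightarrow> real) has_derivative (\<lambda>a. - (inverse x * a * inverse x))) (at x)"
    if "x \<noteq> 0" for x :: real
    by (rule has_derivative_inverse'[OF that])
  have o: "open (- {0::real})" by auto
  have "Ck_on k (-{0}) (\<lambda>x. (- v) * (inverse x * inverse x))" for v :: real
    by (intro Ck_on_bounded_bilinear[OF o bounded_bilinear_mult] Suc Ck_on_const)
  then have "Ck_on k (-{0}) (\<lambda>x. \<partial> v inverse x)" for v :: real
    by (rule Ck_on_cong[OF o, rotated]) (simp add: dir_deriv_eq[OF d])
  moreover have "\<forall>x\<in>-{0}. (inverse :: real \<Rightarrow> real) differentiable (at x)" by (intro ballI Derivative.differentiableI[OF d]) auto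
  ultimately show ?case by simp
qed

lemma smooth_on_inverse [smooth_intros]:
  fixes f :: "'v::euclidean_space \<Rightarrow> real"
  assumes "open S" "smooth_on S f" "\<And>x. x \<in> S \<Longrightarrow> f x \<noteq> 0"
  shows "smooth_on S (\<lambda>x. inverse (f x))"
proof -
  have "smooth_on (- {0}) (inverse :: real \<Rightarrow> real)" by (simp add: smooth_on_def Ck_on_inverse)
  moreover have "f ` S \<subseteq> - {0}" using assms(3) by auto
  ultimately show ?thesis
    using smooth_on_compose[of S "- {0}" f inverse] assms(1,2) by auto
qed

subsection \<open>Derivative rules\<close>

lemma dir_deriv_add:
  "f differentiable (at x) \<Longrightarrow> g differentiable (at x) \<Longrightarrow> \<partial> a (\<lambda>x. f x + g x) x = \<partial> a f x + \<partial> a g x"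
  by (rule dir_deriv_eq[OF has_derivative_add[OF has_derivative_dir_deriv has_derivative_dir_deriv]])

lemma dir_deriv_linear:
  "bounded_linear h \<Longrightarrow> f differentiable (at x) \<Longrightarrow> \<partial> a (\<lambda>x. h (f x)) x = h (\<partial> a f x)"
  by (rule dir_deriv_eq[OF bounded_linear.has_derivative[OF _ has_derivative_dir_deriv]])

lemma dir_deriv_bilinear:
  "bounded_bilinear h \<Longrightarrow> f differentiable (at x) \<Longrightarrow> g differentiable (at x) \<Longrightarrow>
    \<partial> a (\<lambda>x. h (f x) (g x)) x = h (f x) (\<partial> a g x) + h (\<partial> a f x) (g x)"
  by (rule dir_deriv_eq[OF bounded_bilinear.FDERIV[OF _ has_derivative_dir_deriv has_derivative_dir_deriv]])

lemma dir_deriv_compose: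
  "g differentiable (at x) \<Longrightarrow> f differentiable (at (g x)) \<Longrightarrow>
     \<partial> a (\<lambda>x. f (g x)) x = \<partial> (\<partial> a g x) f (g x)"
  using dir_deriv_eq[OF diff_chain_at[OF has_derivative_dir_deriv has_derivative_dir_deriv]]
  by (simp add: o_def)


subsection \<open>Second derivatives are symmetric\<close>

text \<open>
  The mean value theorem, applied first along \<open>a\<close> and then along \<open>b\<close>, turns the second difference into a
  mixed derivative at a nearby point. As the second difference is symmetric in \<open>a\<close> and \<open>b\<close>, letting
  \<open>t\<close> tend to 0 shows that mixed derivatives commute.
\<close>

lemma second_difference_mean_value:
  fixes f :: "'v::euclidean_space \<Rightarrow> real"
  assumes f: "smooth_on (ball x r) f" and t: "0 < t" "t * (norm a + norm b) < r"
  shows "\<exists>s\<in>{0..t}. \<exists>s'\<in>{0..t}. f (x + t *\<^sub>R a + t *\<^sub>R b) - f (x + t *\<^sub>R a) - f (x + t *\<^sub>R b) + f x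
           = t * (t * \<partial> b (\<lambda>y. \<partial> a f y) (x + s *\<^sub>R a + s' *\<^sub>R b))"
proof -
  have inb: "x + s *\<^sub>R a + s' *\<^sub>R b \<in> ball x r" if "0 \<le> s" "s \<le> t" "0 \<le> s'" "s' \<le> t" for s s'
  proof -
    have "norm (s *\<^sub>R a + s' *\<^sub>R b) \<le> s * norm a + s' * norm b"
      using norm_triangle_ineq[of "s *\<^sub>R a" "s' *\<^sub>R b"] that by simp
    also have "\<dots> \<le> t * norm a + t * norm b"
      by (intro add_mono mult_right_mono) (use that in auto)
    also have "\<dots> < r" using t by (simp add: algebra_simps)
    finally have "norm (s *\<^sub>R a + s' *\<^sub>R b) < r" .
    moreover have "dist (x + s *\<^sub>R a + s' *\<^sub>R b) x = norm (s *\<^sub>R a + s' *\<^sub>R b)"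
      by (simp add: dist_norm add.assoc)
    ultimately show ?thesis by (simp add: dist_commute)
  qed
  have line: "((\<lambda>s. g (y + s *\<^sub>R v)) has_real_derivative \<partial> v g (y + s *\<^sub>R v)) (at s)"
    if "g differentiable (at (y + s *\<^sub>R v))" for g :: "'v \<Rightarrow> real" and y v s
  proof -
    have "((\<lambda>s. y + s *\<^sub>R v) has_derivative (\<lambda>h. h *\<^sub>R v)) (at s)" for s :: real
      by (auto intro!: derivative_eq_intros)
    from diff_chain_at[OF this has_derivative_dir_deriv[OF that]]
    have "((\<lambda>s. g (y + s *\<^sub>R v)) has_derivative (\<lambda>h. \<partial> (h *\<^sub>R v) g (y + s *\<^sub>R v))) (at s)"
      by (simp add: o_def)
    then show ?thesis
      unfolding has_field_derivative_def
      by (rule has_derivative_eq_rhs) (simp add: fun_eq_iff linear_scale[OF linear_dir_deriv[OF that]])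
  qed
  define \<phi> where "\<phi> s = f ((x + t *\<^sub>R b) + s *\<^sub>R a) - f (x + s *\<^sub>R a)" for s
  have d1: "(\<phi> has_real_derivative (\<partial> a f ((x + t *\<^sub>R b) + s *\<^sub>R a) - \<partial> a f (x + s *\<^sub>R a))) (at s)"
    if "0 \<le> s" "s \<le> t" for s
    unfolding \<phi>_def
    by (intro DERIV_diff line smooth_onD(1)[OF f])
       (use inb[of s t] inb[of s 0] that t in \<open>simp_all add: algebra_simps\<close>)
  obtain s where s: "0 < s" "s < t"
    "\<phi> t - \<phi> 0 = t * (\<partial> a f ((x + t *\<^sub>R b) + s *\<^sub>R a) - \<partial> a f (x + s *\<^sub>R a))"
    using MVT2[OF t(1), of \<phi>, OF d1] by auto
  define \<psi> where "\<psi> s' = \<partial> a f (x + s *\<^sub>R a + s' *\<^sub>R b)" for s'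
  have d2: "(\<psi> has_real_derivative \<partial> b (\<lambda>y. \<partial> a f y) (x + s *\<^sub>R a + s' *\<^sub>R b)) (at s')"
    if "0 \<le> s'" "s' \<le> t" for s'
    unfolding \<psi>_def
    by (intro line smooth_onD(1)[OF smooth_on_dir_deriv[OF f]]) (use inb[of s s'] that s in simp)
  obtain s' where s': "0 < s'" "s' < t"
    "\<psi> t - \<psi> 0 = t * \<partial> b (\<lambda>y. \<partial> a f y) (x + s *\<^sub>R a + s' *\<^sub>R b)"
    using MVT2[OF t(1), of \<psi>, OF d2] by auto
  have "\<phi> t - \<phi> 0 = t * (\<psi> t - \<psi> 0)"
    using s(3) by (simp add: \<psi>_def algebra_simps)
  moreover have "f (x + t *\<^sub>R a + t *\<^sub>R b) - f (x + t *\<^sub>R a) - f (x + t *\<^sub>R b) + f x = \<phi> t - \<phi> 0"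
    by (simp add: \<phi>_def algebra_simps)
  ultimately show ?thesis using s s' by (intro bexI[of _ s] bexI[of _ s']) auto
qed

lemma dir_deriv_commute_real:
  fixes f :: "'v::euclidean_space \<Rightarrow> real"
  assumes "open S" "smooth_on S f" "x \<in> S"
  shows "\<partial> a (\<lambda>y. \<partial> b f y) x = \<partial> b (\<lambda>y. \<partial> a f y) x"
proof (rule ccontr)
  define g where "g = (\<lambda>x. \<partial> b (\<lambda>y. \<partial> a f y) x)"
  define h where "h = (\<lambda>x. \<partial> a (\<lambda>y. \<partial> b f y) x)"
  assume "\<partial> a (\<lambda>y. \<partial> b f y) x \<noteq> \<partial> b (\<lambda>y. \<partial> a f y) x"
  then have e: "\<bar>g x - h x\<bar> / 2 > 0" (is "?e > 0") by (auto simp: g_def h_def)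
  have cont: "continuous (at x) g" "continuous (at x) h"
    unfolding g_def h_def
    by (rule differentiable_imp_continuous_within smooth_onD(1) smooth_intros assms)+
  obtain d1 where d1: "d1 > 0" "\<And>y. dist y x < d1 \<Longrightarrow> dist (g y) (g x) < ?e"
    using cont(1) e unfolding continuous_at_eps_delta by (metis dist_norm real_norm_def)
  obtain d2 where d2: "d2 > 0" "\<And>y. dist y x < d2 \<Longrightarrow> dist (h y) (h x) < ?e"
    using cont(2) e unfolding continuous_at_eps_delta by (metis dist_norm real_norm_def)
  obtain d3 where d3: "d3 > 0" "ball x d3 \<subseteq> S"
    using assms(1,3) openE by blast
  define r where "r = min d1 (min d2 d3)"
  have r: "r > 0" "r \<le> d1" "r \<le> d2" "r \<le> d3" using d1 d2 d3 by (auto simp: r_def)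
  define t where "t = r / (norm a + norm b + 1)"
  have n: "norm a + norm b + 1 > 0" by (smt (verit) norm_ge_zero)
  have t: "0 < t" "t * (norm a + norm b) < r"
    using r n by (auto simp: t_def field_simps)
  have sm: "smooth_on (ball x r) f"
    using smooth_on_subset[OF assms(2)] d3 r by (meson order_trans subset_ball)
  obtain s s' where 1: "s \<in> {0..t}" "s' \<in> {0..t}"
    "f (x + t *\<^sub>R a + t *\<^sub>R b) - f (x + t *\<^sub>R a) - f (x + t *\<^sub>R b) + f x = t * (t * g (x + s *\<^sub>R a + s' *\<^sub>R b))"
    using second_difference_mean_value[OF sm t] unfolding g_def by blast
  obtain s1 s1' where 2: "s1 \<in> {0..t}" "s1' \<in> {0..t}"
    "f (x + t *\<^sub>R b + t *\<^sub>R a) - f (x + t *\<^sub>R b) - f (x + t *\<^sub>R a) + f x = t * (t * h (x + s1 *\<^sub>R b + s1' *\<^sub>R a))"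
    using second_difference_mean_value[OF sm t(1), of b a] t(2) unfolding h_def by (auto simp: add.commute)
  have eq: "g (x + s *\<^sub>R a + s' *\<^sub>R b) = h (x + s1 *\<^sub>R b + s1' *\<^sub>R a)"
  proof -
    have "t * (t * g (x + s *\<^sub>R a + s' *\<^sub>R b)) = t * (t * h (x + s1 *\<^sub>R b + s1' *\<^sub>R a))"
      unfolding 1(3)[symmetric] 2(3)[symmetric] by (simp add: algebra_simps)
    then show ?thesis using t(1) by simp
  qed
  have near: "dist (x + s *\<^sub>R v + s' *\<^sub>R w) x < r"
    if "s \<in> {0..t}" "s' \<in> {0..t}" "norm v + norm w = norm a + norm b" for s s' :: real and v w
  proof -
    have "norm (s *\<^sub>R v + s' *\<^sub>R w) \<le> s * norm v + s' * norm w"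
      using norm_triangle_ineq[of "s *\<^sub>R v" "s' *\<^sub>R w"] that by simp
    also have "\<dots> \<le> t * norm v + t * norm w"
      by (intro add_mono mult_right_mono) (use that in auto)
    also have "\<dots> < r" using t that(3) by (metis distrib_left)
    finally show ?thesis by (simp add: dist_norm add.assoc)
  qed
  have "dist (g (x + s *\<^sub>R a + s' *\<^sub>R b)) (g x) < ?e"
    using d1(2) near[of s s' a b] 1 r by force
  moreover have "dist (h (x + s1 *\<^sub>R b + s1' *\<^sub>R a)) (h x) < ?e"
    using d2(2) near[of s1 s1' b a] 2 r by force
  ultimately have "\<bar>G - g x\<bar> < ?e" "\<bar>G - h x\<bar> < ?e" if "G = g (x + s *\<^sub>R a + s' *\<^sub>R b)" for G
    using eq that by (simp_all add: dist_real_def)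
  then show False by (smt (verit) field_sum_of_halves)
qed

lemma dir_deriv_commute:
  fixes f :: "'v::euclidean_space \<Rightarrow> 'w::euclidean_space"
  assumes "open S" "smooth_on S f" "x \<in> S"
  shows "\<partial> a (\<lambda>y. \<partial> b f y) x = \<partial> b (\<lambda>y. \<partial> a f y) x"
proof (rule euclidean_eqI)
  fix k :: 'w assume "k \<in> Basis"
  have comp: "\<partial> a (\<lambda>y. \<partial> b f y) x \<bullet> k = \<partial> a (\<lambda>y. \<partial> b (\<lambda>z. f z \<bullet> k) y) x" for a b
  proof -
    have "\<partial> a (\<lambda>y. \<partial> b f y) x \<bullet> k = \<partial> a (\<lambda>y. \<partial> b f y \<bullet> k) x"
      by (rule dir_deriv_linear[OF bounded_linear_inner_left, symmetric])
         (rule smooth_onD(1)[OF smooth_on_dir_deriv[OF assms(2)] assms(3)])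
    also have "\<dots> = \<partial> a (\<lambda>y. \<partial> b (\<lambda>z. f z \<bullet> k) y) x"
      by (rule dir_deriv_cong_open[OF assms(1,3)])
         (rule dir_deriv_linear[OF bounded_linear_inner_left, symmetric], rule smooth_onD(1)[OF assms(2)])
    finally show ?thesis .
  qed
  show "\<partial> a (\<lambda>y. \<partial> b f y) x \<bullet> k = \<partial> b (\<lambda>y. \<partial> a f y) x \<bullet> k"
    unfolding comp
    by (rule dir_deriv_commute_real[OF assms(1) _ assms(3)]) (intro smooth_intros assms)
qed

subsection \<open>Smooth bump functions\<close>

text \<open>
  The case \<open>m = 0\<close> is the classical function \<open>exp (- 1 / t)\<close> that is flat at 0. The factors \<open>t\<^sup>-\<^sup>m\<close> make the
  family closed under linear combinations of derivatives, so that one induction yields all orders.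
\<close>

definition flat_exp :: "nat \<Rightarrow> real \<Rightarrow> real" where
  "flat_exp m t = (if t > 0 then inverse t ^ m * exp (- inverse t) else 0)"

lemma flat_exp_tendsto: "(flat_exp m \<longlongrightarrow> 0) (at_right 0)"
proof -
  have "((\<lambda>t. inverse t ^ m / exp (inverse t)) \<longlongrightarrow> 0) (at_right (0::real))"
    using filterlim_compose[OF tendsto_power_div_exp_0 filterlim_inverse_at_top_right] .
  then show ?thesis
    by (rule Lim_transform_eventually)
       (auto simp: eventually_at_right_less flat_exp_def exp_minus divide_inverse eventually_at_filter)
qed

text \<open>
  On the right, the difference quotient of \<open>flat_exp m\<close> at 0 is \<open>flat_exp (Suc m)\<close>, which tends to 0.
\<close>

lemma flat_exp_deriv_0: "(flat_exp m has_real_derivative 0) (at 0)"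
proof -
  have "((\<lambda>h. (flat_exp m h - flat_exp m 0) / h) \<longlongrightarrow> 0) (at_right 0)"
    by (rule Lim_transform_eventually[OF flat_exp_tendsto[of "Suc m"]])
       (auto simp: eventually_at_filter flat_exp_def divide_inverse)
  moreover have "((\<lambda>h. (flat_exp m h - flat_exp m 0) / h) \<longlongrightarrow> 0) (at_left 0)"
    by (rule Lim_transform_eventually[OF tendsto_const])
       (auto simp: eventually_at_filter flat_exp_def)
  ultimately show ?thesis
    unfolding has_field_derivative_iff by (simp add: filterlim_split_at)
qed

lemma flat_exp_deriv:
  "(flat_exp m has_real_derivative (flat_exp (Suc (Suc m)) t - real m * flat_exp (Suc m) t)) (at t)"
proof -
  consider "t = 0" | "t < 0" | "t > 0" by linarith
  then show ?thesis
  proof cases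
    case 1
    then show ?thesis using flat_exp_deriv_0[of m] by (simp add: flat_exp_def)
  next
    case 2
    have "((\<lambda>t. 0) has_real_derivative 0) (at t)" by simp
    then have "(flat_exp m has_real_derivative 0) (at t)"
      by (rule has_field_derivative_transform_within_open[of _ _ _ "{..<0}"]) (use 2 in \<open>auto simp: flat_exp_def\<close>)
    then show ?thesis using 2 by (simp add: flat_exp_def)
  next
    case 3
    define u E where "u = inverse t" and "E = exp (- u)"
    have i: "(inverse has_real_derivative - (u * u)) (at t)"
      using DERIV_inverse[of t UNIV] 3 by (simp add: u_def power2_eq_square power_Suc numeral_2_eq_2)
    have p: "((\<lambda>t. inverse t ^ m) has_real_derivative real m * (- (u * u) * u ^ (m - Suc 0))) (at t)"
      using DERIV_power[OF i, of m] by (simp add: u_def)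
    have e: "((\<lambda>t. exp (- inverse t)) has_real_derivative E * (u * u)) (at t)"
      using DERIV_chain2[OF DERIV_exp DERIV_minus[OF i]] by (simp add: u_def E_def)
    have "real m * (- (u * u) * u ^ (m - Suc 0)) * E + E * (u * u) * u ^ m
        = u ^ Suc (Suc m) * E - real m * (u ^ Suc m * E)"
      by (cases m) (simp_all add: algebra_simps)
    note eq = this
    have "((\<lambda>t. inverse t ^ m * exp (- inverse t)) has_real_derivative
        (real m * (- (u * u) * u ^ (m - Suc 0)) * E + E * (u * u) * u ^ m)) (at t)"
      using DERIV_mult[OF p e] by (simp only: u_def E_def)
    then have "((\<lambda>t. inverse t ^ m * exp (- inverse t)) has_real_derivative
           (inverse t ^ Suc (Suc m) * exp (- inverse t) - real m * (inverse t ^ Suc m * exp (- inverse t)))) (at t)"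
      unfolding eq by (simp only: u_def E_def)
    then have "(flat_exp m has_real_derivative
           (inverse t ^ Suc (Suc m) * exp (- inverse t) - real m * (inverse t ^ Suc m * exp (- inverse t)))) (at t)"
      by (rule has_field_derivative_transform_within_open[of _ _ _ "{0<..}"]) (use 3 in \<open>auto simp: flat_exp_def\<close>)
    then show ?thesis using 3 by (simp add: flat_exp_def)
  qed
qed

lemma smooth_on_flat_exp: "smooth_on UNIV (flat_exp m)"
  unfolding smooth_on_def
proof
  fix k show "Ck_on k UNIV (flat_exp m)"
  proof (induction k arbitrary: m)
    case 0
    show ?case
      by (auto intro!: continuous_at_imp_continuous_on DERIV_isCont[OF flat_exp_deriv])
  next
    case (Suc k)
    have d: "(flat_exp m has_derivative (\<lambda>h. (flat_exp (Suc (Suc m)) t + (- real m) * flat_exp (Suc m) t) * h)) (at t)" for t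
      using flat_exp_deriv[of m t] by (simp add: has_field_derivative_def)
    have "Ck_on k UNIV (\<lambda>t. (flat_exp (Suc (Suc m)) t + (- real m) * flat_exp (Suc m) t) * h)" for h
      by (rule Ck_on_bounded_bilinear[OF open_UNIV bounded_bilinear_mult Ck_on_add[OF open_UNIV Suc.IH
             Ck_on_bounded_bilinear[OF open_UNIV bounded_bilinear_mult Ck_on_const Suc.IH]] Ck_on_const])
    then have "Ck_on k UNIV (\<lambda>t. \<partial> h (flat_exp m) t)" for h
      by (simp only: dir_deriv_eq[OF d])
    moreover have "flat_exp m differentiable (at t)" for t
      using d by (rule Derivative.differentiableI)
    ultimately show ?case by simp
  qed
qed

lemma smooth_bump:
  fixes x0 :: "'v::euclidean_space"
  assumes "0 < r" "r < s"
  obtains \<beta> :: "'v \<Rightarrow> real" where "smooth_on UNIV \<beta>" "\<And>x. x \<in> ball x0 r \<Longrightarrow> \<beta> x = 1" "\<And>x. x \<notin> ball x0 s \<Longrightarrow> \<beta> x = 0"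
proof
  \<comment> \<open>With \<open>f\<close> vanishing exactly on the nonpositive reals, at least one of the two summands of the denominator is positive everywhere.\<close>
  define q where "q x = (x - x0) \<bullet> (x - x0)" for x
  have q: "q x < t ^ 2 \<longleftrightarrow> x \<in> ball x0 t" if "t > 0" for t x
    using that by (simp add: q_def dist_norm norm_minus_commute power2_norm_eq_inner[symmetric] abs_le_square_iff not_le[symmetric])
  define f where "f = flat_exp 0"
  have f0: "f t \<ge> 0" "f t > 0 \<longleftrightarrow> t > 0" for t by (auto simp: f_def flat_exp_def)
  define \<beta> where "\<beta> x = f (s\<^sup>2 - q x) * inverse (f (s\<^sup>2 - q x) + f (q x - r\<^sup>2))" for x
  have rs: "r\<^sup>2 < s\<^sup>2" using assms by (simp add: power_strict_mono)
  have pos: "f (s\<^sup>2 - q x) + f (q x - r\<^sup>2) > 0" for x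
  proof (cases "q x < s\<^sup>2")
    case True
    then have "f (s\<^sup>2 - q x) > 0" using f0 by simp
    then show ?thesis using f0(1)[of "q x - r\<^sup>2"] by simp
  next
    case False
    then have "f (q x - r\<^sup>2) > 0" using f0 rs by simp
    then show ?thesis using f0(1)[of "s\<^sup>2 - q x"] by simp
  qed
  have sq: "smooth_on UNIV q" unfolding q_def by (intro smooth_intros) auto
  have s1: "smooth_on UNIV (\<lambda>x. f (s\<^sup>2 - q x))"
    by (rule smooth_on_compose[where T=UNIV and f=f])
       (auto intro!: smooth_intros sq simp: f_def smooth_on_flat_exp)
  have s2: "smooth_on UNIV (\<lambda>x. f (q x - r\<^sup>2))"
    by (rule smooth_on_compose[where T=UNIV and f=f])
       (auto intro!: smooth_intros sq simp: f_def smooth_on_flat_exp)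
  show "smooth_on UNIV \<beta>"
    unfolding \<beta>_def using pos
    by (intro smooth_intros s1 s2 open_UNIV) (metis less_irrefl)
  show "\<beta> x = 1" if "x \<in> ball x0 r" for x
  proof -
    have "q x < r\<^sup>2" using q[of r x] assms that by simp
    then have "f (q x - r\<^sup>2) = 0" "f (s\<^sup>2 - q x) > 0" using f0(2)[of "s\<^sup>2 - q x"] rs by (auto simp: f_def flat_exp_def)
    then show ?thesis by (simp add: \<beta>_def)
  qed
  show "\<beta> x = 0" if "x \<notin> ball x0 s" for x
  proof -
    have "\<not> q x < s\<^sup>2" using q[of s x] assms that by simp
    then have "f (s\<^sup>2 - q x) = 0" by (auto simp: f_def flat_exp_def)
    then show ?thesis by (simp add: \<beta>_def)
  qed
qed

section \<open>Smooth families of linear and bilinear maps\<close>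

lemma linear_expand:
  fixes L :: "'u::euclidean_space \<Rightarrow> 'w::real_vector"
  assumes "linear L"
  shows "L v = (\<Sum>b\<in>Basis. (v \<bullet> b) *\<^sub>R L b)"
  by (metis (no_types, lifting) assms euclidean_representation linear_scale linear_sum sum.cong)

text \<open>
  The product rule for evaluating a family of linear maps at a moving argument. Only the maps \<open>\<lambda>y. L y v\<close> with
  \<open>v\<close> fixed are assumed to be differentiable; expanding the argument in a basis reduces the claim to the product
  rule for scalars.
\<close>

lemma has_derivative_linear_family:
  fixes L :: "'v::euclidean_space \<Rightarrow> 'u::euclidean_space \<Rightarrow> 'w::real_normed_vector"
  assumes S: "open S" "x \<in> S" and lin: "\<And>y. y \<in> S \<Longrightarrow> linear (L y)"
    and L: "\<And>v. (\<lambda>y. L y v) differentiable (at x)" and f: "f differentiable (at x)"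
  shows "((\<lambda>y. L y (f y)) has_derivative (\<lambda>a. \<partial> a (\<lambda>y. L y (f x)) x + L x (\<partial> a f x))) (at x)"
proof -
  have "((\<lambda>y. \<Sum>b\<in>Basis. (f y \<bullet> b) *\<^sub>R L y b) has_derivative
     (\<lambda>a. \<Sum>b\<in>Basis. (f x \<bullet> b) *\<^sub>R \<partial> a (\<lambda>y. L y b) x + (\<partial> a f x \<bullet> b) *\<^sub>R L x b)) (at x)"
    by (rule has_derivative_sum has_derivative_scaleR has_derivative_inner_left
          has_derivative_dir_deriv L f)+
  moreover have "\<partial> a (\<lambda>y. L y (f x)) x = (\<Sum>b\<in>Basis. (f x \<bullet> b) *\<^sub>R \<partial> a (\<lambda>y. L y b) x)" for a
  proof -
    have "((\<lambda>y. \<Sum>b\<in>Basis. (f x \<bullet> b) *\<^sub>R L y b) has_derivative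
       (\<lambda>a. \<Sum>b\<in>Basis. (f x \<bullet> b) *\<^sub>R \<partial> a (\<lambda>y. L y b) x)) (at x)"
      by (rule has_derivative_sum has_derivative_scaleR_right has_derivative_dir_deriv L)+
    then have "((\<lambda>y. L y (f x)) has_derivative
       (\<lambda>a. \<Sum>b\<in>Basis. (f x \<bullet> b) *\<^sub>R \<partial> a (\<lambda>y. L y b) x)) (at x)"
      by (rule has_derivative_transform_within_open[OF _ S]) (simp add: linear_expand[OF lin, symmetric])
    then show ?thesis by (rule dir_deriv_eq)
  qed
  ultimately have "((\<lambda>y. \<Sum>b\<in>Basis. (f y \<bullet> b) *\<^sub>R L y b) has_derivative
     (\<lambda>a. \<partial> a (\<lambda>y. L y (f x)) x + L x (\<partial> a f x))) (at x)"
    by (simp add: sum.distrib linear_expand[OF lin[OF S(2)], symmetric])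
  then show ?thesis
    by (rule has_derivative_transform_within_open[OF _ S]) (simp add: linear_expand[OF lin, symmetric])
qed

lemma dir_deriv_linear_family:
  fixes L :: "'v::euclidean_space \<Rightarrow> 'u::euclidean_space \<Rightarrow> 'w::real_normed_vector"
  assumes "open S" "x \<in> S" "\<And>y. y \<in> S \<Longrightarrow> linear (L y)"
    and "\<And>v. smooth_on S (\<lambda>y. L y v)" "smooth_on S f"
  shows "\<partial> a (\<lambda>y. L y (f y)) x = \<partial> a (\<lambda>y. L y (f x)) x + L x (\<partial> a f x)"
  by (rule dir_deriv_eq[OF has_derivative_linear_family[OF assms(1-3)]])
     (use assms in \<open>auto intro: smooth_onD\<close>)

lemma smooth_on_linear_family:
  fixes L :: "'v::euclidean_space \<Rightarrow> 'u::euclidean_space \<Rightarrow> 'w::real_normed_vector"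
  assumes "open S" "\<And>y. y \<in> S \<Longrightarrow> linear (L y)"
    and "\<And>v. smooth_on S (\<lambda>y. L y v)" "smooth_on S f"
  shows "smooth_on S (\<lambda>y. L y (f y))"
proof -
  have "smooth_on S (\<lambda>y. \<Sum>b\<in>Basis. (f y \<bullet> b) *\<^sub>R L y b)"
    by (intro smooth_intros assms)
  then show ?thesis
    by (rule smooth_on_cong[OF assms(1), rotated]) (simp add: linear_expand[OF assms(2), symmetric])
qed

text \<open>
  Fixing one argument at a time, this is the linear case twice.
\<close>

lemma has_derivative_bilinear_family:
  fixes F :: "'v::euclidean_space \<Rightarrow> 'u::euclidean_space \<Rightarrow> 'z::euclidean_space \<Rightarrow> 'w::real_normed_vector"
  assumes S: "open S" "x \<in> S" and bil: "\<And>y. y \<in> S \<Longrightarrow> bilinear (F y)"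
    and F: "\<And>u v. (\<lambda>y. F y u v) differentiable (at x)"
    and f: "f differentiable (at x)" and g: "g differentiable (at x)"
  shows "((\<lambda>y. F y (f y) (g y)) has_derivative
     (\<lambda>a. \<partial> a (\<lambda>y. F y (f x) (g x)) x + F x (\<partial> a f x) (g x) + F x (f x) (\<partial> a g x))) (at x)"
proof -
  have lin1: "linear (\<lambda>u. F y u v)" and lin2: "linear (F y u)" if "y \<in> S" for y u v
    using bil[OF that] by (auto simp: bilinear_def)
  have 1: "((\<lambda>y. F y (f y) v) has_derivative
     (\<lambda>a. \<partial> a (\<lambda>y. F y (f x) v) x + F x (\<partial> a f x) v)) (at x)" for v
    by (rule has_derivative_linear_family[where L="\<lambda>y u. F y u v", OF S]) (auto intro: lin1 F f)
  have "((\<lambda>y. F y (f y) (g y)) has_derivative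
     (\<lambda>a. \<partial> a (\<lambda>y. F y (f y) (g x)) x + F x (f x) (\<partial> a g x))) (at x)"
    by (rule has_derivative_linear_family[where L="\<lambda>y u. F y (f y) u", OF S])
       (auto intro: lin2 g Derivative.differentiableI[OF 1])
  then show ?thesis by (simp add: dir_deriv_eq[OF 1])
qed

lemma dir_deriv_bilinear_family:
  fixes F :: "'v::euclidean_space \<Rightarrow> 'u::euclidean_space \<Rightarrow> 'z::euclidean_space \<Rightarrow> 'w::real_normed_vector"
  assumes "open S" "x \<in> S" "\<And>y. y \<in> S \<Longrightarrow> bilinear (F y)"
    and "\<And>u v. smooth_on S (\<lambda>y. F y u v)" "smooth_on S f" "smooth_on S g"
  shows "\<partial> a (\<lambda>y. F y (f y) (g y)) x
     = \<partial> a (\<lambda>y. F y (f x) (g x)) x + F x (\<partial> a f x) (g x) + F x (f x) (\<partial> a g x)"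
  by (rule dir_deriv_eq[OF has_derivative_bilinear_family[OF assms(1-3)]])
     (use assms in \<open>auto intro: smooth_onD\<close>)

lemma smooth_on_bilinear_family:
  fixes F :: "'v::euclidean_space \<Rightarrow> 'u::euclidean_space \<Rightarrow> 'z::euclidean_space \<Rightarrow> 'w::real_normed_vector"
  assumes "open S" "\<And>y. y \<in> S \<Longrightarrow> bilinear (F y)"
    and "\<And>u v. smooth_on S (\<lambda>y. F y u v)" "smooth_on S f" "smooth_on S g"
  shows "smooth_on S (\<lambda>y. F y (f y) (g y))"
proof (rule smooth_on_linear_family[where L="\<lambda>y u. F y (f y) u", OF assms(1) _ _ assms(5)])
  show "linear (F y (f y))" if "y \<in> S" for y using assms(2)[OF that] by (auto simp: bilinear_def)
  show "smooth_on S (\<lambda>y. F y (f y) v)" for v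
    by (rule smooth_on_linear_family[where L="\<lambda>y u. F y u v", OF assms(1) _ assms(3,4)])
       (use assms(2) in \<open>auto simp: bilinear_def\<close>)
qed

lemma bilinear_expand:
  fixes L :: "'u::euclidean_space \<Rightarrow> 'z::euclidean_space \<Rightarrow> 'w::real_vector"
  assumes "bilinear L"
  shows "L u v = (\<Sum>b\<in>Basis. \<Sum>c\<in>Basis. ((u \<bullet> b) * (v \<bullet> c)) *\<^sub>R L b c)"
proof -
  have 1: "linear (\<lambda>u. L u v)" "linear (L u)" for u v using assms by (auto simp: bilinear_def)
  have "L u v = (\<Sum>b\<in>Basis. (u \<bullet> b) *\<^sub>R L b v)" by (rule linear_expand[OF 1(1)])
  also have "\<dots> = (\<Sum>b\<in>Basis. (u \<bullet> b) *\<^sub>R (\<Sum>c\<in>Basis. (v \<bullet> c) *\<^sub>R L b c))"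
    by (subst linear_expand[OF 1(2), of _ v]) simp
  finally show ?thesis by (simp add: scaleR_sum_right)
qed

lemma continuous_on_bilinear_family:
  fixes F :: "'v::euclidean_space \<Rightarrow> 'u::euclidean_space \<Rightarrow> 'z::euclidean_space \<Rightarrow> 'w::real_normed_vector"
  assumes bil: "\<And>y. y \<in> S \<Longrightarrow> bilinear (F y)" and F: "\<And>u v. continuous_on S (\<lambda>y. F y u v)"
    and p: "continuous_on A p" "p ` A \<subseteq> S" and fg: "continuous_on A f" "continuous_on A g"
  shows "continuous_on A (\<lambda>z. F (p z) (f z) (g z))"
proof -
  have "continuous_on A (\<lambda>z. F (p z) b c)" for b c
    using continuous_on_compose2[OF F p] .
  then have "continuous_on A (\<lambda>z. \<Sum>b\<in>Basis. \<Sum>c\<in>Basis. ((f z \<bullet> b) * (g z \<bullet> c)) *\<^sub>R F (p z) b c)"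
    by (intro continuous_on_sum continuous_on_scaleR continuous_on_mult continuous_on_inner fg continuous_on_const)
  then show ?thesis
    by (rule continuous_on_eq) (use p(2) in \<open>auto intro!: bilinear_expand[symmetric] bil\<close>)
qed

lemma bounded_bilinear_family:
  fixes F :: "'v::euclidean_space \<Rightarrow> 'u::euclidean_space \<Rightarrow> 'z::euclidean_space \<Rightarrow> 'w::real_normed_vector"
  assumes K: "compact K" and bil: "\<And>y. y \<in> K \<Longrightarrow> bilinear (F y)"
    and F: "\<And>u v. continuous_on K (\<lambda>y. F y u v)"
  shows "\<exists>M\<ge>0. \<forall>x\<in>K. \<forall>u v. norm (F x u v) \<le> M * norm u * norm v"
proof -
  have "\<exists>m\<ge>0. \<forall>x\<in>K. norm (F x b c) \<le> m" for b c
  proof -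
    have "bounded ((\<lambda>y. F y b c) ` K)" using K F compact_continuous_image compact_imp_bounded by blast
    then show ?thesis unfolding bounded_pos by (auto intro: less_imp_le)
  qed
  then obtain m where m: "\<And>b c. m b c \<ge> 0" "\<And>b c x. x \<in> K \<Longrightarrow> norm (F x b c) \<le> m b c"
    by metis
  have "norm (F x u v) \<le> (\<Sum>b\<in>Basis. \<Sum>c\<in>Basis. m b c) * norm u * norm v" if x: "x \<in> K" for x u v
  proof -
    have "norm (F x u v) \<le> (\<Sum>b\<in>Basis. \<Sum>c\<in>Basis. norm (((u \<bullet> b) * (v \<bullet> c)) *\<^sub>R F x b c))"
      unfolding bilinear_expand[OF bil[OF x], of u v]
      by (intro order_trans[OF norm_sum] sum_mono order_refl)
    also have "\<dots> \<le> (\<Sum>b\<in>Basis. \<Sum>c\<in>Basis. (norm u * norm v) * m b c)"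
      unfolding norm_scaleR abs_mult
      by (intro sum_mono mult_mono Basis_le_norm m x) auto
    also have "\<dots> = (\<Sum>b\<in>Basis. \<Sum>c\<in>Basis. m b c) * norm u * norm v"
      by (simp add: sum_distrib_left[symmetric] mult.commute mult.left_commute)
    finally show ?thesis .
  qed
  then show ?thesis by (intro exI[of _ "\<Sum>b\<in>Basis. \<Sum>c\<in>Basis. m b c"]) (auto intro!: sum_nonneg m)
qed

lemma bilinear_dir_deriv_family:
  fixes F :: "'v::euclidean_space \<Rightarrow> 'u::euclidean_space \<Rightarrow> 'z::euclidean_space \<Rightarrow> 'w::real_normed_vector"
  assumes S: "open S" "x \<in> S" and bil: "\<And>y. y \<in> S \<Longrightarrow> bilinear (F y)"
    and F: "\<And>u v. smooth_on S (\<lambda>y. F y u v)"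
  shows "bilinear (\<lambda>u v. \<partial> a (\<lambda>y. F y u v) x)"
proof -
  note d = smooth_onD(1)[OF F S(2)]
  have 1: "\<partial> a (\<lambda>y. F y (u + u') v) x = \<partial> a (\<lambda>y. F y u v) x + \<partial> a (\<lambda>y. F y u' v) x" for u u' v
    by (subst dir_deriv_cong_open[OF S, where g="\<lambda>y. F y u v + F y u' v"])
       (use bil in \<open>auto simp: bilinear_ladd intro!: dir_deriv_add d\<close>)
  have 2: "\<partial> a (\<lambda>y. F y u (v + v')) x = \<partial> a (\<lambda>y. F y u v) x + \<partial> a (\<lambda>y. F y u v') x" for u v v'
    by (subst dir_deriv_cong_open[OF S, where g="\<lambda>y. F y u v + F y u v'"])
       (use bil in \<open>auto simp: bilinear_radd intro!: dir_deriv_add d\<close>)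
  have 3: "\<partial> a (\<lambda>y. F y (k *\<^sub>R u) v) x = k *\<^sub>R \<partial> a (\<lambda>y. F y u v) x" for u v k
    by (subst dir_deriv_cong_open[OF S, where g="\<lambda>y. k *\<^sub>R F y u v"])
       (use bil in \<open>auto simp: bilinear_lmul intro!: dir_deriv_linear[OF bounded_linear_scaleR_right] d\<close>)
  have 4: "\<partial> a (\<lambda>y. F y u (k *\<^sub>R v)) x = k *\<^sub>R \<partial> a (\<lambda>y. F y u v) x" for u v k
    by (subst dir_deriv_cong_open[OF S, where g="\<lambda>y. k *\<^sub>R F y u v"])
       (use bil in \<open>auto simp: bilinear_rmul intro!: dir_deriv_linear[OF bounded_linear_scaleR_right] d\<close>)
  show ?thesis unfolding bilinear_def by (auto intro!: linearI 1 2 3 4)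
qed

section \<open>Linear total differential equations\<close>

text \<open>
  The equation is \<open>du(x) h = B x h (u x)\<close> with prescribed \<open>u 0\<close>. Along each ray from 0 it is an ordinary
  differential equation, so a solution must be a fixed point of \<open>u \<mapsto> w\<^sub>0 + ray_int u\<close>. This fixed point is
  constructed as a Neumann series whose terms are continuously differentiable with summable derivatives; the
  integrability condition \<open>flat\<close> then forces it to solve the equation in all directions, not only radially. The
  radius is chosen small compared with the bound \<open>M\<close>, which makes \<open>ray_int\<close> a contraction.
\<close>

locale linear_system =
  fixes r M :: real and B :: "'v::euclidean_space \<Rightarrow> 'v \<Rightarrow> 'w::euclidean_space \<Rightarrow> 'w"
  assumes r: "r > 0" and M: "M \<ge> 0" "M * r \<le> 1 / 4"
    and bil: "\<And>x. x \<in> ball 0 r \<Longrightarrow> bilinear (B x)"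
    and sm: "\<And>h w. smooth_on (ball 0 r) (\<lambda>x. B x h w)"
    and bd: "\<And>x h w. x \<in> ball 0 r \<Longrightarrow> norm (B x h w) \<le> M * norm h * norm w"
    and bd': "\<And>x a h w. x \<in> ball 0 r \<Longrightarrow> norm (\<partial> a (\<lambda>y. B y h w) x) \<le> M * norm a * norm h * norm w"
    and flat: "\<And>x h k w. x \<in> ball 0 r \<Longrightarrow>
      \<partial> h (\<lambda>y. B y k w) x + B x k (B x h w) = \<partial> k (\<lambda>y. B y h w) x + B x h (B x k w)"
begin

abbreviation U :: "'v set" where "U \<equiv> ball 0 r"

lemma scale_in_U: "x \<in> U \<Longrightarrow> 0 \<le> t \<Longrightarrow> t \<le> 1 \<Longrightarrow> t *\<^sub>R x \<in> U"
  using mult_left_le_one_le[of "norm x" t] by (simp add: dist_norm)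

lemma M_norm: "x \<in> U \<Longrightarrow> M * norm x \<le> 1 / 4"
  using M mult_left_mono[of "norm x" r M] by simp

definition ray_int :: "('v \<Rightarrow> 'w) \<Rightarrow> 'v \<Rightarrow> 'w" where
  "ray_int u x = integral {0..1} (\<lambda>t. B (t *\<^sub>R x) x (u (t *\<^sub>R x)))"

text \<open>
  The derivative in direction \<open>a\<close> of the integrand \<open>B (t x) x (u (t x))\<close> with respect to \<open>x\<close>.
\<close>

definition ray_deriv :: "('v \<Rightarrow> 'w) \<Rightarrow> 'v \<Rightarrow> 'v \<Rightarrow> real \<Rightarrow> 'w" where
  "ray_deriv u x a t = t *\<^sub>R \<partial> a (\<lambda>y. B y x (u (t *\<^sub>R x))) (t *\<^sub>R x)
     + B (t *\<^sub>R x) a (u (t *\<^sub>R x)) + t *\<^sub>R B (t *\<^sub>R x) x (\<partial> a u (t *\<^sub>R x))"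

lemma continuous_on_scale:
  assumes "continuous_on U f"
  shows "continuous_on (U \<times> {0..1}) (\<lambda>(x, t). f (t *\<^sub>R x))"
    "x \<in> U \<Longrightarrow> continuous_on {0..1} (\<lambda>t. f (t *\<^sub>R x))"
proof -
  have 1: "continuous_on (U \<times> {0..1::real}) (\<lambda>z. snd z *\<^sub>R fst z)" by (intro continuous_intros)
  have 2: "(\<lambda>z. snd z *\<^sub>R fst z) ` (U \<times> {0..1}) \<subseteq> U" by (rule image_subsetI) (metis mem_Times_iff atLeastAtMost_iff scale_in_U)
  show "continuous_on (U \<times> {0..1}) (\<lambda>(x, t). f (t *\<^sub>R x))"
    using continuous_on_compose2[OF assms 1 2] by (simp add: case_prod_unfold)
  show "continuous_on {0..1} (\<lambda>t. f (t *\<^sub>R x))" if "x \<in> U"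
    by (rule continuous_on_compose2[OF assms]) (use that scale_in_U in \<open>auto intro!: continuous_intros\<close>)
qed

lemma ray_integrand_continuous:
  assumes u: "continuous_on U u"
  shows "continuous_on (U \<times> {0..1}) (\<lambda>(x, t). B (t *\<^sub>R x) x (u (t *\<^sub>R x)))"
    "x \<in> U \<Longrightarrow> continuous_on {0..1} (\<lambda>t. B (t *\<^sub>R x) x (u (t *\<^sub>R x)))"
proof -
  have 2: "(\<lambda>z. snd z *\<^sub>R fst z) ` (U \<times> {0..1}) \<subseteq> U" by (rule image_subsetI) (metis mem_Times_iff atLeastAtMost_iff scale_in_U)
  have "continuous_on (U \<times> {0..1}) (\<lambda>z. B (snd z *\<^sub>R fst z) (fst z) (u (snd z *\<^sub>R fst z)))"
    by (rule continuous_on_bilinear_family[where F=B, OF bil smooth_onD(3)[OF sm] _ 2])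
       (use continuous_on_scale(1)[OF u] in \<open>auto simp: case_prod_unfold intro!: continuous_intros\<close>)
  then show "continuous_on (U \<times> {0..1}) (\<lambda>(x, t). B (t *\<^sub>R x) x (u (t *\<^sub>R x)))"
    by (simp add: case_prod_unfold)
  show "continuous_on {0..1} (\<lambda>t. B (t *\<^sub>R x) x (u (t *\<^sub>R x)))" if x: "x \<in> U"
    by (rule continuous_on_bilinear_family[where F=B and S=U, OF bil smooth_onD(3)[OF sm]])
       (use continuous_on_scale(2)[OF u x] scale_in_U[OF x] in \<open>auto intro!: continuous_intros\<close>)
qed

lemma B_rdiff: "x \<in> U \<Longrightarrow> B x h (v - w) = B x h v - B x h w" using bil bilinear_rsub by blast

lemma ray_int_bound:
  assumes u: "continuous_on U u" "\<And>x. x \<in> U \<Longrightarrow> norm (u x) \<le> K" and x: "x \<in> U"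
  shows "norm (ray_int u x) \<le> K / 4"
proof -
  have "norm (integral {0..1} (\<lambda>t. B (t *\<^sub>R x) x (u (t *\<^sub>R x)))) \<le> (K / 4) * (1 - 0)"
  proof (rule integral_bound)
    show "norm (B (t *\<^sub>R x) x (u (t *\<^sub>R x))) \<le> K / 4" if "t \<in> {0..1}" for t
    proof -
      have t: "t *\<^sub>R x \<in> U" using scale_in_U[OF x] that by simp
      have "norm (B (t *\<^sub>R x) x (u (t *\<^sub>R x))) \<le> M * norm x * norm (u (t *\<^sub>R x))" by (rule bd[OF t])
      also have "\<dots> \<le> 1 / 4 * K"
        by (intro mult_mono M_norm[OF x] u(2)[OF t]) auto
      finally show ?thesis by simp
    qed
  qed (use ray_integrand_continuous(2)[OF u(1) x] in auto)
  then show ?thesis by (simp add: ray_int_def)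
qed

lemma ray_int_diff:
  assumes u: "continuous_on U u" "continuous_on U v" and x: "x \<in> U"
  shows "ray_int (\<lambda>x. u x - v x) x = ray_int u x - ray_int v x"
proof -
  have "ray_int (\<lambda>x. u x - v x) x = integral {0..1} (\<lambda>t. B (t *\<^sub>R x) x (u (t *\<^sub>R x)) - B (t *\<^sub>R x) x (v (t *\<^sub>R x)))"
    unfolding ray_int_def by (rule Henstock_Kurzweil_Integration.integral_cong) (use scale_in_U[OF x] in \<open>auto intro!: B_rdiff\<close>)
  also have "\<dots> = ray_int u x - ray_int v x"
    unfolding ray_int_def
    by (rule integral_diff) (use ray_integrand_continuous(2)[OF u(1) x] ray_integrand_continuous(2)[OF u(2) x]
        in \<open>auto intro: integrable_continuous_real\<close>)
  finally show ?thesis .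
qed

lemma bil': "x \<in> U \<Longrightarrow> bilinear (\<lambda>h w. \<partial> a (\<lambda>y. B y h w) x)"
  by (rule bilinear_dir_deriv_family[OF open_ball _ bil sm])

lemma ray_deriv_continuous:
  assumes u: "Ck_on (Suc 0) U u"
  shows "continuous_on (U \<times> {0..1}) (\<lambda>(x, t). ray_deriv u x a t)"
    "x \<in> U \<Longrightarrow> continuous_on {0..1} (ray_deriv u x a)"
proof -
  have 2: "(\<lambda>z. snd z *\<^sub>R fst z) ` (U \<times> {0..1}) \<subseteq> U" by (rule image_subsetI) (metis mem_Times_iff atLeastAtMost_iff scale_in_U)
  have c: "continuous_on U u" "continuous_on U (\<lambda>x. \<partial> a u x)"
    using u Ck_on_imp_continuous[OF u] by auto
  note cs = continuous_on_scale(1)[OF c(1), unfolded case_prod_unfold] continuous_on_scale(1)[OF c(2), unfolded case_prod_unfold]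
  note F1 = continuous_on_bilinear_family[where F=B, OF bil smooth_onD(3)[OF sm] _ 2]
  note F2 = continuous_on_bilinear_family[where F="\<lambda>x h w. \<partial> a (\<lambda>y. B y h w) x", OF bil' smooth_onD(3)[OF smooth_on_dir_deriv[OF sm]] _ 2]
  have "continuous_on (U \<times> {0..1}) (\<lambda>z. ray_deriv u (fst z) a (snd z))"
    unfolding ray_deriv_def
    by (intro continuous_on_add continuous_on_scaleR F1 F2 continuous_on_fst continuous_on_snd continuous_on_id continuous_on_const cs)
  then show *: "continuous_on (U \<times> {0..1}) (\<lambda>(x, t). ray_deriv u x a t)"
    by (simp add: case_prod_unfold)
  show "continuous_on {0..1} (ray_deriv u x a)" if "x \<in> U"
  proof -
    have "continuous_on {0..1::real} (\<lambda>t. (x, t))" by (intro continuous_on_Pair continuous_on_const continuous_on_id)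
    moreover have "Pair x ` {0..1} \<subseteq> U \<times> {0..1}" using that by (simp add: image_subset_iff)
    ultimately show ?thesis using continuous_on_compose2[OF *, of "{0..1}" "Pair x"] by simp
  qed
qed

text \<open>
  Differentiation under the integral sign; the continuity of the derivative needed for it may be checked direction by
  direction, as the domain is finite-dimensional.
\<close>

lemma ray_int_has_derivative:
  assumes u: "Ck_on (Suc 0) U u" and x0: "x0 \<in> U"
  shows "(ray_int u has_derivative (\<lambda>a. integral {0..1} (ray_deriv u x0 a))) (at x0)"
proof -
  have du: "u differentiable (at x)" if "x \<in> U" for x using u that by simp
  have cu: "continuous_on U u" by (rule Ck_on_imp_continuous[OF u])
  have d: "((\<lambda>x. B (t *\<^sub>R x) x (u (t *\<^sub>R x))) has_derivative (\<lambda>a. ray_deriv u x a t)) (at x)"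
    if x: "x \<in> U" and t: "t \<in> {0..1}" for x t
  proof -
    have tx: "t *\<^sub>R x \<in> U" using scale_in_U[OF x] t by simp
    have sc: "((\<lambda>x. t *\<^sub>R x) has_derivative (\<lambda>a. t *\<^sub>R a)) (at x)" by (intro derivative_eq_intros) auto
    have F: "((\<lambda>y. B (t *\<^sub>R y) h w) has_derivative (\<lambda>a. \<partial> (t *\<^sub>R a) (\<lambda>y. B y h w) (t *\<^sub>R x))) (at x)" for h w
      using diff_chain_at[OF sc has_derivative_dir_deriv[OF smooth_onD(1)[OF sm tx]]] by (simp add: o_def)
    have F': "\<partial> a (\<lambda>y. B (t *\<^sub>R y) h w) x = t *\<^sub>R \<partial> a (\<lambda>y. B y h w) (t *\<^sub>R x)" for a h w
      unfolding dir_deriv_eq[OF F] by (rule linear_scale[OF linear_dir_deriv[OF smooth_onD(1)[OF sm tx]]])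
    have g: "((\<lambda>y. u (t *\<^sub>R y)) has_derivative (\<lambda>a. \<partial> (t *\<^sub>R a) u (t *\<^sub>R x))) (at x)"
      using diff_chain_at[OF sc has_derivative_dir_deriv[OF du[OF tx]]] by (simp add: o_def)
    have g': "\<partial> a (\<lambda>y. u (t *\<^sub>R y)) x = t *\<^sub>R \<partial> a u (t *\<^sub>R x)" for a
      unfolding dir_deriv_eq[OF g] by (rule linear_scale[OF linear_dir_deriv[OF du[OF tx]]])
    have bilt: "bilinear (B (t *\<^sub>R y))" if "y \<in> U" for y
      using bil scale_in_U[OF that] t by simp
    have "((\<lambda>x. B (t *\<^sub>R x) x (u (t *\<^sub>R x))) has_derivative
      (\<lambda>a. \<partial> a (\<lambda>y. B (t *\<^sub>R y) x (u (t *\<^sub>R x))) x + B (t *\<^sub>R x) (\<partial> a (\<lambda>x. x) x) (u (t *\<^sub>R x))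
          + B (t *\<^sub>R x) x (\<partial> a (\<lambda>y. u (t *\<^sub>R y)) x))) (at x)"
      by (rule has_derivative_bilinear_family[where F="\<lambda>x. B (t *\<^sub>R x)" and f="\<lambda>x. x" and g="\<lambda>x. u (t *\<^sub>R x)",
            OF open_ball x bilt Derivative.differentiableI[OF F] _ Derivative.differentiableI[OF g]]) auto
    then show ?thesis
      unfolding F' g' ray_deriv_def using bilinear_rmul[OF bil[OF tx]] by simp
  qed
  define fx where "fx x t = Blinfun (\<lambda>a. ray_deriv u x a t)" for x t
  have fx: "blinfun_apply (fx x t) = (\<lambda>a. ray_deriv u x a t)" if "x \<in> U" "t \<in> {0..1}" for x t
    unfolding fx_def using has_derivative_bounded_linear[OF d[OF that]] by (rule bounded_linear_Blinfun_apply)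
  have cfx: "continuous_on (U \<times> {0..1}) (\<lambda>(x, t). fx x t)"
  proof (rule continuous_on_blinfun_componentwise)
    fix i :: 'v
    show "continuous_on (U \<times> {0..1}) (\<lambda>z. blinfun_apply (case z of (x, t) \<Rightarrow> fx x t) i)"
      by (rule continuous_on_eq[OF ray_deriv_continuous(1)[OF u, of i]]) (auto simp: fx)
  qed
  have "((\<lambda>x. integral (cbox 0 1) (\<lambda>t. B (t *\<^sub>R x) x (u (t *\<^sub>R x)))) has_derivative
        blinfun_apply (integral (cbox 0 1) (fx x0))) (at x0 within U)"
  proof (rule leibniz_rule)
    show "((\<lambda>x. B (t *\<^sub>R x) x (u (t *\<^sub>R x))) has_derivative blinfun_apply (fx x t)) (at x within U)"
      if "x \<in> U" "t \<in> cbox 0 1" for x t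
      using d[OF that(1), of t] fx[OF that(1), of t] that(2) has_derivative_at_withinI by fastforce
    show "(\<lambda>t. B (t *\<^sub>R x) x (u (t *\<^sub>R x))) integrable_on cbox 0 1" if "x \<in> U" for x
      using ray_integrand_continuous(2)[OF cu that] integrable_continuous_real by (metis box_real(2))
  qed (use cfx x0 in auto)
  then have 1: "(ray_int u has_derivative blinfun_apply (integral {0..1} (fx x0))) (at x0)"
    using x0 unfolding ray_int_def by (simp add: at_within_open[OF _ open_ball])
  have "blinfun_apply (integral {0..1} (fx x0)) a = integral {0..1} (ray_deriv u x0 a)" for a
  proof -
    have c: "continuous_on {0..1} (fx x0)"
    proof -
      have "continuous_on {0..1::real} (\<lambda>t. (x0, t))" by (intro continuous_on_Pair continuous_on_const continuous_on_id)
      moreover have "Pair x0 ` {0..1} \<subseteq> U \<times> {0..1}" using x0 by (simp add: image_subset_iff)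
      ultimately show ?thesis using continuous_on_compose2[OF cfx, of "{0..1}" "Pair x0"] by simp
    qed
    have "blinfun_apply (integral {0..1} (fx x0)) a = integral {0..1} (\<lambda>t. blinfun_apply (fx x0 t) a)"
      using integral_linear[OF integrable_continuous_real[OF c] bounded_linear_apply_blinfun[of a]]
      by (simp add: o_def bounded_linear_apply_blinfun blinfun.bounded_linear_left)
    also have "\<dots> = integral {0..1} (ray_deriv u x0 a)"
      by (rule Henstock_Kurzweil_Integration.integral_cong) (use fx x0 in auto)
    finally show ?thesis .
  qed
  then have "blinfun_apply (integral {0..1} (fx x0)) = (\<lambda>a. integral {0..1} (ray_deriv u x0 a))" by auto
  with 1 show ?thesis by simp
qed

lemma dir_deriv_ray_int:
  assumes u: "Ck_on (Suc 0) U u" and x: "x \<in> U"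
  shows "\<partial> a (ray_int u) x = integral {0..1} (ray_deriv u x a)"
  by (rule dir_deriv_eq[OF ray_int_has_derivative[OF assms]])

lemma ray_int_C1:
  assumes u: "Ck_on (Suc 0) U u"
  shows "Ck_on (Suc 0) U (ray_int u)"
proof -
  have "continuous_on U (\<lambda>x. integral (cbox 0 1) (ray_deriv u x a))" for a
    by (rule integral_continuous_on_param) (use ray_deriv_continuous(1)[OF u] in auto)
  then have "continuous_on U (\<lambda>x. \<partial> a (ray_int u) x)" for a
    by (rule continuous_on_eq) (simp add: dir_deriv_ray_int[OF u])
  then show ?thesis using Derivative.differentiableI[OF ray_int_has_derivative[OF u]] by simp
qed

text \<open>
  The derivative of the image is contracted up to a multiple of the size of the function itself: the three summands of
  \<open>ray_deriv\<close> contribute \<open>K / 4\<close>, \<open>M K\<close> and \<open>K' / 4\<close>.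
\<close>

lemma dir_deriv_ray_int_bound:
  assumes u: "Ck_on (Suc 0) U u" "\<And>x. x \<in> U \<Longrightarrow> norm (u x) \<le> K" and K: "K \<ge> 0"
    and u': "\<And>x a. x \<in> U \<Longrightarrow> norm (\<partial> a u x) \<le> K' * norm a" "K' \<ge> 0" and x: "x \<in> U"
  shows "norm (\<partial> a (ray_int u) x) \<le> ((1 / 4 + M) * K + K' / 4) * norm a"
proof -
  have "norm (integral {0..1} (ray_deriv u x a)) \<le> (((1 / 4 + M) * K + K' / 4) * norm a) * (1 - 0)"
  proof (rule integral_bound)
    show "norm (ray_deriv u x a t) \<le> ((1 / 4 + M) * K + K' / 4) * norm a" if t: "t \<in> {0..1}" for t
    proof -
      have tx: "t *\<^sub>R x \<in> U" using scale_in_U[OF x] t by simp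
      have Mx: "M * norm x \<le> 1 / 4" by (rule M_norm[OF x])
      have "norm (t *\<^sub>R \<partial> a (\<lambda>y. B y x (u (t *\<^sub>R x))) (t *\<^sub>R x)) \<le> 1 * norm (\<partial> a (\<lambda>y. B y x (u (t *\<^sub>R x))) (t *\<^sub>R x))"
        using t by (simp add: mult_left_le_one_le)
      also have "\<dots> \<le> (M * norm x) * (norm a * norm (u (t *\<^sub>R x)))"
        using bd'[OF tx, where a=a and h=x and w="u (t *\<^sub>R x)"] by (simp add: mult_ac)
      also have "\<dots> \<le> 1 / 4 * (norm a * K)"
        by (intro mult_mono Mx u(2) tx order_refl) (use K in auto)
      finally have 1: "norm (t *\<^sub>R \<partial> a (\<lambda>y. B y x (u (t *\<^sub>R x))) (t *\<^sub>R x)) \<le> 1 / 4 * (norm a * K)" .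
      have "norm (B (t *\<^sub>R x) a (u (t *\<^sub>R x))) \<le> M * norm a * norm (u (t *\<^sub>R x))" by (rule bd[OF tx])
      also have "\<dots> \<le> M * norm a * K" by (intro mult_left_mono u(2) tx) (use M in auto)
      finally have 2: "norm (B (t *\<^sub>R x) a (u (t *\<^sub>R x))) \<le> M * norm a * K" .
      have "norm (t *\<^sub>R B (t *\<^sub>R x) x (\<partial> a u (t *\<^sub>R x))) \<le> 1 * norm (B (t *\<^sub>R x) x (\<partial> a u (t *\<^sub>R x)))"
        using t by (simp add: mult_left_le_one_le)
      also have "\<dots> \<le> M * norm x * norm (\<partial> a u (t *\<^sub>R x))" using bd[OF tx] by simp
      also have "\<dots> \<le> 1 / 4 * (K' * norm a)" by (intro mult_mono Mx u'(1) tx) auto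
      finally have 3: "norm (t *\<^sub>R B (t *\<^sub>R x) x (\<partial> a u (t *\<^sub>R x))) \<le> 1 / 4 * (K' * norm a)" .
      have "norm (ray_deriv u x a t) \<le> 1 / 4 * (norm a * K) + M * norm a * K + 1 / 4 * (K' * norm a)"
        unfolding ray_deriv_def by (intro norm_triangle_le add_mono 1 2 3)
      then show ?thesis by (simp add: algebra_simps)
    qed
  qed (use ray_deriv_continuous(2)[OF u(1) x] in auto)
  then show ?thesis by (simp add: dir_deriv_ray_int[OF u(1) x])
qed


context
  fixes w0 :: 'w
begin

definition picard :: "nat \<Rightarrow> 'v \<Rightarrow> 'w" where "picard n = (ray_int ^^ n) (\<lambda>x. w0)"

text \<open>
  This constant satisfies \<open>(1 / 4 + M) * norm w0 = K' / 4\<close>. So if the derivative of a term is at most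
  \<open>K' * q\<close> and its values at most \<open>norm w0 * q\<close>, then by \<open>dir_deriv_ray_int_bound\<close> the derivative of
  the next term is at most \<open>K' * q / 2\<close>.
\<close>

definition K' :: real where "K' = (1 + 4 * M) * norm w0"

lemma K'_nonneg: "K' \<ge> 0" using M by (simp add: K'_def)

lemma picard_bounds:
  "Ck_on (Suc 0) U (picard n) \<and> (\<forall>x\<in>U. norm (picard n x) \<le> norm w0 * (1 / 4) ^ n) \<and>
   (\<forall>x\<in>U. \<forall>a. norm (\<partial> a (picard n) x) \<le> K' * (1 / 2) ^ n * norm a)"
proof (induction n)
  case 0
  show ?case using Ck_on_const[of "Suc 0" U w0] K'_nonneg by (simp add: picard_def)
next
  case (Suc n)
  have s: "picard (Suc n) = ray_int (picard n)" by (simp add: picard_def)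
  have IH: "Ck_on (Suc 0) U (picard n)" "\<And>x. x \<in> U \<Longrightarrow> norm (picard n x) \<le> norm w0 * (1 / 4) ^ n"
    "\<And>x a. x \<in> U \<Longrightarrow> norm (\<partial> a (picard n) x) \<le> (K' * (1 / 2) ^ n) * norm a"
    using Suc by auto
  have c: "continuous_on U (picard n)" using Ck_on_imp_continuous[OF IH(1)] .
  have 1: "norm (ray_int (picard n) x) \<le> norm w0 * (1 / 4) ^ Suc n" if "x \<in> U" for x
    using ray_int_bound[OF c IH(2) that] by simp
  have 2: "norm (\<partial> a (ray_int (picard n)) x) \<le> K' * (1 / 2) ^ Suc n * norm a" if x: "x \<in> U" for x a
  proof -
    have "norm (\<partial> a (ray_int (picard n)) x)
       \<le> ((1 / 4 + M) * (norm w0 * (1 / 4) ^ n) + (K' * (1 / 2) ^ n) / 4) * norm a"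
      by (rule dir_deriv_ray_int_bound[OF IH(1,2) _ IH(3) _ x]) (use K'_nonneg in auto)
    also have "\<dots> \<le> (K' * (1 / 2) ^ Suc n) * norm a"
    proof (rule mult_right_mono)
      have "(1 / 4 + M) * (norm w0 * (1 / 4) ^ n) = K' / 4 * (1 / 4) ^ n" by (simp add: K'_def algebra_simps)
      also have "\<dots> \<le> K' / 4 * (1 / 2) ^ n" by (intro mult_left_mono power_mono) (use K'_nonneg in auto)
      finally show "(1 / 4 + M) * (norm w0 * (1 / 4) ^ n) + (K' * (1 / 2) ^ n) / 4 \<le> K' * (1 / 2) ^ Suc n" by simp
    qed auto
    finally show ?thesis .
  qed
  show ?case unfolding s using 1 2 ray_int_C1[OF IH(1)] by blast
qed

lemmas picard_C1 = picard_bounds[THEN conjunct1]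
lemma picard_bound: "x \<in> U \<Longrightarrow> norm (picard n x) \<le> norm w0 * (1 / 4) ^ n" using picard_bounds by blast
lemma picard_deriv_bound: "x \<in> U \<Longrightarrow> norm (\<partial> a (picard n) x) \<le> K' * norm a * (1 / 2) ^ n"
  using picard_bounds[of n] by (metis mult.assoc mult.commute)

definition sol :: "'v \<Rightarrow> 'w" where "sol x = (\<Sum>n. picard n x)"

lemma geometric_tail:
  fixes f :: "nat \<Rightarrow> 'w"
  assumes f: "\<And>n. norm (f n) \<le> K * q ^ n" and q: "0 \<le> q" "q \<le> 1 / 2" and K: "K \<ge> 0"
  shows "summable f" "norm ((\<Sum>i<n. f i) - (\<Sum>i. f i)) \<le> 2 * K * q ^ n"
proof -
  have q1: "norm q < 1" using q by simp
  have sg: "summable (\<lambda>n. K * q ^ n)" using q1 by (intro summable_mult summable_geometric)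
  show s: "summable f" by (rule summable_comparison_test'[OF sg]) (use f in auto)
  have "(\<Sum>i<n. f i) - (\<Sum>i. f i) = - (\<Sum>i. f (i + n))"
    using suminf_split_initial_segment[OF s, of n] by simp
  then have "norm ((\<Sum>i<n. f i) - (\<Sum>i. f i)) = norm (\<Sum>i. f (i + n))" by simp
  also have "\<dots> \<le> (\<Sum>i. K * q ^ n * q ^ i)"
  proof (rule norm_suminf_le)
    show "norm (f (i + n)) \<le> K * q ^ n * q ^ i" for i using f[of "i + n"] by (simp add: power_add mult_ac)
    show "summable (\<lambda>i. K * q ^ n * q ^ i)" using q1 by (intro summable_mult summable_geometric)
  qed
  also have "\<dots> = K * q ^ n * (1 / (1 - q))"
    using q1 by (subst suminf_mult) (auto simp: suminf_geometric summable_geometric)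
  also have "\<dots> \<le> K * q ^ n * 2"
    by (intro mult_left_mono) (use q K in \<open>auto simp: field_simps\<close>)
  finally show "norm ((\<Sum>i<n. f i) - (\<Sum>i. f i)) \<le> 2 * K * q ^ n" by simp
qed

lemma sol_tail:
  assumes "x \<in> U"
  shows "summable (\<lambda>n. picard n x)" "norm ((\<Sum>i<n. picard i x) - sol x) \<le> 2 * norm w0 * (1 / 4) ^ n"
  using geometric_tail[OF picard_bound[OF assms]] unfolding sol_def by auto

lemma sol_has_derivative:
  assumes x0: "x0 \<in> U"
  shows "(sol has_derivative (\<lambda>a. \<Sum>n. \<partial> a (picard n) x0)) (at x0)"
proof -
  have tail: "norm ((\<Sum>i<n. \<partial> h (picard i) x) - (\<Sum>i. \<partial> h (picard i) x)) \<le> 2 * (K' * norm h) * (1 / 2) ^ n"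
    if "x \<in> U" for x h n
    by (rule geometric_tail[OF picard_deriv_bound[OF that]]) (use K'_nonneg in auto)
  have "\<exists>g. \<forall>x\<in>U. (\<lambda>n. picard n x) sums (g x) \<and>
     (g has_derivative (\<lambda>a. \<Sum>n. \<partial> a (picard n) x)) (at x within U)"
  proof (rule has_derivative_series[where f'="\<lambda>n x a. \<partial> a (picard n) x"])
    show "(picard n has_derivative (\<lambda>a. \<partial> a (picard n) x)) (at x within U)" if "x \<in> U" for n x
      using picard_C1[of n] that by (auto intro!: has_derivative_at_withinI has_derivative_dir_deriv)
    show "convex U" "x0 \<in> U" "(\<lambda>n. picard n x0) sums (\<Sum>n. picard n x0)"
      using x0 summable_sums[OF sol_tail(1)[OF x0]] by auto
    fix e :: real assume "e > 0"
    have "(\<lambda>n. 2 * K' * (1 / 2) ^ n) \<longlonglongrightarrow> 0"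
      by (intro tendsto_mult_right_zero LIMSEQ_power_zero) simp
    then have "\<forall>\<^sub>F n in sequentially. 2 * K' * (1 / 2) ^ n < e"
      using \<open>e > 0\<close> by (rule order_tendstoD(2))
    then show "\<forall>\<^sub>F n in sequentially. \<forall>x\<in>U. \<forall>h.
        norm ((\<Sum>i<n. \<partial> h (picard i) x) - (\<Sum>n. \<partial> h (picard n) x)) \<le> e * norm h"
    proof eventually_elim
      case (elim n)
      show ?case
      proof (intro ballI allI)
        fix x h assume "x \<in> U"
        have "norm ((\<Sum>i<n. \<partial> h (picard i) x) - (\<Sum>i. \<partial> h (picard i) x)) \<le> (2 * K' * (1 / 2) ^ n) * norm h"
          using tail[OF \<open>x \<in> U\<close>, where n=n and h=h] by (simp add: mult_ac)
        also have "\<dots> \<le> e * norm h" by (intro mult_right_mono) (use elim in auto)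
        finally show "norm ((\<Sum>i<n. \<partial> h (picard i) x) - (\<Sum>i. \<partial> h (picard i) x)) \<le> e * norm h" .
      qed
    qed
  qed
  then obtain g where g: "\<And>x. x \<in> U \<Longrightarrow> (\<lambda>n. picard n x) sums (g x)"
    "\<And>x. x \<in> U \<Longrightarrow> (g has_derivative (\<lambda>a. \<Sum>n. \<partial> a (picard n) x)) (at x within U)" by blast
  have "(g has_derivative (\<lambda>a. \<Sum>n. \<partial> a (picard n) x0)) (at x0)"
    using g(2)[OF x0] x0 by (simp add: at_within_open[OF _ open_ball])
  then show ?thesis
    by (rule has_derivative_transform_within_open[OF _ open_ball x0]) (use g(1) in \<open>auto simp: sol_def dest: sums_unique\<close>)
qed

lemma sol_C1: "Ck_on (Suc 0) U sol"
proof -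
  have "continuous_on U (\<lambda>x. \<Sum>n. \<partial> a (picard n) x)" for a
  proof (rule uniform_limit_theorem[OF always_eventually])
    show "uniform_limit U (\<lambda>n x. \<Sum>i<n. \<partial> a (picard i) x) (\<lambda>x. \<Sum>n. \<partial> a (picard n) x) sequentially"
      by (rule Weierstrass_m_test[OF picard_deriv_bound]) (auto intro!: summable_mult summable_geometric)
    show "\<forall>n. continuous_on U (\<lambda>x. \<Sum>i<n. \<partial> a (picard i) x)"
      using picard_C1 by (auto intro!: continuous_on_sum)
  qed auto
  then have "continuous_on U (\<lambda>x. \<partial> a sol x)" for a
    by (rule continuous_on_eq) (simp add: dir_deriv_eq[OF sol_has_derivative])
  then show ?thesis using Derivative.differentiableI[OF sol_has_derivative] by simp
qed

lemma sol_continuous: "continuous_on U sol" by (rule Ck_on_imp_continuous[OF sol_C1])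

text \<open>
  The integral operator maps each partial sum to the next one without its first term; by the contraction
  estimate it commutes with the limit.
\<close>

lemma sol_fixed_point:
  assumes x: "x \<in> U"
  shows "sol x = w0 + ray_int sol x"
proof -
  have cS: "continuous_on U (\<lambda>x. \<Sum>i<N. picard i x)" for N
    by (intro continuous_on_sum Ck_on_imp_continuous[OF picard_C1])
  have S: "ray_int (\<lambda>x. \<Sum>i<N. picard i x) x = (\<Sum>i<N. picard (Suc i) x)" for N
  proof (induction N)
    case 0
    have "integral {0..1} (\<lambda>t. B (t *\<^sub>R x) x 0) = integral {0..1::real} (\<lambda>t. 0)"
      by (rule Henstock_Kurzweil_Integration.integral_cong) (use bilinear_rzero[OF bil[OF scale_in_U[OF x]]] in auto)
    then show ?case by (simp add: ray_int_def)
  next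
    case (Suc N)
    have "picard N = (\<lambda>x. (\<Sum>i<Suc N. picard i x) - (\<Sum>i<N. picard i x))" by (auto simp: fun_eq_iff)
    then have "ray_int (picard N) x = ray_int (\<lambda>x. \<Sum>i<Suc N. picard i x) x - ray_int (\<lambda>x. \<Sum>i<N. picard i x) x"
      using ray_int_diff[OF cS[of "Suc N"] cS[of N] x] by simp
    then show ?case using Suc by (simp add: picard_def algebra_simps)
  qed
  have bnd: "norm (ray_int sol x - (\<Sum>i<N. picard (Suc i) x)) \<le> (norm w0 / 2) * (1 / 4) ^ N" for N
  proof -
    have "norm (ray_int (\<lambda>x. (\<Sum>i<N. picard i x) - sol x) x) \<le> (2 * norm w0 * (1 / 4) ^ N) / 4"
      by (rule ray_int_bound[OF _ sol_tail(2) x]) (intro continuous_on_diff cS sol_continuous)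
    then show ?thesis
      unfolding ray_int_diff[OF cS sol_continuous x] S by (simp add: norm_minus_commute)
  qed
  have lim: "(\<lambda>N. (norm w0 / 2) * (1 / 4) ^ N) \<longlonglongrightarrow> 0"
    by (intro tendsto_mult_right_zero LIMSEQ_power_zero) simp
  have "(\<lambda>N. ray_int sol x - (\<Sum>i<N. picard (Suc i) x)) \<longlonglongrightarrow> 0"
    by (rule Lim_null_comparison[OF always_eventually[OF allI[OF bnd]] lim])
  from tendsto_diff[OF tendsto_const[of "ray_int sol x"] this]
  have 1: "(\<lambda>N. \<Sum>i<N. picard (Suc i) x) \<longlonglongrightarrow> ray_int sol x" by simp
  have "(\<lambda>n. picard (Suc n) x) sums (sol x - picard 0 x)"
    using summable_sums[OF sol_tail(1)[OF x]] by (subst sums_Suc_iff) (simp add: sol_def)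
  then have "(\<lambda>N. \<Sum>i<N. picard (Suc i) x) \<longlonglongrightarrow> sol x - picard 0 x" by (simp add: sums_def)
  from LIMSEQ_unique[OF 1 this] show ?thesis by (simp add: picard_def)
qed

text \<open>
  The heart of the matter. The defect \<open>z x h = \<partial> h sol x - B x h (sol x)\<close> is a difference of two integrals over
  the ray to \<open>x\<close>: the derivative of the fixed point equation, and the fundamental theorem of calculus for
  \<open>t \<mapsto> t B (t x) h (sol (t x))\<close>. By the integrability condition all terms cancel except
  \<open>t (B (t x) x (z (t x) h) - B (t x) h (z (t x) x))\<close>. Hence a bound for the defect can be halved again and again, and
  the defect vanishes.
\<close>

lemma sol_defect_halves:
  assumes C: "\<And>x h. x \<in> U \<Longrightarrow> norm (\<partial> h sol x - B x h (sol x)) \<le> C * norm h" "C \<ge> 0" and x: "x \<in> U"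
  shows "norm (\<partial> h sol x - B x h (sol x)) \<le> (C / 2) * norm h"
proof -
  have du: "sol differentiable (at y)" if "y \<in> U" for y using sol_C1 that by simp
  define G where "G t = B (t *\<^sub>R x) h (sol (t *\<^sub>R x)) + t *\<^sub>R \<partial> x (\<lambda>y. B y h (sol (t *\<^sub>R x))) (t *\<^sub>R x)
     + t *\<^sub>R B (t *\<^sub>R x) h (\<partial> x sol (t *\<^sub>R x))" for t
  have "((\<lambda>t. t *\<^sub>R B (t *\<^sub>R x) h (sol (t *\<^sub>R x))) has_vector_derivative G t) (at t within {0..1})"
    if t: "t \<in> {0..1}" for t
  proof -
    have tx: "t *\<^sub>R x \<in> U" using scale_in_U[OF x] t by simp
    define g where "g y = B y h (sol y)" for y
    have g: "(g has_derivative (\<lambda>a. \<partial> a (\<lambda>y. B y h (sol (t *\<^sub>R x))) (t *\<^sub>R x) + B (t *\<^sub>R x) h (\<partial> a sol (t *\<^sub>R x)))) (at (t *\<^sub>R x))"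
      unfolding g_def
      by (rule has_derivative_linear_family[where L="\<lambda>y. B y h", OF open_ball tx _ smooth_onD(1)[OF sm tx] du[OF tx]])
         (use bil in \<open>auto simp: bilinear_def\<close>)
    have g': "g differentiable (at (t *\<^sub>R x))" using g by (rule Derivative.differentiableI)
    have "((\<lambda>t. t *\<^sub>R x) has_derivative (\<lambda>s. s *\<^sub>R x)) (at t)" by (auto intro!: derivative_eq_intros)
    from diff_chain_at[OF this has_derivative_dir_deriv[OF g']]
    have "((\<lambda>t. g (t *\<^sub>R x)) has_derivative (\<lambda>s. s *\<^sub>R \<partial> x g (t *\<^sub>R x))) (at t)"
      by (simp add: o_def linear_scale[OF linear_dir_deriv[OF g']])
    then have "((\<lambda>t. g (t *\<^sub>R x)) has_vector_derivative \<partial> x g (t *\<^sub>R x)) (at t within {0..1})"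
      unfolding has_vector_derivative_def by (rule has_derivative_at_withinI)
    from has_vector_derivative_scaleR[OF DERIV_ident this]
    show ?thesis by (simp add: G_def dir_deriv_eq[OF g] scaleR_add_right add_ac) (simp add: g_def add_ac)
  qed
  from fundamental_theorem_of_calculus[OF zero_le_one this]
  have G: "(G has_integral B x h (sol x)) {0..1}" by simp
  have eq: "\<partial> h sol x = \<partial> h (ray_int sol) x"
  proof -
    have "\<partial> h sol x = \<partial> h (\<lambda>y. w0 + ray_int sol y) x"
      by (rule dir_deriv_cong_open[OF open_ball x sol_fixed_point])
    also have "\<dots> = \<partial> h (ray_int sol) x"
      using dir_deriv_add[OF differentiable_const Derivative.differentiableI[OF ray_int_has_derivative[OF sol_C1 x]]] by simp
    finally show ?thesis .
  qed
  have R: "(ray_deriv sol x h has_integral \<partial> h sol x) {0..1}"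
    unfolding eq dir_deriv_ray_int[OF sol_C1 x]
    by (intro integrable_integral integrable_continuous_real ray_deriv_continuous(2)[OF sol_C1 x])
  have RG: "((\<lambda>t. ray_deriv sol x h t - G t) has_integral (\<partial> h sol x - B x h (sol x))) {0..1}"
    by (rule has_integral_diff[OF R G])
  have bound: "norm (ray_deriv sol x h t - G t) \<le> (C / 2) * norm h" if t: "t \<in> {0..1}" for t
  proof -
    define y where "y = t *\<^sub>R x"
    have y: "y \<in> U" unfolding y_def using scale_in_U[OF x] t by simp
    have fl: "\<partial> h (\<lambda>z. B z x (sol y)) y - \<partial> x (\<lambda>z. B z h (sol y)) y = B y h (B y x (sol y)) - B y x (B y h (sol y))"
      using flat[OF y, where h=h and k=x and w="sol y"] by (simp add: algebra_simps)
    have "ray_deriv sol x h t - G t = t *\<^sub>R ((\<partial> h (\<lambda>z. B z x (sol y)) y - \<partial> x (\<lambda>z. B z h (sol y)) y)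
        + B y x (\<partial> h sol y) - B y h (\<partial> x sol y))"
      unfolding ray_deriv_def G_def y_def[symmetric] by (simp add: scaleR_diff_right scaleR_add_right algebra_simps)
    also have "\<dots> = t *\<^sub>R (B y x (\<partial> h sol y - B y h (sol y)) - B y h (\<partial> x sol y - B y x (sol y)))"
      unfolding fl by (simp add: B_rdiff[OF y] algebra_simps)
    finally have e: "ray_deriv sol x h t - G t
       = t *\<^sub>R (B y x (\<partial> h sol y - B y h (sol y)) - B y h (\<partial> x sol y - B y x (sol y)))" .
    have Mx: "M * norm x \<le> 1 / 4" by (rule M_norm[OF x])
    have "norm (B y x (\<partial> h sol y - B y h (sol y))) \<le> M * norm x * norm (\<partial> h sol y - B y h (sol y))"
      by (rule bd[OF y])
    also have "\<dots> \<le> 1 / 4 * (C * norm h)" by (intro mult_mono Mx C y) auto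
    finally have 1: "norm (B y x (\<partial> h sol y - B y h (sol y))) \<le> 1 / 4 * (C * norm h)" .
    have "norm (B y h (\<partial> x sol y - B y x (sol y))) \<le> M * norm h * norm (\<partial> x sol y - B y x (sol y))"
      by (rule bd[OF y])
    also have "\<dots> \<le> M * norm h * (C * norm x)" by (intro mult_left_mono C y) (use M in auto)
    also have "\<dots> = (M * norm x) * (C * norm h)" by simp
    also have "\<dots> \<le> 1 / 4 * (C * norm h)" by (intro mult_right_mono Mx) (use C in auto)
    finally have 2: "norm (B y h (\<partial> x sol y - B y x (sol y))) \<le> 1 / 4 * (C * norm h)" .
    have "norm (ray_deriv sol x h t - G t) \<le> 1 * norm (B y x (\<partial> h sol y - B y h (sol y)) - B y h (\<partial> x sol y - B y x (sol y)))"
      unfolding e norm_scaleR by (rule mult_right_mono) (use t in auto)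
    also have "\<dots> \<le> 1 / 4 * (C * norm h) + 1 / 4 * (C * norm h)"
      using norm_triangle_ineq4[of "B y x (\<partial> h sol y - B y h (sol y))" "B y h (\<partial> x sol y - B y x (sol y))"] 1 2 by linarith
    finally show ?thesis by simp
  qed
  have "norm (\<partial> h sol x - B x h (sol x)) \<le> (C / 2) * norm h * measure lborel {0..1::real}"
    by (rule has_integral_bound_real[where f="\<lambda>t. ray_deriv sol x h t - G t"]) (use RG bound C in auto)
  then show ?thesis by simp
qed

lemma sol_solves:
  assumes x: "x \<in> U"
  shows "(sol has_derivative (\<lambda>h. B x h (sol x))) (at x)"
proof -
  define C where "C = 2 * K' + M * (2 * norm w0)"
  have C0: "C \<ge> 0" using K'_nonneg M by (simp add: C_def)
  have base: "norm (\<partial> h sol x - B x h (sol x)) \<le> C * norm h" if x: "x \<in> U" for x h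
  proof -
    have 1: "norm (\<partial> h sol x) \<le> 2 * (K' * norm h)"
      using geometric_tail(2)[OF picard_deriv_bound[OF x, where a=h], where n=0] K'_nonneg
      by (simp add: dir_deriv_eq[OF sol_has_derivative[OF x]])
    have "norm (sol x) \<le> 2 * norm w0" using sol_tail(2)[OF x, of 0] by simp
    then have 2: "norm (B x h (sol x)) \<le> M * norm h * (2 * norm w0)"
      using order_trans[OF bd[OF x] mult_left_mono[of "norm (sol x)" "2 * norm w0" "M * norm h"]] M by auto
    show ?thesis
      using norm_triangle_ineq4[of "\<partial> h sol x" "B x h (sol x)"] 1 2 by (simp add: C_def algebra_simps)
  qed
  have it: "\<forall>x\<in>U. \<forall>h. norm (\<partial> h sol x - B x h (sol x)) \<le> (C / 2 ^ n) * norm h" for n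
  proof (induction n)
    case (Suc n)
    then show ?case using sol_defect_halves[where C="C / 2 ^ n"] C0 by (simp add: mult.commute)
  qed (use base in auto)
  have "\<partial> h sol x - B x h (sol x) = 0" for h
  proof -
    have "(\<lambda>n. C * norm h * (1 / 2) ^ n) \<longlonglongrightarrow> 0"
      by (intro tendsto_mult_right_zero LIMSEQ_power_zero) simp
    moreover have "norm (\<partial> h sol x - B x h (sol x)) \<le> C * norm h * (1 / 2) ^ n" for n
      using it[of n] x by (simp add: power_one_over)
    ultimately have "norm (\<partial> h sol x - B x h (sol x)) \<le> 0"
      by (intro LIMSEQ_le_const[where X="\<lambda>n. C * norm h * (1 / 2) ^ n"]) auto
    then show ?thesis by simp
  qed
  then have "\<partial> h sol x = B x h (sol x)" for h by (metis eq_iff_diff_eq_0)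
  then show ?thesis using has_derivative_dir_deriv[of sol x] sol_C1 x by simp
qed

lemma sol_0: "sol 0 = w0"
proof -
  have "B 0 0 w = 0" for w using bilinear_lzero[OF bil[of 0]] r by simp
  then show ?thesis using sol_fixed_point[of 0] r by (simp add: ray_int_def)
qed

end

end

text \<open>
  The equation expresses the derivatives of a solution by the solution, so each order of
  differentiability yields the next.
\<close>

lemma smooth_on_linear_solution:
  fixes B :: "'v::euclidean_space \<Rightarrow> 'v \<Rightarrow> 'w::euclidean_space \<Rightarrow> 'w"
  assumes S: "open S" and bil: "\<And>x. x \<in> S \<Longrightarrow> bilinear (B x)"
    and sm: "\<And>h w. smooth_on S (\<lambda>x. B x h w)"
    and u: "\<And>x. x \<in> S \<Longrightarrow> (u has_derivative (\<lambda>h. B x h (u x))) (at x)"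
  shows "smooth_on S u"
  unfolding smooth_on_def
proof
  fix k show "Ck_on k S u"
  proof (induction k)
    case 0
    show ?case using has_derivative_continuous[OF u] by (simp add: continuous_at_imp_continuous_on)
  next
    case (Suc k)
    have "Ck_on k S (\<lambda>x. \<Sum>b\<in>Basis. (u x \<bullet> b) *\<^sub>R B x h b)" for h
      by (intro Ck_on_sum Ck_on_bounded_bilinear[OF S bounded_bilinear_scaleR] S
           Ck_on_bounded_linear[OF S bounded_linear_inner_left Suc.IH])
         (use sm in \<open>simp add: smooth_on_def\<close>)
    then have "Ck_on k S (\<lambda>x. \<partial> h u x)" for h
    proof (rule Ck_on_cong[OF S, rotated])
      fix x assume x: "x \<in> S"
      have "linear (B x h)" using bil[OF x] by (simp add: bilinear_def)
      then show "(\<Sum>b\<in>Basis. (u x \<bullet> b) *\<^sub>R B x h b) = \<partial> h u x"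
        unfolding dir_deriv_eq[OF u[OF x]] by (rule linear_expand[symmetric])
    qed
    then show ?case using Derivative.differentiableI[OF u] by simp
  qed
qed

text \<open>
  The theorem of Frobenius for linear equations. The premise \<open>flat\<close> says that the two ways of computing the mixed
  second derivative of a solution from the equation agree.
\<close>

theorem linear_total_differential_equation:
  fixes B :: "'v::euclidean_space \<Rightarrow> 'v \<Rightarrow> 'w::euclidean_space \<Rightarrow> 'w"
  assumes S: "open S" "x0 \<in> S" and bil: "\<And>x. x \<in> S \<Longrightarrow> bilinear (B x)"
    and sm: "\<And>h w. smooth_on S (\<lambda>x. B x h w)"
    and flat: "\<And>x h k w. x \<in> S \<Longrightarrow>
      \<partial> h (\<lambda>y. B y k w) x + B x k (B x h w) = \<partial> k (\<lambda>y. B y h w) x + B x h (B x k w)"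
  obtains r u where "r > 0" "ball x0 r \<subseteq> S" "u x0 = w0" "smooth_on (ball x0 r) u"
    "\<And>x. x \<in> ball x0 r \<Longrightarrow> (u has_derivative (\<lambda>h. B x h (u x))) (at x)"
proof -
  obtain R where R: "R > 0" "cball x0 R \<subseteq> S" using S open_contains_cball by blast
  have comp: "compact (cball x0 R)" by simp
  obtain M1 where M1: "M1 \<ge> 0" "\<And>x h w. x \<in> cball x0 R \<Longrightarrow> norm (B x h w) \<le> M1 * norm h * norm w"
    using bounded_bilinear_family[of "cball x0 R" B, OF comp] bil sm R(2)
    by (metis (no_types, lifting) continuous_on_subset smooth_onD(3) subsetD)
  have "\<exists>m\<ge>0. \<forall>x\<in>cball x0 R. \<forall>h w. norm (\<partial> a (\<lambda>y. B y h w) x) \<le> m * norm h * norm w" for a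
  proof (rule bounded_bilinear_family[OF comp])
    show "bilinear (\<lambda>h w. \<partial> a (\<lambda>y. B y h w) x)" if "x \<in> cball x0 R" for x
      by (rule bilinear_dir_deriv_family[OF S(1) _ bil sm]) (use R that in auto)
    show "continuous_on (cball x0 R) (\<lambda>x. \<partial> a (\<lambda>y. B y h w) x)" for h w
      using smooth_onD(3)[OF smooth_on_dir_deriv[OF sm]] R(2) by (rule continuous_on_subset)
  qed
  then obtain m where m: "\<And>a. m a \<ge> 0"
    "\<And>a x h w. x \<in> cball x0 R \<Longrightarrow> norm (\<partial> a (\<lambda>y. B y h w) x) \<le> m a * norm h * norm w" by metis
  define M2 where "M2 = (\<Sum>b\<in>Basis. m b)"
  have M2: "norm (\<partial> a (\<lambda>y. B y h w) x) \<le> M2 * norm a * norm h * norm w" if x: "x \<in> cball x0 R" for x a h w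
  proof -
    have xS: "x \<in> S" using x R by auto
    have "norm (\<partial> a (\<lambda>y. B y h w) x) \<le> (\<Sum>b\<in>Basis. norm ((a \<bullet> b) *\<^sub>R \<partial> b (\<lambda>y. B y h w) x))"
      by (subst dir_deriv_basis[OF smooth_onD(1)[OF sm xS], where a=a]) (rule norm_sum)
    also have "\<dots> \<le> (\<Sum>b\<in>Basis. norm a * (m b * norm h * norm w))"
      unfolding norm_scaleR by (intro sum_mono mult_mono Basis_le_norm m x) auto
    also have "\<dots> = M2 * norm a * norm h * norm w"
      by (simp add: M2_def sum_distrib_left[symmetric] sum_distrib_right[symmetric] mult_ac)
    finally show ?thesis .
  qed
  define M where "M = max M1 M2"
  define r where "r = min R (1 / (4 * (M + 1)))"
  have M: "M \<ge> 0" using M1(1) by (simp add: M_def)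
  have r: "r > 0" "r \<le> R" using R M by (auto simp: r_def)
  have bS: "ball x0 r \<subseteq> S" using order_trans[OF order_trans[OF subset_ball[OF r(2)] ball_subset_cball] R(2)] .
  have "M * r \<le> M * (1 / (4 * (M + 1)))" using M by (intro mult_left_mono) (auto simp: r_def)
  also have "\<dots> \<le> 1 / 4" using M by (simp add: field_simps)
  finally have Mr: "M * r \<le> 1 / 4" .
  have sub: "x0 + x \<in> cball x0 R" "x0 + x \<in> S" if "x \<in> ball 0 r" for x
    using that r R by (auto simp: subset_iff dist_norm)
  define B0 where "B0 x = B (x0 + x)" for x
  have shift: "\<partial> a (\<lambda>y. B0 y h w) x = \<partial> a (\<lambda>y. B y h w) (x0 + x)" if "x \<in> ball 0 r" for a x h w
  proof -
    have t: "((\<lambda>y. x0 + y) has_derivative (\<lambda>a. a)) (at x)" by (auto intro!: derivative_eq_intros)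
    have "((\<lambda>y. B0 y h w) has_derivative (\<lambda>a. \<partial> a (\<lambda>y. B y h w) (x0 + x))) (at x)"
      using diff_chain_at[OF t has_derivative_dir_deriv[OF smooth_onD(1)[OF sm sub(2)[OF that]]]]
      by (simp add: o_def B0_def)
    then show ?thesis by (rule dir_deriv_eq)
  qed
  interpret sys: linear_system r M B0
  proof
    show "bilinear (B0 x)" if "x \<in> ball 0 r" for x unfolding B0_def by (rule bil[OF sub(2)[OF that]])
    show "smooth_on (ball 0 r) (\<lambda>x. B0 x h w)" for h w
      unfolding B0_def
    proof (rule smooth_on_compose[where T=S and g="\<lambda>x. x0 + x" and f="\<lambda>x. B x h w", OF open_ball S(1) _ _ sm])
      show "(\<lambda>x. x0 + x) ` ball 0 r \<subseteq> S" using sub(2) by blast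
      show "smooth_on (ball 0 r) (\<lambda>x. x0 + x)" by (intro smooth_intros open_ball)
    qed
    show "norm (B0 x h w) \<le> M * norm h * norm w" if "x \<in> ball 0 r" for x h w
    proof -
      have "norm (B0 x h w) \<le> M1 * norm h * norm w" unfolding B0_def by (rule M1(2)[OF sub(1)[OF that]])
      also have "\<dots> \<le> M * norm h * norm w" by (intro mult_right_mono) (auto simp: M_def)
      finally show ?thesis .
    qed
    show "norm (\<partial> a (\<lambda>y. B0 y h w) x) \<le> M * norm a * norm h * norm w" if "x \<in> ball 0 r" for x a h w
    proof -
      have "norm (\<partial> a (\<lambda>y. B0 y h w) x) \<le> M2 * norm a * norm h * norm w"
        unfolding shift[OF that] by (rule M2[OF sub(1)[OF that]])
      also have "\<dots> \<le> M * norm a * norm h * norm w" by (intro mult_right_mono) (auto simp: M_def)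
      finally show ?thesis .
    qed
    show "\<partial> h (\<lambda>y. B0 y k w) x + B0 x k (B0 x h w) = \<partial> k (\<lambda>y. B0 y h w) x + B0 x h (B0 x k w)"
      if "x \<in> ball 0 r" for x h k w
      unfolding shift[OF that] unfolding B0_def by (rule flat[OF sub(2)[OF that]])
  qed (use r M Mr in auto)
  define u where "u x = sys.sol w0 (x - x0)" for x
  have u: "(u has_derivative (\<lambda>h. B x h (u x))) (at x)" if "x \<in> ball x0 r" for x
  proof -
    have t: "((\<lambda>y. y - x0) has_derivative (\<lambda>a. a)) (at x)" by (auto intro!: derivative_eq_intros)
    have "x - x0 \<in> ball 0 r" using that by (simp add: dist_norm norm_minus_commute)
    from diff_chain_at[OF t sys.sol_solves[OF this]] show ?thesis by (simp add: o_def u_def[abs_def] B0_def)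
  qed
  show ?thesis
  proof
    show "smooth_on (ball x0 r) u"
      by (rule smooth_on_linear_solution[OF open_ball _ smooth_on_subset[OF sm bS] u]) (use bil bS in auto)
    show "u x0 = w0" by (simp add: u_def sys.sol_0)
  qed (use u r bS in auto)
qed

section \<open>Calculus on a smooth manifold\<close>

locale manifold =
  fixes \<A> :: "('a::{t2_space, second_countable_topology}, 'n::finite) chart set"
  assumes manifold: "smooth_manifold \<A>"
begin

lemma
  assumes "(V, c) \<in> \<A>"
  shows chart_open: "open V" "open (c ` V)"
    and chart_homeo: "homeomorphism V (c ` V) c (inv_into V c)"
    and chart_inv: "\<And>q. q \<in> V \<Longrightarrow> inv_into V c (c q) = q" "\<And>x. x \<in> c ` V \<Longrightarrow> c (inv_into V c x) = x"
      "\<And>x. x \<in> c ` V \<Longrightarrow> inv_into V c x \<in> V"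
    and chart_cont: "continuous_on V c" "continuous_on (c ` V) (inv_into V c)"
proof -
  have "is_chart (V, c)" using manifold assms unfolding smooth_manifold_def by blast
  then show o: "open V" "open (c ` V)" and h: "homeomorphism V (c ` V) c (inv_into V c)"
    unfolding is_chart_def by auto
  show "\<And>q. q \<in> V \<Longrightarrow> inv_into V c (c q) = q" using h by (simp add: homeomorphism_def)
  show "\<And>x. x \<in> c ` V \<Longrightarrow> c (inv_into V c x) = x" "\<And>x. x \<in> c ` V \<Longrightarrow> inv_into V c x \<in> V"
    by (auto simp: f_inv_into_f inv_into_into)
  show "continuous_on V c" "continuous_on (c ` V) (inv_into V c)" using h by (auto simp: homeomorphism_def)
qed

lemma chart_image_open:
  assumes "(V, c) \<in> \<A>" "open U" shows "open (c ` (U \<inter> V))"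
proof -
  have "openin (top_of_set (c ` V)) (c ` (U \<inter> V))"
    by (rule homeomorphism_imp_open_map[OF chart_homeo[OF assms(1)]])
       (use assms(2) in \<open>auto simp: openin_open\<close>)
  then show ?thesis using chart_open(2)[OF assms(1)] openin_open_trans by blast
qed

lemma chart_image_open': "(V, c) \<in> \<A> \<Longrightarrow> open U \<Longrightarrow> U \<subseteq> V \<Longrightarrow> open (c ` U)"
  using chart_image_open[of V c U] by (simp add: inf.absorb1)

lemma chart_preimage_open:
  assumes "(V, c) \<in> \<A>" "open S" shows "open {q \<in> V. c q \<in> S}"
proof -
  have "open (c -` S \<inter> V)"
    using continuous_on_open_vimage[OF chart_open(1)[OF assms(1)]] chart_cont(1)[OF assms(1)] assms(2) by blast
  moreover have "c -` S \<inter> V = {q \<in> V. c q \<in> S}" by auto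
  ultimately show ?thesis by simp
qed

lemma chart_ex: obtains V c where "(V, c) \<in> \<A>" "p \<in> V"
proof -
  have "p \<in> (\<Union>(V, c)\<in>\<A>. V)" using manifold by (simp add: smooth_manifold_def)
  then show thesis using that by auto
qed

lemma transition_smooth:
  assumes "(V, c) \<in> \<A>" "(W, d) \<in> \<A>"
  shows "smooth_on (c ` (V \<inter> W)) (\<lambda>x. d (inv_into V c x))"
proof -
  have "\<forall>(V, c)\<in>\<A>. \<forall>(W, d)\<in>\<A>. smooth_on (c ` (V \<inter> W)) (d \<circ> inv_into V c)"
    using manifold by (simp add: smooth_manifold_def)
  from bspec[OF bspec[OF this assms(1), simplified] assms(2)] show ?thesis by (simp add: o_def)
qed

lemma chart_at_mem:
  assumes "chart_at \<A> p = (V, c)" shows "(V, c) \<in> \<A>" "p \<in> V"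
proof -
  obtain V' c' where "(V', c') \<in> \<A>" "p \<in> V'" by (rule chart_ex)
  then have "chart_at \<A> p \<in> \<A> \<and> p \<in> fst (chart_at \<A> p)"
    unfolding chart_at_def by (intro someI[where P="\<lambda>k. k \<in> \<A> \<and> p \<in> fst k" and x="(V', c')"]) simp
  then show "(V, c) \<in> \<A>" "p \<in> V" using assms by auto
qed

subsection \<open>Smooth functions\<close>

lemma smooth_mapD:
  "smooth_map \<A> U f \<Longrightarrow> (V, c) \<in> \<A> \<Longrightarrow> smooth_on (c ` (U \<inter> V)) (\<lambda>x. f (inv_into V c x))"
  unfolding smooth_map_def by (auto simp: o_def)

lemma smooth_mapD':
  "smooth_map \<A> U f \<Longrightarrow> (V, c) \<in> \<A> \<Longrightarrow> N \<subseteq> U \<inter> V \<Longrightarrow> smooth_on (c ` N) (\<lambda>x. f (inv_into V c x))"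
  using smooth_on_subset[OF smooth_mapD] by blast

lemma smooth_map_subset: "smooth_map \<A> U f \<Longrightarrow> U' \<subseteq> U \<Longrightarrow> smooth_map \<A> U' f"
  unfolding smooth_map_def o_def
proof safe
  fix V c assume *: "\<forall>(V, c)\<in>\<A>. smooth_on (c ` (U \<inter> V)) (\<lambda>x. f (inv_into V c x))" "U' \<subseteq> U" "(V, c) \<in> \<A>"
  then have "smooth_on (c ` (U \<inter> V)) (\<lambda>x. f (inv_into V c x))" by blast
  then show "smooth_on (c ` (U' \<inter> V)) (\<lambda>x. f (inv_into V c x))"
    by (rule smooth_on_subset) (use * in auto)
qed

text \<open>Smoothness may be checked near every point in one chart of one's choice.\<close>

lemma smooth_mapI:
  assumes loc: "\<And>p. p \<in> U \<Longrightarrow> \<exists>V c N. (V, c) \<in> \<A> \<and> open N \<and> p \<in> N \<and> N \<subseteq> V \<and>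
      smooth_on (c ` N) (\<lambda>x. f (inv_into V c x))"
  shows "smooth_map \<A> U f"
  unfolding smooth_map_def o_def
proof (safe, rule smooth_on_local)
  fix W d x assume Wd: "(W, d) \<in> \<A>" and x: "x \<in> d ` (U \<inter> W)"
  then obtain p where p: "p \<in> U" "p \<in> W" "x = d p" by blast
  obtain V c N where N: "(V, c) \<in> \<A>" "open N" "p \<in> N" "N \<subseteq> V"
    "smooth_on (c ` N) (\<lambda>x. f (inv_into V c x))" using loc[OF p(1)] by blast
  let ?T = "d ` (N \<inter> W)"
  have o: "open ?T" by (rule chart_image_open[OF Wd N(2)])
  have s: "smooth_on ?T (\<lambda>y. c (inv_into W d y))"
    by (rule smooth_on_subset[OF transition_smooth[OF Wd N(1)]]) (use N in auto)
  have im: "(\<lambda>y. c (inv_into W d y)) ` ?T \<subseteq> c ` N"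
    using chart_inv(1)[OF Wd] by auto
  have "smooth_on ?T (\<lambda>y. f (inv_into V c (c (inv_into W d y))))"
    by (rule smooth_on_compose[where f="\<lambda>x. f (inv_into V c x)", OF o chart_image_open'[OF N(1,2,4)] im s N(5)])
  then have "smooth_on ?T (\<lambda>y. f (inv_into W d y))"
    by (rule smooth_on_cong[OF o, rotated]) (use chart_inv(1)[OF Wd] chart_inv(1)[OF N(1)] N(4) in auto)
  then show "\<exists>T. open T \<and> x \<in> T \<and> smooth_on T (\<lambda>y. f (inv_into W d y))"
    using o p N(3) by blast
qed

lemma smooth_map_chartI:
  assumes "(V, c) \<in> \<A>" "open U" "U \<subseteq> V" "smooth_on (c ` U) (\<lambda>x. f (inv_into V c x))"
  shows "smooth_map \<A> U f"
  by (rule smooth_mapI) (use assms in blast)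

lemma smooth_map_local:
  assumes "\<And>p. p \<in> U \<Longrightarrow> \<exists>N. open N \<and> p \<in> N \<and> smooth_map \<A> N f"
  shows "smooth_map \<A> U f"
proof (rule smooth_mapI)
  fix p assume "p \<in> U"
  then obtain N where N: "open N" "p \<in> N" "smooth_map \<A> N f" using assms by blast
  obtain V c where V: "(V, c) \<in> \<A>" "p \<in> V" by (rule chart_ex)
  show "\<exists>V c N. (V, c) \<in> \<A> \<and> open N \<and> p \<in> N \<and> N \<subseteq> V \<and> smooth_on (c ` N) (\<lambda>x. f (inv_into V c x))"
    using V N smooth_mapD[OF N(3) V(1)] chart_open(1)[OF V(1)]
    by (intro exI[of _ V] exI[of _ c] exI[of _ "N \<inter> V"]) auto
qed

lemma smooth_map_cong:
  assumes "open U" "\<And>q. q \<in> U \<Longrightarrow> f q = g q" "smooth_map \<A> U f"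
  shows "smooth_map \<A> U g"
  unfolding smooth_map_def o_def
proof safe
  fix V c assume V: "(V, c) \<in> \<A>"
  show "smooth_on (c ` (U \<inter> V)) (\<lambda>x. g (inv_into V c x))"
    by (rule smooth_on_cong[OF chart_image_open[OF V assms(1)] _ smooth_mapD[OF assms(3) V]])
       (use chart_inv(1)[OF V] assms(2) in auto)
qed

lemma smooth_map_const: "smooth_map \<A> U (\<lambda>q. k)"
  unfolding smooth_map_def by (auto simp: o_def smooth_on_const)

lemma smooth_map_add:
  "open U \<Longrightarrow> smooth_map \<A> U f \<Longrightarrow> smooth_map \<A> U g \<Longrightarrow> smooth_map \<A> U (\<lambda>q. f q + g q)"
  unfolding smooth_map_def o_def by (auto intro!: smooth_on_add chart_image_open)

lemma smooth_map_scaleR: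
  "open U \<Longrightarrow> smooth_map \<A> U f \<Longrightarrow> smooth_map \<A> U g \<Longrightarrow> smooth_map \<A> U (\<lambda>q. f q *\<^sub>R g q)"
  unfolding smooth_map_def o_def by (auto intro!: smooth_on_scaleR chart_image_open)

lemma smooth_map_inner_left:
  "open U \<Longrightarrow> smooth_map \<A> U f \<Longrightarrow> smooth_map \<A> U (\<lambda>q. f q \<bullet> b)"
  unfolding smooth_map_def o_def by (auto intro!: smooth_on_inner smooth_on_const chart_image_open)

lemma smooth_map_sum:
  "open U \<Longrightarrow> (\<And>i. i \<in> I \<Longrightarrow> smooth_map \<A> U (f i)) \<Longrightarrow> smooth_map \<A> U (\<lambda>q. \<Sum>i\<in>I. f i q)"
  unfolding smooth_map_def o_def by (auto intro!: smooth_on_sum chart_image_open)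

lemma smooth_map_differentiable:
  assumes "smooth_map \<A> U f" "open U" "p \<in> U" "(V, c) \<in> \<A>" "p \<in> V"
  shows "(\<lambda>x. f (inv_into V c x)) differentiable (at (c p))"
  using smooth_onD(1)[OF smooth_mapD[OF assms(1,4)]] assms by blast

lemma chart_smooth_map: "(V, c) \<in> \<A> \<Longrightarrow> smooth_map \<A> V c"
proof (rule smooth_map_chartI)
  assume V: "(V, c) \<in> \<A>"
  show "smooth_on (c ` V) (\<lambda>x. c (inv_into V c x))"
    by (rule smooth_on_cong[OF chart_open(2)[OF V] _ smooth_on_id]) (simp add: chart_inv(2)[OF V])
qed (auto simp: chart_open)

subsection \<open>Derivatives along tangent vectors\<close>

lemma tderiv_eq: "chart_at \<A> p = (V, c) \<Longrightarrow> tderiv \<A> f p w = \<partial> w (\<lambda>x. f (inv_into V c x)) (c p)"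
  unfolding tderiv_def by (simp add: o_def)

text \<open>
  Tangent vectors are given in a chart chosen at their base point. This lemma transfers derivatives to an arbitrary
  chart, by the chain rule for the transition map.
\<close>

lemma tderiv_chart:
  assumes V: "(V, c) \<in> \<A>" "p \<in> V" and f: "(\<lambda>x. f (inv_into V c x)) differentiable (at (c p))"
  shows "tderiv \<A> f p w = \<partial> (tderiv \<A> c p w) (\<lambda>x. f (inv_into V c x)) (c p)"
proof -
  obtain V0 c0 where ca: "chart_at \<A> p = (V0, c0)" by (cases "chart_at \<A> p")
  note c0 = chart_at_mem[OF ca]
  let ?T = "c0 ` (V0 \<inter> V)"
  have o: "open ?T" using chart_image_open[OF c0(1) chart_open(1)[OF V(1)]] by (simp add: Int_commute)
  have x: "c0 p \<in> ?T" using c0 V by blast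
  let ?g = "\<lambda>x. c (inv_into V0 c0 x)"
  have g: "?g differentiable (at (c0 p))"
    by (rule smooth_onD(1)[OF transition_smooth[OF c0(1) V(1)] x])
  have gp: "?g (c0 p) = c p" using chart_inv(1)[OF c0(1)] c0(2) by simp
  have "\<partial> w (\<lambda>x. f (inv_into V0 c0 x)) (c0 p) = \<partial> w (\<lambda>x. f (inv_into V c (?g x))) (c0 p)"
    by (rule dir_deriv_cong_open[OF o x]) (use chart_inv(1)[OF c0(1)] chart_inv(1)[OF V(1)] in auto)
  also have "\<dots> = \<partial> (\<partial> w ?g (c0 p)) (\<lambda>x. f (inv_into V c x)) (c p)"
    using dir_deriv_compose[where f="\<lambda>x. f (inv_into V c x)", OF g] f gp by simp
  finally show ?thesis by (simp add: tderiv_eq[OF ca])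
qed

lemma tderiv_linear:
  assumes "smooth_map \<A> U f" "open U" "p \<in> U"
  shows "linear (tderiv \<A> f p)"
proof -
  obtain V0 c0 where ca: "chart_at \<A> p = (V0, c0)" by (cases "chart_at \<A> p")
  note c0 = chart_at_mem[OF ca]
  have "tderiv \<A> f p = (\<lambda>w. \<partial> w (\<lambda>x. f (inv_into V0 c0 x)) (c0 p))"
    by (simp add: fun_eq_iff tderiv_eq[OF ca])
  then show ?thesis
    using linear_dir_deriv[OF smooth_map_differentiable[OF assms c0]] by simp
qed

lemma tderiv_chart_at: "chart_at \<A> p = (V, c) \<Longrightarrow> tderiv \<A> c p w = w"
proof -
  assume ca: "chart_at \<A> p = (V, c)"
  note c = chart_at_mem[OF ca]
  have "\<partial> w (\<lambda>x. c (inv_into V c x)) (c p) = \<partial> w (\<lambda>x. x) (c p)"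
    by (rule dir_deriv_cong_open[OF chart_open(2)[OF c(1)]]) (use c chart_inv[OF c(1)] in auto)
  then show ?thesis by (simp add: tderiv_eq[OF ca])
qed

lemma tderiv_chart_bij:
  assumes V: "(V, c) \<in> \<A>" "p \<in> V"
  shows "linear (tderiv \<A> c p)" "bij (tderiv \<A> c p)"
proof -
  obtain V0 c0 where ca: "chart_at \<A> p = (V0, c0)" by (cases "chart_at \<A> p")
  note c0 = chart_at_mem[OF ca]
  show lin: "linear (tderiv \<A> c p)"
    by (rule tderiv_linear[OF chart_smooth_map[OF V(1)] chart_open(1)[OF V(1)] V(2)])
  have "w = tderiv \<A> c0 p w" for w by (simp add: tderiv_chart_at[OF ca])
  also have "tderiv \<A> c0 p w = \<partial> (tderiv \<A> c p w) (\<lambda>x. c0 (inv_into V c x)) (c p)" for w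
    by (rule tderiv_chart[OF V]) (rule smooth_map_differentiable[OF chart_smooth_map[OF c0(1)] chart_open(1)[OF c0(1)] c0(2) V])
  finally have "inj (tderiv \<A> c p)" by (metis injI)
  then show "bij (tderiv \<A> c p)" using lin linear_injective_imp_surjective bij_def by blast
qed

lemma coord_field_tderiv:
  assumes V: "(V, c) \<in> \<A>" "p \<in> V"
  shows "tderiv \<A> c p (coord_field \<A> c w p) = w" "coord_field \<A> c (tderiv \<A> c p v) p = v"
    "linear (\<lambda>w. coord_field \<A> c w p)"
proof -
  note b = tderiv_chart_bij[OF V]
  show 1: "tderiv \<A> c p (coord_field \<A> c w p) = w" for w
    unfolding coord_field_def using b(2) by (simp add: bij_is_surj surj_f_inv_f)
  show 2: "coord_field \<A> c (tderiv \<A> c p v) p = v" for v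
    unfolding coord_field_def using b(2) by (simp add: bij_is_inj)
  have inj: "inj (tderiv \<A> c p)" using b(2) by (simp add: bij_is_inj)
  show "linear (\<lambda>w. coord_field \<A> c w p)"
    by (rule linearI; rule injD[OF inj]) (simp_all add: 1 linear_add[OF b(1)] linear_scale[OF b(1)])
qed

lemma tderiv_cong:
  assumes "open U" "p \<in> U" "\<And>q. q \<in> U \<Longrightarrow> f q = g q"
  shows "tderiv \<A> f p w = tderiv \<A> g p w"
proof -
  obtain V0 c0 where ca: "chart_at \<A> p = (V0, c0)" by (cases "chart_at \<A> p")
  note c0 = chart_at_mem[OF ca]
  show ?thesis unfolding tderiv_eq[OF ca]
    by (rule dir_deriv_cong_open[OF chart_image_open[OF c0(1) assms(1)]])
       (use c0 assms chart_inv(1)[OF c0(1)] in auto)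
qed

lemma tderiv_const: "tderiv \<A> (\<lambda>q. k) p w = 0"
  by (cases "chart_at \<A> p") (simp add: tderiv_eq)

subsection \<open>Vector fields\<close>

lemma vector_fieldsD:
  "X \<in> vector_fields \<A> U \<Longrightarrow> (V, c) \<in> \<A> \<Longrightarrow> smooth_map \<A> (U \<inter> V) (\<lambda>p. tderiv \<A> c p (X p))"
  unfolding vector_fields_def by blast

lemma vector_fieldsI:
  "(\<And>V c. (V, c) \<in> \<A> \<Longrightarrow> smooth_map \<A> (U \<inter> V) (\<lambda>p. tderiv \<A> c p (X p))) \<Longrightarrow> X \<in> vector_fields \<A> U"
  unfolding vector_fields_def by blast

lemma vector_fields_subset: "X \<in> vector_fields \<A> U \<Longrightarrow> U' \<subseteq> U \<Longrightarrow> X \<in> vector_fields \<A> U'"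
  by (rule vector_fieldsI, rule smooth_map_subset[OF vector_fieldsD]) auto

lemma vector_fields_add:
  assumes "open U" "X \<in> vector_fields \<A> U" "Y \<in> vector_fields \<A> U"
  shows "(\<lambda>q. X q + Y q) \<in> vector_fields \<A> U"
proof (rule vector_fieldsI)
  fix V c assume V: "(V, c) \<in> \<A>"
  have o: "open (U \<inter> V)" using chart_open[OF V] assms by auto
  show "smooth_map \<A> (U \<inter> V) (\<lambda>p. tderiv \<A> c p (X p + Y p))"
    by (rule smooth_map_cong[OF o _ smooth_map_add[OF o vector_fieldsD[OF assms(2) V] vector_fieldsD[OF assms(3) V]]])
       (use linear_add[OF tderiv_chart_bij(1)[OF V]] in auto)
qed

lemma vector_fields_scaleR:
  assumes "open U" "smooth_map \<A> U f" "X \<in> vector_fields \<A> U"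
  shows "(\<lambda>q. f q *\<^sub>R X q) \<in> vector_fields \<A> U"
proof (rule vector_fieldsI)
  fix V c assume V: "(V, c) \<in> \<A>"
  have o: "open (U \<inter> V)" using chart_open[OF V] assms by auto
  show "smooth_map \<A> (U \<inter> V) (\<lambda>p. tderiv \<A> c p (f p *\<^sub>R X p))"
    by (rule smooth_map_cong[OF o _ smooth_map_scaleR[OF o smooth_map_subset[OF assms(2)] vector_fieldsD[OF assms(3) V]]])
       (use linear_scale[OF tderiv_chart_bij(1)[OF V]] in auto)
qed

lemma vector_fields_zero: "(\<lambda>q. 0) \<in> vector_fields \<A> U"
proof (rule vector_fieldsI)
  fix V c assume V: "(V, c) \<in> \<A>"
  have "smooth_map \<A> V (\<lambda>p. tderiv \<A> c p 0)"
    by (rule smooth_map_cong[OF chart_open(1)[OF V] _ smooth_map_const[of _ 0]])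
       (use linear_0[OF tderiv_chart_bij(1)[OF V]] in auto)
  then show "smooth_map \<A> (U \<inter> V) (\<lambda>p. tderiv \<A> c p 0)" by (rule smooth_map_subset) auto
qed

lemma vector_fields_sum:
  assumes "open U" "\<And>i. i \<in> I \<Longrightarrow> X i \<in> vector_fields \<A> U"
  shows "(\<lambda>q. \<Sum>i\<in>I. X i q) \<in> vector_fields \<A> U"
  using assms(2)
  by (induction I rule: infinite_finite_induct) (auto simp: vector_fields_zero vector_fields_add[OF assms(1)])

text \<open>The components of a vector field in a chart.\<close>

definition vrep :: "'a set \<Rightarrow> ('a \<Rightarrow> real ^ 'n) \<Rightarrow> ('a \<Rightarrow> real ^ 'n) \<Rightarrow> real ^ 'n \<Rightarrow> real ^ 'n" where
  "vrep V c X x = tderiv \<A> c (inv_into V c x) (X (inv_into V c x))"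

lemma vrep_smooth:
  assumes "(V, c) \<in> \<A>" "X \<in> vector_fields \<A> U" "N \<subseteq> U \<inter> V"
  shows "smooth_on (c ` N) (vrep V c X)"
  using smooth_mapD'[OF vector_fieldsD[OF assms(2,1)] assms(1), of N] assms(3)
  unfolding vrep_def[abs_def] by auto

lemma vrep_at: "(V, c) \<in> \<A> \<Longrightarrow> q \<in> V \<Longrightarrow> vrep V c X (c q) = tderiv \<A> c q (X q)"
  by (simp add: vrep_def chart_inv)

lemma vector_fields_coordI:
  assumes V: "(V, c) \<in> \<A>" and U: "open U" "U \<subseteq> V" and g: "smooth_on (c ` U) g"
    and X: "\<And>q. q \<in> U \<Longrightarrow> X q = coord_field \<A> c (g (c q)) q"
  shows "X \<in> vector_fields \<A> U"
proof (rule vector_fieldsI)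
  fix W d assume W: "(W, d) \<in> \<A>"
  have o: "open (U \<inter> W)" using U chart_open[OF W] by auto
  have o': "open (c ` (U \<inter> W))" using chart_image_open'[OF V o] U by auto
  have s: "smooth_on (c ` (U \<inter> W)) (\<lambda>x. d (inv_into V c x))"
    by (rule smooth_on_subset[OF transition_smooth[OF V W]]) (use U in auto)
  have "smooth_on (c ` (U \<inter> W)) (\<lambda>x. \<partial> (g x) (\<lambda>x. d (inv_into V c x)) x)"
    by (rule smooth_on_linear_family[where L="\<lambda>x v. \<partial> v (\<lambda>x. d (inv_into V c x)) x", OF o'])
       (auto intro!: linear_dir_deriv smooth_onD(1)[OF s] smooth_onD(2)[OF s] smooth_on_subset[OF g])
  then have "smooth_on (c ` (U \<inter> W)) (\<lambda>x. tderiv \<A> d (inv_into V c x) (X (inv_into V c x)))"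
  proof (rule smooth_on_cong[OF o', rotated])
    fix x assume "x \<in> c ` (U \<inter> W)"
    then obtain q where q: "q \<in> U" "q \<in> W" "q \<in> V" "x = c q" using U by blast
    have "tderiv \<A> d q (X q) = \<partial> (tderiv \<A> c q (X q)) (\<lambda>x. d (inv_into V c x)) (c q)"
      by (rule tderiv_chart[OF V q(3)]) (use smooth_onD(1)[OF s] q in blast)
    then show "\<partial> (g x) (\<lambda>x. d (inv_into V c x)) x = tderiv \<A> d (inv_into V c x) (X (inv_into V c x))"
      using q X coord_field_tderiv(1)[OF V q(3)] chart_inv(1)[OF V] by simp
  qed
  from smooth_map_chartI[OF V o _ this] U show "smooth_map \<A> (U \<inter> W) (\<lambda>p. tderiv \<A> d p (X p))"
    by auto
qed

lemma tderiv_vrep: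
  assumes V: "(V, c) \<in> \<A>" "x \<in> c ` N" "open N" "N \<subseteq> V" and f: "smooth_map \<A> N f"
  shows "tderiv \<A> f (inv_into V c x) (X (inv_into V c x)) = \<partial> (vrep V c X x) (\<lambda>x. f (inv_into V c x)) x"
proof -
  obtain q where q: "q \<in> N" "q \<in> V" "x = c q" using V by blast
  show ?thesis unfolding q(3) vrep_at[OF V(1) q(2)] chart_inv(1)[OF V(1) q(2)]
    by (rule tderiv_chart[OF V(1) q(2)]) (rule smooth_map_differentiable[OF f V(3) q(1) V(1) q(2)])
qed

subsection \<open>The Lie bracket\<close>

lemma smooth_map_tderiv:
  assumes "open U" "smooth_map \<A> U f" "X \<in> vector_fields \<A> U"
  shows "smooth_map \<A> U (\<lambda>q. tderiv \<A> f q (X q))"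
proof (rule smooth_mapI)
  fix p assume p: "p \<in> U"
  obtain V c where V: "(V, c) \<in> \<A>" "p \<in> V" by (rule chart_ex)
  let ?N = "U \<inter> V"
  have o: "open ?N" using assms chart_open[OF V(1)] by auto
  have o': "open (c ` ?N)" by (rule chart_image_open[OF V(1) assms(1)])
  have s: "smooth_on (c ` ?N) (\<lambda>x. f (inv_into V c x))" by (rule smooth_mapD[OF assms(2) V(1)])
  have "smooth_on (c ` ?N) (\<lambda>x. \<partial> (vrep V c X x) (\<lambda>x. f (inv_into V c x)) x)"
    by (rule smooth_on_linear_family[where L="\<lambda>x v. \<partial> v (\<lambda>x. f (inv_into V c x)) x", OF o' _ _ vrep_smooth[OF V(1) assms(3)]])
       (auto intro!: linear_dir_deriv smooth_onD(1)[OF s] smooth_onD(2)[OF s])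
  then have "smooth_on (c ` ?N) (\<lambda>x. tderiv \<A> f (inv_into V c x) (X (inv_into V c x)))"
    by (rule smooth_on_cong[OF o', rotated])
       (rule tderiv_vrep[OF V(1) _ o _ smooth_map_subset[OF assms(2)], symmetric], auto)
  then show "\<exists>V c N. (V, c) \<in> \<A> \<and> open N \<and> p \<in> N \<and> N \<subseteq> V \<and>
      smooth_on (c ` N) (\<lambda>x. tderiv \<A> f (inv_into V c x) (X (inv_into V c x)))"
    using V p o by (intro exI[of _ V] exI[of _ c] exI[of _ ?N]) auto
qed

text \<open>
  The first summand is symmetric in the two vectors, the second one contributes the Lie bracket.
\<close>

lemma tderiv_tderiv_vrep:
  assumes V: "(V, c) \<in> \<A>" "q \<in> N" "open N" "N \<subseteq> V" and f: "smooth_map \<A> N f"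
    and Y: "Y \<in> vector_fields \<A> N"
  shows "tderiv \<A> (\<lambda>q. tderiv \<A> f q (Y q)) q (X q) =
     \<partial> (vrep V c X (c q)) (\<lambda>y. \<partial> (vrep V c Y (c q)) (\<lambda>x. f (inv_into V c x)) y) (c q)
     + \<partial> (\<partial> (vrep V c X (c q)) (vrep V c Y) (c q)) (\<lambda>x. f (inv_into V c x)) (c q)"
proof -
  have q: "q \<in> V" using V by auto
  have x: "c q \<in> c ` N" using V by auto
  have o': "open (c ` N)" by (rule chart_image_open'[OF V(1,3,4)])
  have s: "smooth_on (c ` N) (\<lambda>x. f (inv_into V c x))" by (rule smooth_mapD'[OF f V(1)]) (use V in auto)
  have "tderiv \<A> (\<lambda>q. tderiv \<A> f q (Y q)) q (X q) =
     \<partial> (vrep V c X (c q)) (\<lambda>x. tderiv \<A> f (inv_into V c x) (Y (inv_into V c x))) (c q)"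
    using tderiv_vrep[OF V(1) x V(3,4) smooth_map_tderiv[OF V(3) f Y], of X] chart_inv(1)[OF V(1) q] by simp
  also have "\<dots> = \<partial> (vrep V c X (c q)) (\<lambda>x. \<partial> (vrep V c Y x) (\<lambda>x. f (inv_into V c x)) x) (c q)"
    by (rule dir_deriv_cong_open[OF o' x]) (rule tderiv_vrep[OF V(1) _ V(3,4) f])
  also have "\<dots> = \<partial> (vrep V c X (c q)) (\<lambda>y. \<partial> (vrep V c Y (c q)) (\<lambda>x. f (inv_into V c x)) y) (c q)
     + \<partial> (\<partial> (vrep V c X (c q)) (vrep V c Y) (c q)) (\<lambda>x. f (inv_into V c x)) (c q)"
    by (rule dir_deriv_linear_family[where L="\<lambda>x v. \<partial> v (\<lambda>x. f (inv_into V c x)) x", OF o' x])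
       (use V in \<open>auto intro!: linear_dir_deriv smooth_onD(1)[OF s] smooth_onD(2)[OF s] vrep_smooth[OF V(1) Y]\<close>)
  finally show ?thesis .
qed

text \<open>
  The bracket is defined in the chart chosen at the point. Characterising it as the commutator of
  derivations shows that it has the same expression in every chart.
\<close>

lemma lie_bracket_tderiv:
  fixes f :: "'a \<Rightarrow> 'w::euclidean_space"
  assumes "open U" "p \<in> U" and f: "smooth_map \<A> U f" and X: "X \<in> vector_fields \<A> U" and Y: "Y \<in> vector_fields \<A> U"
  shows "tderiv \<A> f p (lie_bracket \<A> X Y p) =
     tderiv \<A> (\<lambda>q. tderiv \<A> f q (Y q)) p (X p) - tderiv \<A> (\<lambda>q. tderiv \<A> f q (X q)) p (Y p)"
proof -
  obtain V c where ca: "chart_at \<A> p = (V, c)" by (cases "chart_at \<A> p")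
  note c = chart_at_mem[OF ca]
  let ?N = "U \<inter> V"
  have N: "p \<in> ?N" "open ?N" "?N \<subseteq> V" using assms c chart_open[OF c(1)] by auto
  have o': "open (c ` ?N)" by (rule chart_image_open'[OF c(1) N(2,3)])
  have x: "c p \<in> c ` ?N" using N by auto
  have XY: "X \<in> vector_fields \<A> ?N" "Y \<in> vector_fields \<A> ?N" using X Y vector_fields_subset by blast+
  have f': "smooth_map \<A> ?N f" by (rule smooth_map_subset[OF f]) auto
  let ?f = "\<lambda>x. f (inv_into V c x)"
  have s: "smooth_on (c ` ?N) ?f" by (rule smooth_mapD[OF f c(1)])
  let ?X = "vrep V c X" and ?Y = "vrep V c Y"
  have "lie_bracket \<A> X Y p = \<partial> (?X (c p)) ?Y (c p) - \<partial> (?Y (c p)) ?X (c p)"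
    unfolding lie_bracket_def ca vrep_at[OF c(1,2)] tderiv_chart_at[OF ca]
    unfolding tderiv_eq[OF ca] vrep_def[abs_def] by (simp add: tderiv_eq[OF ca])
  then have "tderiv \<A> f p (lie_bracket \<A> X Y p) = \<partial> (\<partial> (?X (c p)) ?Y (c p) - \<partial> (?Y (c p)) ?X (c p)) ?f (c p)"
    by (simp add: tderiv_eq[OF ca])
  also have "\<dots> = \<partial> (\<partial> (?X (c p)) ?Y (c p)) ?f (c p) - \<partial> (\<partial> (?Y (c p)) ?X (c p)) ?f (c p)"
    by (rule linear_diff[OF linear_dir_deriv[OF smooth_onD(1)[OF s x]]])
  also have "\<dots> = tderiv \<A> (\<lambda>q. tderiv \<A> f q (Y q)) p (X p) - tderiv \<A> (\<lambda>q. tderiv \<A> f q (X q)) p (Y p)"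
    unfolding tderiv_tderiv_vrep[OF c(1) N f' XY(1), of Y] tderiv_tderiv_vrep[OF c(1) N f' XY(2), of X]
      dir_deriv_commute[OF o' s x, of "?Y (c p)" "?X (c p)"] by simp
  finally show ?thesis .
qed

lemma lie_bracket_vector_field:
  assumes "open U" and X: "X \<in> vector_fields \<A> U" and Y: "Y \<in> vector_fields \<A> U"
  shows "lie_bracket \<A> X Y \<in> vector_fields \<A> U"
proof (rule vector_fieldsI)
  fix V c assume V: "(V, c) \<in> \<A>"
  let ?N = "U \<inter> V"
  have o: "open ?N" using assms chart_open[OF V] by auto
  have c: "smooth_map \<A> ?N c" by (rule smooth_map_subset[OF chart_smooth_map[OF V]]) auto
  have XY: "X \<in> vector_fields \<A> ?N" "Y \<in> vector_fields \<A> ?N" using X Y vector_fields_subset by blast+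
  have "smooth_map \<A> ?N (\<lambda>p. tderiv \<A> (\<lambda>q. tderiv \<A> c q (Y q)) p (X p) + (-1) *\<^sub>R tderiv \<A> (\<lambda>q. tderiv \<A> c q (X q)) p (Y p))"
    by (intro smooth_map_add smooth_map_scaleR smooth_map_const smooth_map_tderiv o c XY)
  then show "smooth_map \<A> ?N (\<lambda>p. tderiv \<A> c p (lie_bracket \<A> X Y p))"
    by (rule smooth_map_cong[OF o, rotated]) (simp add: lie_bracket_tderiv[OF o _ c XY])
qed

lemma vrep_lie_bracket:
  assumes V: "(V, c) \<in> \<A>" and N: "open N" "N \<subseteq> V" and x: "x \<in> c ` N"
    and X: "X \<in> vector_fields \<A> N" and Y: "Y \<in> vector_fields \<A> N"
  shows "vrep V c (lie_bracket \<A> X Y) x = \<partial> (vrep V c X x) (vrep V c Y) x - \<partial> (vrep V c Y x) (vrep V c X) x"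
proof -
  have c: "smooth_map \<A> N c" by (rule smooth_map_subset[OF chart_smooth_map[OF V] N(2)])
  obtain q where q: "q \<in> N" "q \<in> V" "x = c q" using N x by auto
  have 1: "tderiv \<A> (\<lambda>q. tderiv \<A> c q (Y q)) q (X q) = \<partial> (vrep V c X x) (vrep V c Y) x"
    if "Y \<in> vector_fields \<A> N" for X Y
    using tderiv_vrep[OF V x N smooth_map_tderiv[OF N(1) c that], of X] q chart_inv(1)[OF V q(2)]
    by (simp add: vrep_def[abs_def])
  show ?thesis
    using lie_bracket_tderiv[OF N(1) q(1) c X Y] unfolding 1[OF X] 1[OF Y]
    by (simp add: q(3) vrep_at[OF V q(2)])
qed

end

section \<open>Cutting off and extending by zero\<close>

context manifold
begin

lemma cutoff:
  assumes N: "open N" "p \<in> N"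
  obtains \<kappa> :: "'a \<Rightarrow> real" and N' K where "open N'" "p \<in> N'" "N' \<subseteq> N" "closed K" "K \<subseteq> N"
    "smooth_map \<A> UNIV \<kappa>" "\<And>q. q \<in> N' \<Longrightarrow> \<kappa> q = 1" "\<And>q. q \<notin> K \<Longrightarrow> \<kappa> q = 0"
proof -
  obtain V c where V: "(V, c) \<in> \<A>" "p \<in> V" by (rule chart_ex)
  obtain s where s: "s > 0" "cball (c p) s \<subseteq> c ` (N \<inter> V)"
    using chart_image_open[OF V(1) N(1)] V(2) N(2) open_contains_cball by blast
  obtain \<beta> :: "real ^ 'n \<Rightarrow> real" where \<beta>: "smooth_on UNIV \<beta>" "\<And>x. x \<in> ball (c p) (s / 2) \<Longrightarrow> \<beta> x = 1"
    "\<And>x. x \<notin> ball (c p) s \<Longrightarrow> \<beta> x = 0"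
    using smooth_bump[of "s / 2" s "c p"] s(1) by auto
  define K where "K = inv_into V c ` cball (c p) s"
  define N' where "N' = {q \<in> V. c q \<in> ball (c p) (s / 2)}"
  define \<kappa> where "\<kappa> q = (if q \<in> V then \<beta> (c q) else 0)" for q
  have K: "closed K"
    unfolding K_def
    by (intro compact_imp_closed compact_continuous_image continuous_on_subset[OF chart_cont(2)[OF V(1)]])
       (use s in auto)
  have KN: "K \<subseteq> N \<inter> V"
  proof
    fix q assume "q \<in> K"
    then obtain x where x: "x \<in> cball (c p) s" "q = inv_into V c x" unfolding K_def by blast
    then obtain q' where "q' \<in> N" "q' \<in> V" "x = c q'" using s(2) by blast
    then show "q \<in> N \<inter> V" using x(2) chart_inv(1)[OF V(1)] by simp
  qed
  have \<kappa>0: "\<kappa> q = 0" if "q \<notin> K" for q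
  proof (cases "q \<in> V \<and> c q \<in> ball (c p) s")
    case True
    then have "q \<in> K" unfolding K_def using chart_inv(1)[OF V(1), of q] ball_subset_cball
      by (metis image_eqI subsetD)
    then show ?thesis using that by simp
  next
    case False
    then show ?thesis using \<beta>(3) by (auto simp: \<kappa>_def)
  qed
  have "smooth_map \<A> UNIV \<kappa>"
  proof (rule smooth_map_local)
    fix q :: 'a
    show "\<exists>N. open N \<and> q \<in> N \<and> smooth_map \<A> N \<kappa>"
    proof (cases "q \<in> V")
      case True
      have "smooth_map \<A> V \<kappa>"
      proof (rule smooth_map_chartI[OF V(1)])
        show "smooth_on (c ` V) (\<lambda>x. \<kappa> (inv_into V c x))"
          by (rule smooth_on_cong[OF chart_open(2)[OF V(1)] _ smooth_on_subset[OF \<beta>(1)]])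
             (use chart_inv[OF V(1)] in \<open>auto simp: \<kappa>_def\<close>)
      qed (use chart_open[OF V(1)] in auto)
      then show ?thesis using True chart_open(1)[OF V(1)] by blast
    next
      case False
      have o: "open (- K)" using K by auto
      have "smooth_map \<A> (- K) \<kappa>"
        by (rule smooth_map_cong[OF o _ smooth_map_const[of _ 0]]) (use \<kappa>0 in auto)
      then show ?thesis using False KN o by blast
    qed
  qed
  moreover have "N' \<subseteq> N"
  proof
    fix q assume "q \<in> N'"
    then have q: "q \<in> V" "c q \<in> ball (c p) (s / 2)" by (auto simp: N'_def)
    have "c q \<in> cball (c p) s" using q s(1) by simp
    then have "q \<in> K" unfolding K_def using chart_inv(1)[OF V(1) q(1)] by (metis image_eqI)
    then show "q \<in> N" using KN by blast
  qed
  moreover have "open N'" unfolding N'_def by (rule chart_preimage_open[OF V(1)]) simp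
  moreover have "p \<in> N'" using V s(1) by (simp add: N'_def)
  moreover have "\<kappa> q = 1" if "q \<in> N'" for q using that \<beta>(2) by (simp add: \<kappa>_def N'_def)
  ultimately show thesis using that K KN \<kappa>0 by blast
qed

text \<open>
  If \<open>\<kappa>\<close> vanishes outside a closed subset of \<open>N\<close>, the product is smooth beyond \<open>N\<close> even
  though \<open>f\<close> is only controlled on \<open>N\<close>. As the components of vector fields and sections are linear in their
  values, the same extension works for functions, vector fields and sections.
\<close>

definition ext0 :: "'a set \<Rightarrow> ('a \<Rightarrow> real) \<Rightarrow> ('a \<Rightarrow> 'x::real_vector) \<Rightarrow> 'a \<Rightarrow> 'x" where
  "ext0 N \<kappa> f q = (if q \<in> N then \<kappa> q *\<^sub>R f q else 0)"

lemma smooth_map_ext0: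
  assumes U: "open U" "open N" and K: "closed K" "K \<subseteq> N" and \<kappa>: "smooth_map \<A> UNIV \<kappa>" "\<And>q. q \<notin> K \<Longrightarrow> \<kappa> q = 0"
    and f: "smooth_map \<A> (U \<inter> N) f"
  shows "smooth_map \<A> U (ext0 N \<kappa> f)"
proof (rule smooth_map_local)
  fix q assume q: "q \<in> U"
  show "\<exists>N'. open N' \<and> q \<in> N' \<and> smooth_map \<A> N' (ext0 N \<kappa> f)"
  proof (cases "q \<in> N")
    case True
    have o: "open (U \<inter> N)" using U by auto
    have "smooth_map \<A> (U \<inter> N) (ext0 N \<kappa> f)"
      by (rule smooth_map_cong[OF o _ smooth_map_scaleR[OF o smooth_map_subset[OF \<kappa>(1)] f]])
         (auto simp: ext0_def)
    then show ?thesis using True q o by blast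
  next
    case False
    have o: "open (- K)" using K by auto
    have "smooth_map \<A> (- K) (ext0 N \<kappa> f)"
      by (rule smooth_map_cong[OF o _ smooth_map_const[of _ 0]]) (use \<kappa> in \<open>auto simp: ext0_def\<close>)
    then show ?thesis using False K o by blast
  qed
qed

lemma vector_fields_ext0:
  assumes U: "open U" "open N" and K: "closed K" "K \<subseteq> N" and \<kappa>: "smooth_map \<A> UNIV \<kappa>" "\<And>q. q \<notin> K \<Longrightarrow> \<kappa> q = 0"
    and X: "X \<in> vector_fields \<A> (U \<inter> N)"
  shows "ext0 N \<kappa> X \<in> vector_fields \<A> U"
proof (rule vector_fieldsI)
  fix V c assume V: "(V, c) \<in> \<A>"
  have o: "open (U \<inter> V)" using U chart_open[OF V] by auto
  have "smooth_map \<A> (U \<inter> V) (ext0 N \<kappa> (\<lambda>q. tderiv \<A> c q (X q)))"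
  proof (rule smooth_map_ext0[where K=K, OF o U(2) K \<kappa>(1)])
    show "smooth_map \<A> (U \<inter> V \<inter> N) (\<lambda>q. tderiv \<A> c q (X q))"
      by (rule smooth_map_subset[OF vector_fieldsD[OF X V]]) auto
  qed (rule \<kappa>(2))
  then show "smooth_map \<A> (U \<inter> V) (\<lambda>p. tderiv \<A> c p (ext0 N \<kappa> X p))"
    by (rule smooth_map_cong[OF o, rotated])
       (use linear_scale[OF tderiv_chart_bij(1)[OF V]] linear_0[OF tderiv_chart_bij(1)[OF V]] in \<open>auto simp: ext0_def\<close>)
qed

end

section \<open>Vector bundles\<close>

locale vbundle = manifold \<A>
  for \<A> :: "('a::{t2_space, second_countable_topology}, 'n::finite) chart set" +
  fixes E :: "'a \<Rightarrow> 'e::real_vector set" and \<T> :: "('a, 'e, 'm::finite) triv set"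
  assumes vbundle: "vector_bundle \<A> E \<T>"
begin

lemma fibre_subspace: "subspace (E p)" using vbundle by (simp add: vector_bundle_def)

lemma triv_ex: obtains W \<Phi> where "(W, \<Phi>) \<in> \<T>" "p \<in> W"
proof -
  have "p \<in> (\<Union>(V, \<Phi>)\<in>\<T>. V)" using vbundle by (simp add: vector_bundle_def)
  then show thesis using that by auto
qed

lemma
  assumes "(W, \<Phi>) \<in> \<T>"
  shows triv_open: "open W"
    and triv_fibre_linear: "q \<in> W \<Longrightarrow> fibre_linear (E q) (\<Phi> q)"
    and triv_bij: "q \<in> W \<Longrightarrow> bij_betw (\<Phi> q) (E q) UNIV"
proof -
  have "\<forall>(V, \<Phi>)\<in>\<T>. open V \<and> (\<forall>p\<in>V. fibre_linear (E p) (\<Phi> p) \<and> bij_betw (\<Phi> p) (E p) UNIV)"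
    using vbundle by (simp add: vector_bundle_def)
  from bspec[OF this assms]
  show "open W" "q \<in> W \<Longrightarrow> fibre_linear (E q) (\<Phi> q)" "q \<in> W \<Longrightarrow> bij_betw (\<Phi> q) (E q) UNIV" by auto
qed

lemma triv_transition:
  assumes "(W, \<Phi>) \<in> \<T>" "(W', \<Psi>) \<in> \<T>"
  shows "smooth_map \<A> (W \<inter> W') (\<lambda>p. \<Psi> p (frame E \<Phi> v p))"
proof -
  have "\<forall>(V, \<Phi>)\<in>\<T>. \<forall>(W, \<Psi>)\<in>\<T>. \<forall>v. smooth_map \<A> (V \<inter> W) (\<lambda>p. \<Psi> p (frame E \<Phi> v p))"
    using vbundle by (simp add: vector_bundle_def)
  from bspec[OF bspec[OF this assms(1), simplified] assms(2)] show ?thesis by simp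
qed

lemma
  assumes "(W, \<Phi>) \<in> \<T>" "q \<in> W"
  shows frame_in: "frame E \<Phi> v q \<in> E q"
    and triv_frame: "\<Phi> q (frame E \<Phi> v q) = v"
    and frame_triv: "e \<in> E q \<Longrightarrow> frame E \<Phi> (\<Phi> q e) q = e"
    and triv_add: "e \<in> E q \<Longrightarrow> e' \<in> E q \<Longrightarrow> \<Phi> q (e + e') = \<Phi> q e + \<Phi> q e'"
    and triv_scale: "e \<in> E q \<Longrightarrow> \<Phi> q (k *\<^sub>R e) = k *\<^sub>R \<Phi> q e"
    and triv_inject: "e \<in> E q \<Longrightarrow> e' \<in> E q \<Longrightarrow> \<Phi> q e = \<Phi> q e' \<Longrightarrow> e = e'"
proof -
  note b = triv_bij[OF assms]
  show 1: "frame E \<Phi> v q \<in> E q" unfolding frame_def using b by (auto simp: bij_betw_def intro!: inv_into_into)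
  show "\<Phi> q (frame E \<Phi> v q) = v" unfolding frame_def using b by (simp add: bij_betw_inv_into_right)
  show "e \<in> E q \<Longrightarrow> frame E \<Phi> (\<Phi> q e) q = e" unfolding frame_def using b by (simp add: bij_betw_inv_into_left)
  show "e \<in> E q \<Longrightarrow> e' \<in> E q \<Longrightarrow> \<Phi> q (e + e') = \<Phi> q e + \<Phi> q e'"
    "e \<in> E q \<Longrightarrow> \<Phi> q (k *\<^sub>R e) = k *\<^sub>R \<Phi> q e"
    using triv_fibre_linear[OF assms] by (auto simp: fibre_linear_def)
  show "e \<in> E q \<Longrightarrow> e' \<in> E q \<Longrightarrow> \<Phi> q e = \<Phi> q e' \<Longrightarrow> e = e'"
    using b by (auto simp: bij_betw_def inj_on_def)
qed

lemma triv_0: "(W, \<Phi>) \<in> \<T> \<Longrightarrow> q \<in> W \<Longrightarrow> \<Phi> q 0 = 0"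
  using triv_scale[of W \<Phi> q 0 0] subspace_0[OF fibre_subspace] by simp

lemma triv_diff:
  assumes "(W, \<Phi>) \<in> \<T>" "q \<in> W" "e \<in> E q" "e' \<in> E q"
  shows "\<Phi> q (e - e') = \<Phi> q e - \<Phi> q e'"
  using triv_add[OF assms(1,2), of "e - e'" e'] subspace_diff[OF fibre_subspace] assms by simp

lemma triv_sum:
  assumes "(W, \<Phi>) \<in> \<T>" "q \<in> W" "\<And>i. i \<in> I \<Longrightarrow> e i \<in> E q"
  shows "\<Phi> q (\<Sum>i\<in>I. e i) = (\<Sum>i\<in>I. \<Phi> q (e i))"
  using assms(3)
  by (induction I rule: infinite_finite_induct)
     (auto simp: triv_0[OF assms(1,2)] triv_add[OF assms(1,2)] subspace_sum[OF fibre_subspace])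

lemma frame_linear:
  assumes "(W, \<Phi>) \<in> \<T>" "q \<in> W"
  shows "linear (\<lambda>v. frame E \<Phi> v q)"
  by (rule linearI; rule triv_inject[OF assms])
     (auto simp: frame_in[OF assms] triv_frame[OF assms] triv_add[OF assms] triv_scale[OF assms]
       subspace_add[OF fibre_subspace] subspace_scale[OF fibre_subspace])

lemma sectionsD:
  assumes "\<eta> \<in> sections \<A> E \<T> U"
  shows "q \<in> U \<Longrightarrow> \<eta> q \<in> E q" "(W, \<Phi>) \<in> \<T> \<Longrightarrow> smooth_map \<A> (U \<inter> W) (\<lambda>p. \<Phi> p (\<eta> p))"
  using assms unfolding sections_def by auto

lemma sectionsI:
  "(\<And>q. q \<in> U \<Longrightarrow> \<eta> q \<in> E q) \<Longrightarrow> (\<And>W \<Phi>. (W, \<Phi>) \<in> \<T> \<Longrightarrow> smooth_map \<A> (U \<inter> W) (\<lambda>p. \<Phi> p (\<eta> p))) \<Longrightarrow>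
    \<eta> \<in> sections \<A> E \<T> U"
  unfolding sections_def by auto

lemma sections_subset: "\<eta> \<in> sections \<A> E \<T> U \<Longrightarrow> U' \<subseteq> U \<Longrightarrow> \<eta> \<in> sections \<A> E \<T> U'"
  by (rule sectionsI) (auto intro: sectionsD smooth_map_subset[OF sectionsD(2)])

lemma sections_add:
  assumes "open U" "\<eta> \<in> sections \<A> E \<T> U" "\<zeta> \<in> sections \<A> E \<T> U"
  shows "(\<lambda>q. \<eta> q + \<zeta> q) \<in> sections \<A> E \<T> U"
proof (rule sectionsI)
  show "\<eta> q + \<zeta> q \<in> E q" if "q \<in> U" for q
    using that assms sectionsD(1) subspace_add[OF fibre_subspace] by blast
  fix W \<Phi> assume W: "(W, \<Phi>) \<in> \<T>"
  have o: "open (U \<inter> W)" using assms triv_open[OF W] by auto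
  show "smooth_map \<A> (U \<inter> W) (\<lambda>p. \<Phi> p (\<eta> p + \<zeta> p))"
    by (rule smooth_map_cong[OF o _ smooth_map_add[OF o sectionsD(2)[OF assms(2) W] sectionsD(2)[OF assms(3) W]]])
       (use triv_add[OF W] sectionsD(1)[OF assms(2)] sectionsD(1)[OF assms(3)] in auto)
qed

lemma sections_scaleR:
  assumes "open U" "smooth_map \<A> U f" "\<eta> \<in> sections \<A> E \<T> U"
  shows "(\<lambda>q. f q *\<^sub>R \<eta> q) \<in> sections \<A> E \<T> U"
proof (rule sectionsI)
  show "f q *\<^sub>R \<eta> q \<in> E q" if "q \<in> U" for q
    using that assms sectionsD(1) subspace_scale[OF fibre_subspace] by blast
  fix W \<Phi> assume W: "(W, \<Phi>) \<in> \<T>"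
  have o: "open (U \<inter> W)" using assms triv_open[OF W] by auto
  show "smooth_map \<A> (U \<inter> W) (\<lambda>p. \<Phi> p (f p *\<^sub>R \<eta> p))"
    by (rule smooth_map_cong[OF o _ smooth_map_scaleR[OF o smooth_map_subset[OF assms(2)] sectionsD(2)[OF assms(3) W]]])
       (use triv_scale[OF W] sectionsD(1)[OF assms(3)] in auto)
qed

lemma sections_zero: "(\<lambda>q. 0) \<in> sections \<A> E \<T> U"
proof (rule sectionsI)
  fix W \<Phi> assume W: "(W, \<Phi>) \<in> \<T>"
  have "smooth_map \<A> W (\<lambda>p. \<Phi> p 0)"
    by (rule smooth_map_cong[OF triv_open[OF W] _ smooth_map_const[of _ 0]]) (use triv_0[OF W] in auto)
  then show "smooth_map \<A> (U \<inter> W) (\<lambda>p. \<Phi> p 0)" by (rule smooth_map_subset) auto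
qed (rule subspace_0[OF fibre_subspace])

lemma sections_sum:
  assumes "open U" "\<And>i. i \<in> I \<Longrightarrow> \<eta> i \<in> sections \<A> E \<T> U"
  shows "(\<lambda>q. \<Sum>i\<in>I. \<eta> i q) \<in> sections \<A> E \<T> U"
  using assms(2)
  by (induction I rule: infinite_finite_induct) (auto simp: sections_zero sections_add[OF assms(1)])

lemma sections_ext0:
  assumes U: "open U" "open N" and K: "closed K" "K \<subseteq> N" and \<kappa>: "smooth_map \<A> UNIV \<kappa>" "\<And>q. q \<notin> K \<Longrightarrow> \<kappa> q = 0"
    and \<eta>: "\<eta> \<in> sections \<A> E \<T> (U \<inter> N)"
  shows "ext0 N \<kappa> \<eta> \<in> sections \<A> E \<T> U"
proof (rule sectionsI)
  show "ext0 N \<kappa> \<eta> q \<in> E q" if "q \<in> U" for q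
    using that sectionsD(1)[OF \<eta>] subspace_scale[OF fibre_subspace] subspace_0[OF fibre_subspace] by (auto simp: ext0_def)
  fix W \<Phi> assume W: "(W, \<Phi>) \<in> \<T>"
  have o: "open (U \<inter> W)" using U triv_open[OF W] by auto
  have "smooth_map \<A> (U \<inter> W) (ext0 N \<kappa> (\<lambda>q. \<Phi> q (\<eta> q)))"
  proof (rule smooth_map_ext0[where K=K, OF o U(2) K \<kappa>(1)])
    show "smooth_map \<A> (U \<inter> W \<inter> N) (\<lambda>q. \<Phi> q (\<eta> q))"
      by (rule smooth_map_subset[OF sectionsD(2)[OF \<eta> W]]) auto
  qed (rule \<kappa>(2))
  then show "smooth_map \<A> (U \<inter> W) (\<lambda>p. \<Phi> p (ext0 N \<kappa> \<eta> p))"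
    by (rule smooth_map_cong[OF o, rotated])
       (use triv_scale[OF W] triv_0[OF W] sectionsD(1)[OF \<eta>] in \<open>auto simp: ext0_def\<close>)
qed

lemma sections_frameI:
  assumes W: "(W, \<Phi>) \<in> \<T>" and U: "open U" "U \<subseteq> W" and g: "smooth_map \<A> U g"
    and \<eta>: "\<And>q. q \<in> U \<Longrightarrow> \<eta> q = frame E \<Phi> (g q) q"
  shows "\<eta> \<in> sections \<A> E \<T> U"
proof (rule sectionsI)
  show "\<eta> q \<in> E q" if "q \<in> U" for q using \<eta>[OF that] frame_in[OF W] U that by auto
  fix W' \<Psi> assume W': "(W', \<Psi>) \<in> \<T>"
  have o: "open (U \<inter> W')" using U triv_open[OF W'] by auto
  have "smooth_map \<A> (U \<inter> W') (\<lambda>q. \<Sum>b\<in>Basis. (g q \<bullet> b) *\<^sub>R \<Psi> q (frame E \<Phi> b q))"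
    by (rule smooth_map_sum[OF o], rule smooth_map_scaleR[OF o smooth_map_inner_left[OF o smooth_map_subset[OF g]]
          smooth_map_subset[OF triv_transition[OF W W']]]) (use U in auto)
  then show "smooth_map \<A> (U \<inter> W') (\<lambda>p. \<Psi> p (\<eta> p))"
  proof (rule smooth_map_cong[OF o, rotated])
    fix q assume q: "q \<in> U \<inter> W'"
    then have q': "q \<in> W" "q \<in> W'" using U by auto
    have "linear (\<lambda>v. \<Psi> q (frame E \<Phi> v q))"
      by (rule linearI) (simp_all add: linear_add[OF frame_linear[OF W q'(1)]] linear_scale[OF frame_linear[OF W q'(1)]]
           frame_in[OF W q'(1)] triv_add[OF W' q'(2)] triv_scale[OF W' q'(2)])
    from linear_expand[OF this, of "g q"] show "(\<Sum>b\<in>Basis. (g q \<bullet> b) *\<^sub>R \<Psi> q (frame E \<Phi> b q)) = \<Psi> q (\<eta> q)"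
      using \<eta> q by simp
  qed
qed

subsection \<open>Connections\<close>

lemma
  assumes D: "connection \<A> E \<T> U D" and X: "X \<in> vector_fields \<A> U" and \<eta>: "\<eta> \<in> sections \<A> E \<T> U"
  shows connection_section: "D X \<eta> \<in> sections \<A> E \<T> U"
    and connection_cong: "Y \<in> vector_fields \<A> U \<Longrightarrow> \<zeta> \<in> sections \<A> E \<T> U \<Longrightarrow> (\<And>q. q \<in> U \<Longrightarrow> X q = Y q) \<Longrightarrow>
       (\<And>q. q \<in> U \<Longrightarrow> \<eta> q = \<zeta> q) \<Longrightarrow> p \<in> U \<Longrightarrow> D X \<eta> p = D Y \<zeta> p"
    and connection_add1: "Y \<in> vector_fields \<A> U \<Longrightarrow> p \<in> U \<Longrightarrow> D (\<lambda>q. X q + Y q) \<eta> p = D X \<eta> p + D Y \<eta> p"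
    and connection_scaleR1: "smooth_map \<A> U f \<Longrightarrow> p \<in> U \<Longrightarrow> D (\<lambda>q. f q *\<^sub>R X q) \<eta> p = f p *\<^sub>R D X \<eta> p"
    and connection_add2: "\<zeta> \<in> sections \<A> E \<T> U \<Longrightarrow> p \<in> U \<Longrightarrow> D X (\<lambda>q. \<eta> q + \<zeta> q) p = D X \<eta> p + D X \<zeta> p"
    and connection_scaleR2: "smooth_map \<A> U f \<Longrightarrow> p \<in> U \<Longrightarrow>
       D X (\<lambda>q. f q *\<^sub>R \<eta> q) p = f p *\<^sub>R D X \<eta> p + tderiv \<A> f p (X p) *\<^sub>R \<eta> p"
proof -
  note D' = D[unfolded connection_def]
  show "D X \<eta> \<in> sections \<A> E \<T> U" by (rule D'[THEN conjunct1, rule_format, OF X \<eta>])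
  show "D X \<eta> p = D Y \<zeta> p" if "Y \<in> vector_fields \<A> U" "\<zeta> \<in> sections \<A> E \<T> U" "\<And>q. q \<in> U \<Longrightarrow> X q = Y q"
       "\<And>q. q \<in> U \<Longrightarrow> \<eta> q = \<zeta> q" "p \<in> U"
    by (rule D'[THEN conjunct2, THEN conjunct1, rule_format, OF X that(1) \<eta> that(2) conjI, OF that(3,4), OF _ _ that(5)])
  show "D (\<lambda>q. X q + Y q) \<eta> p = D X \<eta> p + D Y \<eta> p" if "Y \<in> vector_fields \<A> U" "p \<in> U"
    by (rule D'[THEN conjunct2, THEN conjunct2, THEN conjunct1, rule_format, OF X that(1) \<eta> that(2)])
  show "D (\<lambda>q. f q *\<^sub>R X q) \<eta> p = f p *\<^sub>R D X \<eta> p" if "smooth_map \<A> U f" "p \<in> U"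
    by (rule D'[THEN conjunct2, THEN conjunct2, THEN conjunct2, THEN conjunct1, rule_format, OF that(1) X \<eta> that(2)])
  show "D X (\<lambda>q. \<eta> q + \<zeta> q) p = D X \<eta> p + D X \<zeta> p" if "\<zeta> \<in> sections \<A> E \<T> U" "p \<in> U"
    by (rule D'[THEN conjunct2, THEN conjunct2, THEN conjunct2, THEN conjunct2, THEN conjunct1, rule_format, OF X \<eta> that])
  show "D X (\<lambda>q. f q *\<^sub>R \<eta> q) p = f p *\<^sub>R D X \<eta> p + tderiv \<A> f p (X p) *\<^sub>R \<eta> p" if "smooth_map \<A> U f" "p \<in> U"
    by (rule D'[THEN conjunct2, THEN conjunct2, THEN conjunct2, THEN conjunct2, THEN conjunct2, rule_format, OF that(1) X \<eta> that(2)])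
qed

lemma connection_zero:
  assumes D: "connection \<A> E \<T> U D" and p: "p \<in> U"
  shows "\<eta> \<in> sections \<A> E \<T> U \<Longrightarrow> D (\<lambda>q. 0) \<eta> p = 0" "X \<in> vector_fields \<A> U \<Longrightarrow> D X (\<lambda>q. 0) p = 0"
  using connection_scaleR1[OF D vector_fields_zero _ smooth_map_const[of _ 0] p]
    connection_scaleR2[OF D _ sections_zero smooth_map_const[of _ 0] p]
  by (simp_all add: tderiv_const)

lemma connection_sum1:
  assumes U: "open U" and D: "connection \<A> E \<T> U D" and p: "p \<in> U" and \<eta>: "\<eta> \<in> sections \<A> E \<T> U"
    and X: "\<And>i. i \<in> I \<Longrightarrow> X i \<in> vector_fields \<A> U"
  shows "D (\<lambda>q. \<Sum>i\<in>I. X i q) \<eta> p = (\<Sum>i\<in>I. D (X i) \<eta> p)"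
  using X
proof (induction I rule: infinite_finite_induct)
  case (insert i I)
  have "D (\<lambda>q. X i q + (\<Sum>i\<in>I. X i q)) \<eta> p = D (X i) \<eta> p + D (\<lambda>q. \<Sum>i\<in>I. X i q) \<eta> p"
    by (rule connection_add1[OF D _ \<eta> vector_fields_sum[OF U] p]) (use insert in auto)
  then show ?case using insert by simp
qed (use connection_zero[OF D p] \<eta> in auto)

lemma connection_sum2:
  assumes U: "open U" and D: "connection \<A> E \<T> U D" and p: "p \<in> U" and X: "X \<in> vector_fields \<A> U"
    and \<eta>: "\<And>i. i \<in> I \<Longrightarrow> \<eta> i \<in> sections \<A> E \<T> U"
  shows "D X (\<lambda>q. \<Sum>i\<in>I. \<eta> i q) p = (\<Sum>i\<in>I. D X (\<eta> i) p)"
  using \<eta>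
proof (induction I rule: infinite_finite_induct)
  case (insert i I)
  have "D X (\<lambda>q. \<eta> i q + (\<Sum>i\<in>I. \<eta> i q)) p = D X (\<eta> i) p + D X (\<lambda>q. \<Sum>i\<in>I. \<eta> i q) p"
    by (rule connection_add2[OF D X _ sections_sum[OF U] p]) (use insert in auto)
  then show ?case using insert by simp
qed (use connection_zero[OF D p] X in auto)

end

section \<open>Connections in a chart and a trivialisation\<close>

lemma bilinear_basis_sum:
  "bilinear (\<lambda>(a::'u::euclidean_space) (v::'z::euclidean_space). \<Sum>b\<in>Basis. \<Sum>k\<in>Basis. ((a \<bullet> b) * (v \<bullet> k)) *\<^sub>R G b k)"
  unfolding bilinear_def
  by (auto intro!: linearI simp: inner_add_left distrib_right distrib_left scaleR_add_left sum.distrib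
      scaleR_sum_right mult_ac)

locale bundle_chart = vbundle \<A> E \<T>
  for \<A> :: "('a::{t2_space, second_countable_topology}, 'n::finite) chart set"
    and E :: "'a \<Rightarrow> 'e::real_vector set" and \<T> :: "('a, 'e, 'm::finite) triv set" +
  fixes V :: "'a set" and c :: "'a \<Rightarrow> real ^ 'n" and W :: "'a set" and \<Phi> :: "'a \<Rightarrow> 'e \<Rightarrow> real ^ 'm"
  assumes chart: "(V, c) \<in> \<A>" and triv: "(W, \<Phi>) \<in> \<T>"
begin

abbreviation "ci \<equiv> inv_into V c"
abbreviation "vr \<equiv> vrep V c"

definition sr :: "('a \<Rightarrow> 'e) \<Rightarrow> real ^ 'n \<Rightarrow> real ^ 'm" where
  "sr \<eta> x = \<Phi> (ci x) (\<eta> (ci x))"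

lemma sr_at: "q \<in> V \<Longrightarrow> sr \<eta> (c q) = \<Phi> q (\<eta> q)"
  by (simp add: sr_def chart_inv[OF chart])

lemma sr_smooth: "\<eta> \<in> sections \<A> E \<T> U \<Longrightarrow> N \<subseteq> U \<inter> V \<inter> W \<Longrightarrow> smooth_on (c ` N) (sr \<eta>)"
  unfolding sr_def[abs_def]
  by (rule smooth_mapD'[OF sectionsD(2)[OF _ triv] chart]) auto

text \<open>
  \<open>\<Gamma>\<close> collects the Christoffel symbols over \<open>N\<close> of a connection that acts on fields over \<open>U\<close>. The
  set \<open>U\<close> may be larger than \<open>N\<close>, so that connections on different open sets can be compared over \<open>N\<close>.
\<close>

definition conn_rep :: "'a set \<Rightarrow> (('a \<Rightarrow> real ^ 'n) \<Rightarrow> ('a \<Rightarrow> 'e) \<Rightarrow> 'a \<Rightarrow> 'e) \<Rightarrow> 'a set \<Rightarrow>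
    (real ^ 'n \<Rightarrow> real ^ 'n \<Rightarrow> real ^ 'm \<Rightarrow> real ^ 'm) \<Rightarrow> bool" where
  "conn_rep U D N \<Gamma> \<longleftrightarrow> (\<forall>x\<in>c ` N. bilinear (\<Gamma> x)) \<and> (\<forall>a v. smooth_on (c ` N) (\<lambda>x. \<Gamma> x a v)) \<and>
     (\<forall>X\<in>vector_fields \<A> U. \<forall>\<eta>\<in>sections \<A> E \<T> U. \<forall>x\<in>c ` N.
        sr (D X \<eta>) x = \<partial> (vr X x) (sr \<eta>) x + \<Gamma> x (vr X x) (sr \<eta> x))"

text \<open>
  All constant coordinate fields and all constant sections over \<open>N\<close> extend to the whole manifold. This allows
  tensor identities for global fields to be tested on arbitrary values in coordinates.
\<close>

definition const_ext :: "'a set \<Rightarrow> bool" where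
  "const_ext N \<longleftrightarrow> (\<forall>w. \<exists>X\<in>vector_fields \<A> UNIV. \<forall>x\<in>c ` N. vr X x = w) \<and>
     (\<forall>v. \<exists>\<eta>\<in>sections \<A> E \<T> UNIV. \<forall>x\<in>c ` N. sr \<eta> x = v)"

lemma coord_field_vf: "open N \<Longrightarrow> N \<subseteq> V \<Longrightarrow> coord_field \<A> c w \<in> vector_fields \<A> N"
  by (rule vector_fields_coordI[where g="\<lambda>x. w", OF chart]) (auto simp: smooth_on_const)

lemma frame_section: "open N \<Longrightarrow> N \<subseteq> W \<Longrightarrow> frame E \<Phi> v \<in> sections \<A> E \<T> N"
  by (rule sections_frameI[where g="\<lambda>x. v", OF triv]) (auto simp: smooth_map_const)

text \<open>
  A connection on \<open>U\<close> only accepts fields on all of \<open>U\<close>, hence its locality has to be proved. With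
  a cut-off function \<open>\<kappa>\<close> that is 1 on \<open>N'\<close>, the coordinate fields and the frame become global after
  multiplication by \<open>\<kappa>\<close>, and so do the components of a given field. Since \<open>\<kappa>\<^sup>2\<close> times the field is
  the combination of these, the Leibniz rules determine the covariant derivative on \<open>N'\<close>, where \<open>\<kappa>\<^sup>2\<close> is
  locally constant. The set \<open>N'\<close> does not depend on the connection, so several connections are represented on a
  common set.
\<close>

lemma local_rep:
  assumes N: "open N" "p \<in> N" "N \<subseteq> V \<inter> W"
  obtains N' where "open N'" "p \<in> N'" "N' \<subseteq> N" "const_ext N'"
    "\<And>U D. open U \<Longrightarrow> N \<subseteq> U \<Longrightarrow> connection \<A> E \<T> U D \<Longrightarrow> \<exists>\<Gamma>. conn_rep U D N' \<Gamma>"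
proof -
  obtain \<kappa> :: "'a \<Rightarrow> real" and N' K where N': "open N'" "p \<in> N'" "N' \<subseteq> N" and K: "closed K" "K \<subseteq> N"
    and \<kappa>: "smooth_map \<A> UNIV \<kappa>" "\<And>q. q \<in> N' \<Longrightarrow> \<kappa> q = 1" "\<And>q. q \<notin> K \<Longrightarrow> \<kappa> q = 0"
    using cutoff[OF N(1,2)] by metis
  define dX where "dX w = ext0 N \<kappa> (coord_field \<A> c w)" for w
  define dE where "dE v = ext0 N \<kappa> (frame E \<Phi> v)" for v
  have dX: "dX w \<in> vector_fields \<A> U" if "open U" for w U
    unfolding dX_def
  proof (rule vector_fields_ext0[where K=K, OF that N(1) K \<kappa>(1)])
    show "coord_field \<A> c w \<in> vector_fields \<A> (U \<inter> N)"
      by (rule coord_field_vf) (use that N in auto)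
  qed (rule \<kappa>(3))
  have dE: "dE v \<in> sections \<A> E \<T> U" if "open U" for v U
    unfolding dE_def
  proof (rule sections_ext0[where K=K, OF that N(1) K \<kappa>(1)])
    show "frame E \<Phi> v \<in> sections \<A> E \<T> (U \<inter> N)"
      by (rule frame_section) (use that N in auto)
  qed (rule \<kappa>(3))
  have N'V: "q \<in> V" "q \<in> W" "q \<in> N" if "q \<in> N'" for q using that N' N by auto
  have dX_N': "dX w q = coord_field \<A> c w q" if "q \<in> N'" for w q
    using that N' \<kappa>(2) by (auto simp: dX_def ext0_def)
  have dE_N': "dE v q = frame E \<Phi> v q" if "q \<in> N'" for v q
    using that N' \<kappa>(2) by (auto simp: dE_def ext0_def)
  have "const_ext N'"
    unfolding const_ext_def
  proof safe
    fix w show "\<exists>X\<in>vector_fields \<A> UNIV. \<forall>x\<in>c ` N'. vr X x = w"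
      by (rule bexI[OF _ dX[of UNIV w]]) (use N'V dX_N' coord_field_tderiv(1)[OF chart] in \<open>auto simp: vrep_at[OF chart]\<close>)
  next
    fix v show "\<exists>\<eta>\<in>sections \<A> E \<T> UNIV. \<forall>x\<in>c ` N'. sr \<eta> x = v"
      by (rule bexI[OF _ dE[of UNIV v]]) (use N'V dE_N' triv_frame[OF triv] in \<open>auto simp: sr_at\<close>)
  qed
  moreover have "\<exists>\<Gamma>. conn_rep U D N' \<Gamma>" if U: "open U" "N \<subseteq> U" and D: "connection \<A> E \<T> U D" for U D
  proof
    define \<Gamma> where "\<Gamma> x a v = (\<Sum>b\<in>Basis. \<Sum>k\<in>Basis. ((a \<bullet> b) * (v \<bullet> k)) *\<^sub>R sr (D (dX b) (dE k)) x)" for x a v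
    have oN': "open (c ` N')" by (rule chart_image_open'[OF chart N'(1)]) (use N'V in auto)
    have s: "smooth_on (c ` N') (sr (D (dX b) (dE k)))" for b k
      by (rule sr_smooth[OF connection_section[OF D dX[OF U(1)] dE[OF U(1)]]]) (use N'V U in auto)
    show "conn_rep U D N' \<Gamma>"
      unfolding conn_rep_def
    proof (intro conjI ballI allI)
      show "bilinear (\<Gamma> x)" for x unfolding \<Gamma>_def[abs_def] by (rule bilinear_basis_sum)
      show "smooth_on (c ` N') (\<lambda>x. \<Gamma> x a v)" for a v
        unfolding \<Gamma>_def by (intro smooth_on_sum smooth_on_scaleR smooth_on_const s oN')
    next
      fix X \<eta> x assume X: "X \<in> vector_fields \<A> U" and \<eta>: "\<eta> \<in> sections \<A> E \<T> U" and "x \<in> c ` N'"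
      then obtain q where q: "q \<in> N'" "x = c q" by blast
      have qU: "q \<in> U" "q \<in> N" "q \<in> V" "q \<in> W" using q N'V U by auto
      have UN: "open (U \<inter> N)" using U N by auto
      define Xc where "Xc b = ext0 N \<kappa> (\<lambda>r. tderiv \<A> c r (X r) \<bullet> b)" for b
      define \<eta>c where "\<eta>c k = ext0 N \<kappa> (\<lambda>r. \<Phi> r (\<eta> r) \<bullet> k)" for k
      have Xc: "smooth_map \<A> U (Xc b)" for b
        unfolding Xc_def
      proof (rule smooth_map_ext0[where K=K, OF U(1) N(1) K \<kappa>(1)])
        show "smooth_map \<A> (U \<inter> N) (\<lambda>r. tderiv \<A> c r (X r) \<bullet> b)"
          by (rule smooth_map_inner_left[OF UN smooth_map_subset[OF vector_fieldsD[OF X chart]]]) (use N in auto)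
      qed (rule \<kappa>(3))
      have F: "smooth_map \<A> (U \<inter> N) (\<lambda>r. \<Phi> r (\<eta> r))"
        by (rule smooth_map_subset[OF sectionsD(2)[OF \<eta> triv]]) (use N in auto)
      have \<eta>c: "smooth_map \<A> U (\<eta>c k)" for k
        unfolding \<eta>c_def
      proof (rule smooth_map_ext0[where K=K, OF U(1) N(1) K \<kappa>(1)])
        show "smooth_map \<A> (U \<inter> N) (\<lambda>r. \<Phi> r (\<eta> r) \<bullet> k)" by (rule smooth_map_inner_left[OF UN F])
      qed (rule \<kappa>(3))
      have \<kappa>2: "smooth_map \<A> U (\<lambda>r. \<kappa> r *\<^sub>R \<kappa> r)"
        by (rule smooth_map_scaleR[OF U(1)]) (rule smooth_map_subset[OF \<kappa>(1)], simp)+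
      have X2: "(\<kappa> r *\<^sub>R \<kappa> r) *\<^sub>R X r = (\<Sum>b\<in>Basis. Xc b r *\<^sub>R dX b r)" if "r \<in> U" for r
      proof (cases "r \<in> N")
        case True
        then have r: "r \<in> V" using N by auto
        have "X r = (\<Sum>b\<in>Basis. (tderiv \<A> c r (X r) \<bullet> b) *\<^sub>R coord_field \<A> c b r)"
          using linear_expand[OF coord_field_tderiv(3)[OF chart r], of "tderiv \<A> c r (X r)"]
          by (simp add: coord_field_tderiv(2)[OF chart r])
        then have "(\<kappa> r *\<^sub>R \<kappa> r) *\<^sub>R X r = (\<kappa> r *\<^sub>R \<kappa> r) *\<^sub>R (\<Sum>b\<in>Basis. (tderiv \<A> c r (X r) \<bullet> b) *\<^sub>R coord_field \<A> c b r)"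
          by (rule arg_cong)
        then show ?thesis using True by (simp add: Xc_def dX_def ext0_def scaleR_sum_right mult_ac)
      next
        case False
        then show ?thesis using K \<kappa>(3)[of r] by (auto simp: Xc_def ext0_def)
      qed
      have \<eta>2: "(\<kappa> r *\<^sub>R \<kappa> r) *\<^sub>R \<eta> r = (\<Sum>k\<in>Basis. \<eta>c k r *\<^sub>R dE k r)" if r: "r \<in> U" for r
      proof (cases "r \<in> N")
        case True
        then have rW: "r \<in> W" using N by auto
        have "\<eta> r = (\<Sum>k\<in>Basis. (\<Phi> r (\<eta> r) \<bullet> k) *\<^sub>R frame E \<Phi> k r)"
          using linear_expand[OF frame_linear[OF triv rW], of "\<Phi> r (\<eta> r)"]
          by (simp add: frame_triv[OF triv rW sectionsD(1)[OF \<eta> r]])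
        then have "(\<kappa> r *\<^sub>R \<kappa> r) *\<^sub>R \<eta> r = (\<kappa> r *\<^sub>R \<kappa> r) *\<^sub>R (\<Sum>k\<in>Basis. (\<Phi> r (\<eta> r) \<bullet> k) *\<^sub>R frame E \<Phi> k r)"
          by (rule arg_cong)
        then show ?thesis using True by (simp add: \<eta>c_def dE_def ext0_def scaleR_sum_right mult_ac)
      next
        case False
        then show ?thesis using K \<kappa>(3)[of r] by (auto simp: \<eta>c_def ext0_def)
      qed
      have Xce: "(\<lambda>r. Xc b r *\<^sub>R dX b r) \<in> vector_fields \<A> U" for b
        by (rule vector_fields_scaleR[OF U(1) Xc dX[OF U(1)]])
      have \<eta>ce: "(\<lambda>r. \<eta>c k r *\<^sub>R dE k r) \<in> sections \<A> E \<T> U" for k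
        by (rule sections_scaleR[OF U(1) \<eta>c dE[OF U(1)]])
      have "D X \<eta> q = D (\<lambda>r. (\<kappa> r *\<^sub>R \<kappa> r) *\<^sub>R X r) \<eta> q"
        using connection_scaleR1[OF D X \<eta> \<kappa>2 qU(1)] \<kappa>(2)[OF q(1)] by simp
      also have "\<dots> = D (\<lambda>r. \<Sum>b\<in>Basis. Xc b r *\<^sub>R dX b r) \<eta> q"
        by (rule connection_cong[OF D vector_fields_scaleR[OF U(1) \<kappa>2 X] \<eta> vector_fields_sum[OF U(1) Xce] \<eta> X2 refl qU(1)])
      also have "\<dots> = (\<Sum>b\<in>Basis. D (\<lambda>r. Xc b r *\<^sub>R dX b r) \<eta> q)"
        by (rule connection_sum1[OF U(1) D qU(1) \<eta> Xce])
      also have "\<dots> = (\<Sum>b\<in>Basis. (vr X x \<bullet> b) *\<^sub>R D (dX b) \<eta> q)"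
        by (rule sum.cong[OF refl])
           (use connection_scaleR1[OF D dX[OF U(1)] \<eta> Xc qU(1)] qU(2) \<kappa>(2)[OF q(1)] in
             \<open>simp add: Xc_def ext0_def q(2) vrep_at[OF chart qU(3)]\<close>)
      finally have D1: "D X \<eta> q = (\<Sum>b\<in>Basis. (vr X x \<bullet> b) *\<^sub>R D (dX b) \<eta> q)" .
      \<comment> \<open>The derivative of \<open>\<kappa>\<^sup>2\<close> vanishes at \<open>q\<close>, so replacing \<open>\<eta>\<close> by \<open>\<kappa>\<^sup>2 \<eta>\<close> is harmless.\<close>
      have D2: "\<Phi> q (D (dX b) \<eta> q) = (\<Sum>k\<in>Basis. (sr \<eta> x \<bullet> k) *\<^sub>R sr (D (dX b) (dE k)) x)
            + tderiv \<A> (\<lambda>r. \<Phi> r (\<eta> r)) q (dX b q)" for b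
      proof -
        have "tderiv \<A> (\<lambda>r. \<kappa> r *\<^sub>R \<kappa> r) q w = tderiv \<A> (\<lambda>r. 1) q w" for w
          by (rule tderiv_cong[OF N'(1) q(1)]) (simp add: \<kappa>(2))
        then have "tderiv \<A> (\<lambda>r. \<kappa> r *\<^sub>R \<kappa> r) q w = 0" for w by (simp add: tderiv_const)
        then have "D (dX b) \<eta> q = D (dX b) (\<lambda>r. (\<kappa> r *\<^sub>R \<kappa> r) *\<^sub>R \<eta> r) q"
          using connection_scaleR2[OF D dX[OF U(1)] \<eta> \<kappa>2 qU(1)] \<kappa>(2)[OF q(1)] by simp
        also have "\<dots> = D (dX b) (\<lambda>r. \<Sum>k\<in>Basis. \<eta>c k r *\<^sub>R dE k r) q"
          by (rule connection_cong[OF D dX[OF U(1)] sections_scaleR[OF U(1) \<kappa>2 \<eta>] dX[OF U(1)] sections_sum[OF U(1) \<eta>ce] refl \<eta>2 qU(1)])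
        also have "\<dots> = (\<Sum>k\<in>Basis. D (dX b) (\<lambda>r. \<eta>c k r *\<^sub>R dE k r) q)"
          by (rule connection_sum2[OF U(1) D qU(1) dX[OF U(1)] \<eta>ce])
        also have "\<dots> = (\<Sum>k\<in>Basis. \<eta>c k q *\<^sub>R D (dX b) (dE k) q + tderiv \<A> (\<eta>c k) q (dX b q) *\<^sub>R dE k q)"
          by (rule sum.cong[OF refl]) (rule connection_scaleR2[OF D dX[OF U(1)] dE[OF U(1)] \<eta>c qU(1)])
        finally have e: "D (dX b) \<eta> q = (\<Sum>k\<in>Basis. \<eta>c k q *\<^sub>R D (dX b) (dE k) q + tderiv \<A> (\<eta>c k) q (dX b q) *\<^sub>R dE k q)" .
        have inE: "D (dX b) (dE k) q \<in> E q" "dE k q \<in> E q" for k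
          using sectionsD(1)[OF connection_section[OF D dX[OF U(1)] dE[OF U(1)]] qU(1)] sectionsD(1)[OF dE[OF U(1)] qU(1)] by auto
        note Esub = subspace_add[OF fibre_subspace] subspace_scale[OF fibre_subspace] inE
        have td: "tderiv \<A> (\<eta>c k) q w = tderiv \<A> (\<lambda>r. \<Phi> r (\<eta> r)) q w \<bullet> k" for k w
        proof -
          have "tderiv \<A> (\<eta>c k) q w = tderiv \<A> (\<lambda>r. \<Phi> r (\<eta> r) \<bullet> k) q w"
            by (rule tderiv_cong[OF N'(1) q(1)]) (use N' \<kappa>(2) in \<open>auto simp: \<eta>c_def ext0_def\<close>)
          also have "\<dots> = tderiv \<A> (\<lambda>r. \<Phi> r (\<eta> r)) q w \<bullet> k"
          proof -
            obtain V0 c0 where ca: "chart_at \<A> q = (V0, c0)" by (cases "chart_at \<A> q")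
            note c0 = chart_at_mem[OF ca]
            show ?thesis unfolding tderiv_eq[OF ca]
              by (rule dir_deriv_linear[OF bounded_linear_inner_left smooth_map_differentiable[OF F UN _ c0]]) (use qU in auto)
          qed
          finally show ?thesis .
        qed
        have "\<Phi> q (D (dX b) \<eta> q) = (\<Sum>k\<in>Basis. \<eta>c k q *\<^sub>R \<Phi> q (D (dX b) (dE k) q) + tderiv \<A> (\<eta>c k) q (dX b q) *\<^sub>R k)"
          unfolding e
          by (subst triv_sum[OF triv qU(4)])
             (simp_all add: Esub triv_add[OF triv qU(4)] triv_scale[OF triv qU(4)] dE_N'[OF q(1)] frame_in[OF triv qU(4)] triv_frame[OF triv qU(4)])
        also have "\<dots> = (\<Sum>k\<in>Basis. (sr \<eta> x \<bullet> k) *\<^sub>R sr (D (dX b) (dE k)) x)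
            + (\<Sum>k\<in>Basis. (tderiv \<A> (\<lambda>r. \<Phi> r (\<eta> r)) q (dX b q) \<bullet> k) *\<^sub>R k)"
        proof -
          have "\<eta>c k q = sr \<eta> x \<bullet> k" for k
            using qU(2) \<kappa>(2)[OF q(1)] by (simp add: q(2) sr_at[OF qU(3)] \<eta>c_def ext0_def)
          moreover have "\<Phi> q (D (dX b) (dE k) q) = sr (D (dX b) (dE k)) x" for k
            by (simp add: q(2) sr_at[OF qU(3)])
          ultimately show ?thesis by (simp add: sum.distrib td)
        qed
        finally show ?thesis by (simp add: euclidean_representation)
      qed
      have inE: "D (dX b) \<eta> q \<in> E q" for b
        by (rule sectionsD(1)[OF connection_section[OF D dX[OF U(1)] \<eta>] qU(1)])
      have "sr (D X \<eta>) x = \<Phi> q (\<Sum>b\<in>Basis. (vr X x \<bullet> b) *\<^sub>R D (dX b) \<eta> q)"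
        by (simp add: q(2) sr_at[OF qU(3)] D1[unfolded q(2)])
      also have "\<dots> = (\<Sum>b\<in>Basis. (vr X x \<bullet> b) *\<^sub>R \<Phi> q (D (dX b) \<eta> q))"
        by (subst triv_sum[OF triv qU(4)]) (simp_all add: inE subspace_scale[OF fibre_subspace] triv_scale[OF triv qU(4)])
      also have "\<dots> = (\<Sum>b\<in>Basis. (vr X x \<bullet> b) *\<^sub>R tderiv \<A> (\<lambda>r. \<Phi> r (\<eta> r)) q (dX b q)) + \<Gamma> x (vr X x) (sr \<eta> x)"
        unfolding D2 \<Gamma>_def by (simp add: scaleR_add_right sum.distrib scaleR_sum_right)
      also have "(\<Sum>b\<in>Basis. (vr X x \<bullet> b) *\<^sub>R tderiv \<A> (\<lambda>r. \<Phi> r (\<eta> r)) q (dX b q)) = tderiv \<A> (\<lambda>r. \<Phi> r (\<eta> r)) q (X q)"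
      proof -
        have l: "linear (\<lambda>w. tderiv \<A> (\<lambda>r. \<Phi> r (\<eta> r)) q (coord_field \<A> c w q))"
          using linear_compose[OF coord_field_tderiv(3)[OF chart qU(3)] tderiv_linear[OF F UN]] qU by (simp add: o_def)
        have "tderiv \<A> (\<lambda>r. \<Phi> r (\<eta> r)) q (X q) = tderiv \<A> (\<lambda>r. \<Phi> r (\<eta> r)) q (coord_field \<A> c (vr X x) q)"
          by (simp add: q(2) vrep_at[OF chart qU(3)] coord_field_tderiv(2)[OF chart qU(3)])
        also have "\<dots> = (\<Sum>b\<in>Basis. (vr X x \<bullet> b) *\<^sub>R tderiv \<A> (\<lambda>r. \<Phi> r (\<eta> r)) q (dX b q))"
          using linear_expand[OF l, of "vr X x"] by (simp add: dX_N'[OF q(1)])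
        finally show ?thesis by simp
      qed
      also have "tderiv \<A> (\<lambda>r. \<Phi> r (\<eta> r)) q (X q) = \<partial> (vr X x) (sr \<eta>) x"
      proof -
        have "x \<in> c ` (U \<inter> N)" using q qU by blast
        moreover have "U \<inter> N \<subseteq> V" using N by auto
        ultimately have "tderiv \<A> (\<lambda>r. \<Phi> r (\<eta> r)) (ci x) (X (ci x)) = \<partial> (vr X x) (\<lambda>y. \<Phi> (ci y) (\<eta> (ci y))) x"
          by (rule tderiv_vrep[OF chart _ UN _ F])
        then show ?thesis using chart_inv(1)[OF chart qU(3)] by (simp add: q(2) sr_def[abs_def])
      qed
      finally show "sr (D X \<eta>) x = \<partial> (vr X x) (sr \<eta>) x + \<Gamma> x (vr X x) (sr \<eta> x)" .
    qed
  qed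
  ultimately show thesis using that[of N'] N' by blast
qed

end

section \<open>Curvature and torsion in coordinates\<close>

text \<open>
  On constant coordinate fields all brackets vanish, which explains the shape of the three tensors below. The second
  one is the exterior covariant derivative of \<open>P\<close>, regarded as a one-form with values in the dual bundle.
\<close>

definition cov :: "('v::euclidean_space \<Rightarrow> 'v \<Rightarrow> 'u::euclidean_space \<Rightarrow> 'u) \<Rightarrow> ('v \<Rightarrow> 'v) \<Rightarrow> ('v \<Rightarrow> 'u) \<Rightarrow> 'v \<Rightarrow> 'u" where
  "cov \<Gamma> X e x = \<partial> (X x) e x + \<Gamma> x (X x) (e x)"

definition curv :: "('v::euclidean_space \<Rightarrow> 'v \<Rightarrow> 'u::euclidean_space \<Rightarrow> 'u) \<Rightarrow> 'v \<Rightarrow> 'v \<Rightarrow> 'v \<Rightarrow> 'u \<Rightarrow> 'u" where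
  "curv \<Gamma> x a b v = \<partial> a (\<lambda>y. \<Gamma> y b v) x - \<partial> b (\<lambda>y. \<Gamma> y a v) x + \<Gamma> x a (\<Gamma> x b v) - \<Gamma> x b (\<Gamma> x a v)"

definition codazzi :: "('v::euclidean_space \<Rightarrow> 'v \<Rightarrow> 'u::euclidean_space \<Rightarrow> 'u) \<Rightarrow> ('v \<Rightarrow> 'v \<Rightarrow> 'u \<Rightarrow> real) \<Rightarrow>
    'v \<Rightarrow> 'v \<Rightarrow> 'v \<Rightarrow> 'u \<Rightarrow> real" where
  "codazzi \<Gamma> P x a b v = \<partial> a (\<lambda>y. P y b v) x - \<partial> b (\<lambda>y. P y a v) x - P x b (\<Gamma> x a v) + P x a (\<Gamma> x b v)"

definition tors :: "('v::euclidean_space \<Rightarrow> 'v \<Rightarrow> 'u::euclidean_space \<Rightarrow> 'u) \<Rightarrow> ('v \<Rightarrow> 'v \<Rightarrow> 'u) \<Rightarrow> 'v \<Rightarrow> 'v \<Rightarrow> 'v \<Rightarrow> 'u" where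
  "tors \<Gamma> f x a b = \<partial> a (\<lambda>y. f y b) x - \<partial> b (\<lambda>y. f y a) x + \<Gamma> x a (f x b) - \<Gamma> x b (f x a)"

locale coords =
  fixes S :: "'v::euclidean_space set" and \<Gamma> :: "'v \<Rightarrow> 'v \<Rightarrow> 'u::euclidean_space \<Rightarrow> 'u"
  assumes S: "open S" and bil: "\<And>x. x \<in> S \<Longrightarrow> bilinear (\<Gamma> x)" and sm: "\<And>a v. smooth_on S (\<lambda>x. \<Gamma> x a v)"
begin

lemma cov_smooth:
  assumes "smooth_on S X" "smooth_on S e"
  shows "smooth_on S (cov \<Gamma> X e)"
  unfolding cov_def[abs_def]
proof (rule smooth_on_add[OF S])
  show "smooth_on S (\<lambda>x. \<partial> (X x) e x)"
    by (rule smooth_on_linear_family[where L="\<lambda>x v. \<partial> v e x", OF S _ _ assms(1)])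
       (auto intro!: linear_dir_deriv smooth_onD(1)[OF assms(2)] smooth_onD(2)[OF assms(2)])
  show "smooth_on S (\<lambda>x. \<Gamma> x (X x) (e x))"
    by (rule smooth_on_bilinear_family[OF S bil sm assms])
qed

lemma \<Gamma>_ldiff: "x \<in> S \<Longrightarrow> \<Gamma> x (a - b) v = \<Gamma> x a v - \<Gamma> x b v" using bil bilinear_lsub by blast
lemma \<Gamma>_radd: "x \<in> S \<Longrightarrow> \<Gamma> x a (v + w) = \<Gamma> x a v + \<Gamma> x a w" using bil bilinear_radd by blast

lemma cov_cov:
  assumes X: "smooth_on S X" and Y: "smooth_on S Y" and e: "smooth_on S e" and x: "x \<in> S"
  shows "cov \<Gamma> X (cov \<Gamma> Y e) x = \<partial> (X x) (\<lambda>y. \<partial> (Y x) e y) x + \<partial> (\<partial> (X x) Y x) e x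
     + \<partial> (X x) (\<lambda>y. \<Gamma> y (Y x) (e x)) x + \<Gamma> x (\<partial> (X x) Y x) (e x)
     + \<Gamma> x (Y x) (\<partial> (X x) e x) + \<Gamma> x (X x) (\<partial> (Y x) e x) + \<Gamma> x (X x) (\<Gamma> x (Y x) (e x))"
proof -
  have s1: "smooth_on S (\<lambda>x. \<partial> (Y x) e x)"
    by (rule smooth_on_linear_family[where L="\<lambda>x v. \<partial> v e x", OF S _ _ Y])
       (auto intro!: linear_dir_deriv smooth_onD(1)[OF e] smooth_onD(2)[OF e])
  have s2: "smooth_on S (\<lambda>x. \<Gamma> x (Y x) (e x))"
    by (rule smooth_on_bilinear_family[OF S bil sm Y e])
  have "\<partial> (X x) (cov \<Gamma> Y e) x = \<partial> (X x) (\<lambda>y. \<partial> (Y y) e y) x + \<partial> (X x) (\<lambda>y. \<Gamma> y (Y y) (e y)) x"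
    unfolding cov_def[abs_def] by (rule dir_deriv_add[OF smooth_onD(1)[OF s1 x] smooth_onD(1)[OF s2 x]])
  moreover have "\<partial> (X x) (\<lambda>y. \<partial> (Y y) e y) x = \<partial> (X x) (\<lambda>y. \<partial> (Y x) e y) x + \<partial> (\<partial> (X x) Y x) e x"
    by (rule dir_deriv_linear_family[where L="\<lambda>x v. \<partial> v e x", OF S x _ _ Y])
       (auto intro!: linear_dir_deriv smooth_onD(1)[OF e] smooth_onD(2)[OF e])
  moreover have "\<partial> (X x) (\<lambda>y. \<Gamma> y (Y y) (e y)) x = \<partial> (X x) (\<lambda>y. \<Gamma> y (Y x) (e x)) x
      + \<Gamma> x (\<partial> (X x) Y x) (e x) + \<Gamma> x (Y x) (\<partial> (X x) e x)"
    by (rule dir_deriv_bilinear_family[OF S x bil sm Y e])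
  ultimately show ?thesis
    unfolding cov_def[of \<Gamma> X] by (simp add: cov_def \<Gamma>_radd[OF x] add_ac)
qed

text \<open>
  Tensoriality of the curvature. In coordinates the Lie bracket is \<open>Z\<close>, which absorbs all terms that contain
  derivatives of \<open>X\<close> and \<open>Y\<close>; those with derivatives of \<open>e\<close> cancel by symmetry.
\<close>

lemma cov_curv:
  assumes X: "smooth_on S X" and Y: "smooth_on S Y" and e: "smooth_on S e" and x: "x \<in> S"
    and Z: "Z x = \<partial> (X x) Y x - \<partial> (Y x) X x"
  shows "cov \<Gamma> X (cov \<Gamma> Y e) x - cov \<Gamma> Y (cov \<Gamma> X e) x - cov \<Gamma> Z e x = curv \<Gamma> x (X x) (Y x) (e x)"
proof -
  have "\<partial> (Z x) e x = \<partial> (\<partial> (X x) Y x) e x - \<partial> (\<partial> (Y x) X x) e x"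
    unfolding Z by (rule linear_diff[OF linear_dir_deriv[OF smooth_onD(1)[OF e x]]])
  moreover have "\<Gamma> x (Z x) (e x) = \<Gamma> x (\<partial> (X x) Y x) (e x) - \<Gamma> x (\<partial> (Y x) X x) (e x)"
    unfolding Z by (rule \<Gamma>_ldiff[OF x])
  ultimately show ?thesis
    unfolding cov_cov[OF X Y e x] cov_cov[OF Y X e x] curv_def
    by (simp add: cov_def dir_deriv_commute[OF S e x, of "Y x" "X x"])
qed

lemma cov_codazzi:
  assumes P: "\<And>x. x \<in> S \<Longrightarrow> bilinear (P x)" "\<And>a v. smooth_on S (\<lambda>x. P x a v)"
    and X: "smooth_on S X" and Y: "smooth_on S Y" and e: "smooth_on S e" and x: "x \<in> S"
    and Z: "Z x = \<partial> (X x) Y x - \<partial> (Y x) X x"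
  shows "\<partial> (X x) (\<lambda>y. P y (Y y) (e y)) x - \<partial> (Y x) (\<lambda>y. P y (X y) (e y)) x - P x (Z x) (e x)
     - (P x (Y x) (cov \<Gamma> X e x) - P x (X x) (cov \<Gamma> Y e x)) = codazzi \<Gamma> P x (X x) (Y x) (e x)"
  by (simp add: dir_deriv_bilinear_family[where F=P, OF S x P Y e] dir_deriv_bilinear_family[where F=P, OF S x P X e]
      Z cov_def codazzi_def bilinear_lsub[OF P(1)[OF x]] bilinear_radd[OF P(1)[OF x]])

lemma cov_tors:
  assumes f: "\<And>x. x \<in> S \<Longrightarrow> linear (f x)" "\<And>v. smooth_on S (\<lambda>x. f x v)"
    and X: "smooth_on S X" and Y: "smooth_on S Y" and x: "x \<in> S"
    and Z: "Z x = \<partial> (X x) Y x - \<partial> (Y x) X x"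
  shows "cov \<Gamma> X (\<lambda>y. f y (Y y)) x - cov \<Gamma> Y (\<lambda>y. f y (X y)) x - f x (Z x) = tors \<Gamma> f x (X x) (Y x)"
  by (simp add: cov_def dir_deriv_linear_family[where L=f, OF S x f Y] dir_deriv_linear_family[where L=f, OF S x f X]
      Z tors_def linear_diff[OF f(1)[OF x]])

end

context bundle_chart
begin

lemma conn_repD:
  assumes "conn_rep U D N \<Gamma>"
  shows "x \<in> c ` N \<Longrightarrow> bilinear (\<Gamma> x)" "smooth_on (c ` N) (\<lambda>x. \<Gamma> x a v)"
    "X \<in> vector_fields \<A> U \<Longrightarrow> \<eta> \<in> sections \<A> E \<T> U \<Longrightarrow> x \<in> c ` N \<Longrightarrow> sr (D X \<eta>) x = cov \<Gamma> (vr X) (sr \<eta>) x"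
  using assms unfolding conn_rep_def cov_def by blast+

lemma conn_rep_coords:
  assumes "conn_rep U D N \<Gamma>" "open N" "N \<subseteq> V"
  shows "coords (c ` N) \<Gamma>"
  by (unfold_locales) (use conn_repD[OF assms(1)] chart_image_open'[OF chart assms(2,3)] in auto)

lemma conn_rep_mono: "conn_rep U D N \<Gamma> \<Longrightarrow> N' \<subseteq> N \<Longrightarrow> conn_rep U D N' \<Gamma>"
  unfolding conn_rep_def by (meson image_mono smooth_on_subset subset_iff)

lemma cov_cong:
  assumes "open S" "x \<in> S" "\<And>y. y \<in> S \<Longrightarrow> e y = f y"
  shows "cov \<Gamma> X e x = cov \<Gamma> X f x"
  unfolding cov_def using dir_deriv_cong_open[where f=e and g=f, OF assms] assms(3)[OF assms(2)] by simp

lemma curvature_rep: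
  assumes U: "open U" and N: "open N" "N \<subseteq> U \<inter> V \<inter> W" and D: "connection \<A> E \<T> U D"
    and \<Gamma>: "conn_rep U D N \<Gamma>" and X: "X \<in> vector_fields \<A> U" and Y: "Y \<in> vector_fields \<A> U"
    and \<eta>: "\<eta> \<in> sections \<A> E \<T> U" and x: "x \<in> c ` N"
  shows "sr (curvature \<A> D X Y \<eta>) x = curv \<Gamma> x (vr X x) (vr Y x) (sr \<eta> x)"
proof -
  have NV: "N \<subseteq> V" using N by auto
  have XYN: "X \<in> vector_fields \<A> N" "Y \<in> vector_fields \<A> N"
    by (rule vector_fields_subset[OF X] vector_fields_subset[OF Y], use N in auto)+
  interpret coords "c ` N" \<Gamma> by (rule conn_rep_coords[OF \<Gamma> N(1) NV])
  obtain q where q: "q \<in> N" "q \<in> U" "q \<in> V" "q \<in> W" "x = c q" using x N by blast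
  have sec: "D X \<eta> \<in> sections \<A> E \<T> U" if "X \<in> vector_fields \<A> U" "\<eta> \<in> sections \<A> E \<T> U" for X \<eta>
    by (rule connection_section[OF D that])
  have L: "lie_bracket \<A> X Y \<in> vector_fields \<A> U" by (rule lie_bracket_vector_field[OF U X Y])
  have vs: "smooth_on (c ` N) (vr X)" if "X \<in> vector_fields \<A> U" for X
    by (rule vrep_smooth[OF chart that]) (use N in auto)
  have es: "smooth_on (c ` N) (sr \<eta>)" by (rule sr_smooth[OF \<eta> N(2)])
  have 2: "sr (D X (D Y \<eta>)) x = cov \<Gamma> (vr X) (cov \<Gamma> (vr Y) (sr \<eta>)) x"
    if "X \<in> vector_fields \<A> U" "Y \<in> vector_fields \<A> U" for X Y
    using conn_repD(3)[OF \<Gamma> that(1) sec[OF that(2) \<eta>] x] cov_cong[where e="sr (D Y \<eta>)" and f="cov \<Gamma> (vr Y) (sr \<eta>)", OF S x conn_repD(3)[OF \<Gamma> that(2) \<eta>]]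
    by simp
  have "sr (curvature \<A> D X Y \<eta>) x = sr (D X (D Y \<eta>)) x - sr (D Y (D X \<eta>)) x - sr (D (lie_bracket \<A> X Y) \<eta>) x"
    using q sectionsD(1)[OF sec[OF X sec[OF Y \<eta>]] q(2)] sectionsD(1)[OF sec[OF Y sec[OF X \<eta>]] q(2)] sectionsD(1)[OF sec[OF L \<eta>] q(2)]
    by (simp add: sr_at curvature_def triv_diff[OF triv q(4)] subspace_diff[OF fibre_subspace])
  also have "\<dots> = curv \<Gamma> x (vr X x) (vr Y x) (sr \<eta> x)"
    unfolding 2[OF X Y] 2[OF Y X] conn_repD(3)[OF \<Gamma> L \<eta> x]
    by (rule cov_curv[OF vs[OF X] vs[OF Y] es x])
       (rule vrep_lie_bracket[OF chart N(1) NV x XYN])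
  finally show ?thesis .
qed

subsection \<open>The connection with given coefficients\<close>

definition conn_of :: "(real ^ 'n \<Rightarrow> real ^ 'n \<Rightarrow> real ^ 'm \<Rightarrow> real ^ 'm) \<Rightarrow>
    ('a \<Rightarrow> real ^ 'n) \<Rightarrow> ('a \<Rightarrow> 'e) \<Rightarrow> 'a \<Rightarrow> 'e" where
  "conn_of \<Gamma> X \<eta> q = frame E \<Phi> (cov \<Gamma> (vr X) (sr \<eta>) (c q)) q"

lemma conn_of_connection:
  assumes N: "open N" "N \<subseteq> V \<inter> W" and \<Gamma>: "\<And>x. x \<in> c ` N \<Longrightarrow> bilinear (\<Gamma> x)" "\<And>a v. smooth_on (c ` N) (\<lambda>x. \<Gamma> x a v)"
  shows "connection \<A> E \<T> N (conn_of \<Gamma>)" "conn_rep N (conn_of \<Gamma>) N \<Gamma>"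
proof -
  have NV: "N \<subseteq> V" "N \<subseteq> W" "\<And>q. q \<in> N \<Longrightarrow> q \<in> V" "\<And>q. q \<in> N \<Longrightarrow> q \<in> W" using N by auto
  have oS: "open (c ` N)" by (rule chart_image_open'[OF chart N(1) NV(1)])
  interpret coords "c ` N" \<Gamma> by unfold_locales (use \<Gamma> oS in auto)
  have vs: "smooth_on (c ` N) (vr X)" if "X \<in> vector_fields \<A> N" for X
    by (rule vrep_smooth[OF chart that]) (use N in auto)
  have es: "smooth_on (c ` N) (sr \<eta>)" if "\<eta> \<in> sections \<A> E \<T> N" for \<eta>
    by (rule sr_smooth[OF that]) (use N in auto)
  have ci: "ci (c q) = q" if "q \<in> N" for q by (rule chart_inv(1)[OF chart NV(3)[OF that]])
  have sr_c: "sr \<eta> (c q) = \<Phi> q (\<eta> q)" "vr X (c q) = tderiv \<A> c q (X q)" if "q \<in> N" for q \<eta> X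
    using sr_at[OF NV(3)[OF that]] vrep_at[OF chart NV(3)[OF that]] by auto
  note flin = linear_add[OF frame_linear[OF triv NV(4)]] linear_scale[OF frame_linear[OF triv NV(4)]]
  have dd: "sr \<eta> differentiable (at (c q))" if "\<eta> \<in> sections \<A> E \<T> N" "q \<in> N" for \<eta> q
    using smooth_onD(1)[OF es[OF that(1)]] that(2) by blast
  have c1: "conn_of \<Gamma> X \<eta> \<in> sections \<A> E \<T> N" if "X \<in> vector_fields \<A> N" "\<eta> \<in> sections \<A> E \<T> N" for X \<eta>
  proof (rule sections_frameI[OF triv N(1) NV(2)])
    show "smooth_map \<A> N (\<lambda>q. cov \<Gamma> (vr X) (sr \<eta>) (c q))"
    proof (rule smooth_map_chartI[OF chart N(1) NV(1)])
      show "smooth_on (c ` N) (\<lambda>x. cov \<Gamma> (vr X) (sr \<eta>) (c (ci x)))"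
        by (rule smooth_on_cong[OF oS _ cov_smooth[OF vs[OF that(1)] es[OF that(2)]]]) (auto simp: ci)
    qed
  qed (simp add: conn_of_def)
  have c2: "conn_of \<Gamma> X \<eta> p = conn_of \<Gamma> Y \<zeta> p" if "p \<in> N" "\<forall>p\<in>N. X p = Y p \<and> \<eta> p = \<zeta> p" for X Y \<eta> \<zeta> p
  proof -
    have "cov \<Gamma> (vr X) (sr \<eta>) (c p) = cov \<Gamma> (vr X) (sr \<zeta>) (c p)"
      by (rule cov_cong[OF oS]) (use that sr_c in auto)
    moreover have "vr X (c p) = vr Y (c p)" using that sr_c by simp
    ultimately show ?thesis by (simp add: conn_of_def cov_def)
  qed
  have c3: "conn_of \<Gamma> (\<lambda>q. X q + Y q) \<eta> p = conn_of \<Gamma> X \<eta> p + conn_of \<Gamma> Y \<eta> p"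
    if "\<eta> \<in> sections \<A> E \<T> N" "p \<in> N" for X Y \<eta> p
  proof -
    have "vr (\<lambda>q. X q + Y q) (c p) = vr X (c p) + vr Y (c p)"
      using that by (simp add: sr_c linear_add[OF tderiv_chart_bij(1)[OF chart NV(3)]])
    then have "cov \<Gamma> (vr (\<lambda>q. X q + Y q)) (sr \<eta>) (c p) = cov \<Gamma> (vr X) (sr \<eta>) (c p) + cov \<Gamma> (vr Y) (sr \<eta>) (c p)"
      using that by (simp add: cov_def linear_add[OF linear_dir_deriv[OF dd]] bilinear_ladd[OF \<Gamma>(1)])
    then show ?thesis using that by (simp add: conn_of_def flin)
  qed
  have c4: "conn_of \<Gamma> (\<lambda>q. f q *\<^sub>R X q) \<eta> p = f p *\<^sub>R conn_of \<Gamma> X \<eta> p"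
    if "\<eta> \<in> sections \<A> E \<T> N" "p \<in> N" for f X \<eta> p
  proof -
    have "vr (\<lambda>q. f q *\<^sub>R X q) (c p) = f p *\<^sub>R vr X (c p)"
      using that by (simp add: sr_c linear_scale[OF tderiv_chart_bij(1)[OF chart NV(3)]])
    then have "cov \<Gamma> (vr (\<lambda>q. f q *\<^sub>R X q)) (sr \<eta>) (c p) = f p *\<^sub>R cov \<Gamma> (vr X) (sr \<eta>) (c p)"
      using that by (simp add: cov_def linear_scale[OF linear_dir_deriv[OF dd]] bilinear_lmul[OF \<Gamma>(1)] scaleR_add_right)
    then show ?thesis using that by (simp add: conn_of_def flin)
  qed
  have c5: "conn_of \<Gamma> X (\<lambda>q. \<eta> q + \<zeta> q) p = conn_of \<Gamma> X \<eta> p + conn_of \<Gamma> X \<zeta> p"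
    if "\<eta> \<in> sections \<A> E \<T> N" "\<zeta> \<in> sections \<A> E \<T> N" "p \<in> N" for X \<eta> \<zeta> p
  proof -
    have s: "sr (\<lambda>q. \<eta> q + \<zeta> q) y = sr \<eta> y + sr \<zeta> y" if "y \<in> c ` N" for y
      using that NV \<open>\<eta> \<in> _\<close> \<open>\<zeta> \<in> _\<close> sectionsD(1) by (auto simp: sr_c triv_add[OF triv])
    have "cov \<Gamma> (vr X) (sr (\<lambda>q. \<eta> q + \<zeta> q)) (c p) = cov \<Gamma> (vr X) (\<lambda>y. sr \<eta> y + sr \<zeta> y) (c p)"
      by (rule cov_cong[OF oS _ s]) (use that in auto)
    also have "\<dots> = cov \<Gamma> (vr X) (sr \<eta>) (c p) + cov \<Gamma> (vr X) (sr \<zeta>) (c p)"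
      using that by (simp add: cov_def dir_deriv_add[OF dd dd] bilinear_radd[OF \<Gamma>(1)])
    finally show ?thesis using that by (simp add: conn_of_def flin)
  qed
  have c6: "conn_of \<Gamma> X (\<lambda>q. f q *\<^sub>R \<eta> q) p = f p *\<^sub>R conn_of \<Gamma> X \<eta> p + tderiv \<A> f p (X p) *\<^sub>R \<eta> p"
    if f: "smooth_map \<A> N f" and \<eta>: "\<eta> \<in> sections \<A> E \<T> N" and p: "p \<in> N" for f X \<eta> p
  proof -
    have x: "c p \<in> c ` N" using p by blast
    have sf: "smooth_on (c ` N) (\<lambda>y. f (ci y))" by (rule smooth_mapD'[OF f chart]) (use NV in auto)
    have s: "sr (\<lambda>q. f q *\<^sub>R \<eta> q) y = f (ci y) *\<^sub>R sr \<eta> y" if "y \<in> c ` N" for y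
      using that NV sectionsD(1)[OF \<eta>] by (auto simp: sr_c ci triv_scale[OF triv])
    have "cov \<Gamma> (vr X) (sr (\<lambda>q. f q *\<^sub>R \<eta> q)) (c p) = cov \<Gamma> (vr X) (\<lambda>y. f (ci y) *\<^sub>R sr \<eta> y) (c p)"
      by (rule cov_cong[OF oS x s])
    also have "\<dots> = f p *\<^sub>R cov \<Gamma> (vr X) (sr \<eta>) (c p) + \<partial> (vr X (c p)) (\<lambda>y. f (ci y)) (c p) *\<^sub>R sr \<eta> (c p)"
      using dir_deriv_bilinear[OF bounded_bilinear_scaleR smooth_onD(1)[OF sf x] dd[OF \<eta> p], of "vr X (c p)"] x
      by (simp add: cov_def ci[OF p] bilinear_rmul[OF \<Gamma>(1)] scaleR_add_right)
    also have "\<partial> (vr X (c p)) (\<lambda>y. f (ci y)) (c p) = tderiv \<A> f p (X p)"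
      using tderiv_vrep[OF chart x N(1) NV(1) f, of X] by (simp add: ci[OF p])
    finally show ?thesis
      using p sectionsD(1)[OF \<eta> p] by (simp add: conn_of_def flin sr_c frame_triv[OF triv NV(4)])
  qed
  show con: "connection \<A> E \<T> N (conn_of \<Gamma>)"
    unfolding connection_def
    by (intro conjI ballI allI impI) (assumption | rule c1 c2 c3 c4 c5 c6)+
  have "sr (conn_of \<Gamma> X \<eta>) x = cov \<Gamma> (vr X) (sr \<eta>) x" if "x \<in> c ` N" for X \<eta> x
    using that NV by (auto simp: sr_c conn_of_def triv_frame[OF triv])
  then show "conn_rep N (conn_of \<Gamma>) N \<Gamma>"
    unfolding conn_rep_def using \<Gamma> by (simp add: cov_def)
qed

subsection \<open>The bundle map in coordinates\<close>

text \<open>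
  This is \<open>\<phi>\<close> read in the chart and the trivialisation.
\<close>

definition pr :: "('a \<Rightarrow> real ^ 'n \<Rightarrow> 'e) \<Rightarrow> real ^ 'n \<Rightarrow> real ^ 'n \<Rightarrow> real ^ 'm" where
  "pr \<phi> x w = \<Phi> (ci x) (\<phi> (ci x) (coord_field \<A> c w (ci x)))"

lemma
  assumes \<phi>: "bundle_map \<A> E \<T> \<phi>" and N: "N \<subseteq> V \<inter> W"
  shows pr_linear: "x \<in> c ` N \<Longrightarrow> linear (pr \<phi> x)"
    and pr_smooth: "smooth_on (c ` N) (\<lambda>x. pr \<phi> x w)"
    and pr_sr: "x \<in> c ` N \<Longrightarrow> sr (\<lambda>q. \<phi> q (Y q)) x = pr \<phi> x (vr Y x)"
    and pr_at: "q \<in> N \<Longrightarrow> \<Phi> q (\<phi> q v) = pr \<phi> (c q) (tderiv \<A> c q v)"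
proof -
  have p: "linear (\<phi> q)" "\<phi> q v \<in> E q" for q v using \<phi> unfolding bundle_map_def by auto
  show at: "\<Phi> q (\<phi> q v) = pr \<phi> (c q) (tderiv \<A> c q v)" if "q \<in> N" for q v
    using that N by (auto simp: pr_def chart_inv(1)[OF chart] coord_field_tderiv(2)[OF chart])
  show "sr (\<lambda>q. \<phi> q (Y q)) x = pr \<phi> x (vr Y x)" if "x \<in> c ` N"
    using that N at by (auto simp: sr_at vrep_at[OF chart])
  show "linear (pr \<phi> x)" if x: "x \<in> c ` N"
  proof -
    obtain q where q: "q \<in> V" "q \<in> W" "x = c q" using x N by blast
    show ?thesis unfolding pr_def[abs_def] q(3) chart_inv(1)[OF chart q(1)]
      by (rule linearI) (simp_all add: linear_add[OF coord_field_tderiv(3)[OF chart q(1)]] linear_scale[OF coord_field_tderiv(3)[OF chart q(1)]]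
          linear_add[OF p(1)] linear_scale[OF p(1)] triv_add[OF triv q(2) p(2) p(2)] triv_scale[OF triv q(2) p(2)])
  qed
  have "\<forall>(V, c)\<in>\<A>. \<forall>(W, \<Phi>)\<in>\<T>. \<forall>w. smooth_map \<A> (V \<inter> W) (\<lambda>p. \<Phi> p (\<phi> p (coord_field \<A> c w p)))"
    using \<phi> by (simp add: bundle_map_def)
  from bspec[OF bspec[OF this chart, simplified] triv]
  have "smooth_map \<A> (V \<inter> W) (\<lambda>p. \<Phi> p (\<phi> p (coord_field \<A> c w p)))" by simp
  from smooth_mapD'[OF this chart] N show "smooth_on (c ` N) (\<lambda>x. pr \<phi> x w)" unfolding pr_def by blast
qed

end

lemma (in vbundle) bundle_map_section:
  assumes \<phi>: "bundle_map \<A> E \<T> \<phi>" and U: "open U" and Y: "Y \<in> vector_fields \<A> U"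
  shows "(\<lambda>q. \<phi> q (Y q)) \<in> sections \<A> E \<T> U"
proof (rule sectionsI)
  show "\<phi> q (Y q) \<in> E q" for q using \<phi> unfolding bundle_map_def by auto
  fix W \<Phi> assume W: "(W, \<Phi>) \<in> \<T>"
  show "smooth_map \<A> (U \<inter> W) (\<lambda>q. \<Phi> q (\<phi> q (Y q)))"
  proof (rule smooth_mapI)
    fix p assume p: "p \<in> U \<inter> W"
    obtain V c where V: "(V, c) \<in> \<A>" "p \<in> V" by (rule chart_ex)
    interpret bundle_chart \<A> E \<T> V c W \<Phi> by unfold_locales (use V W in auto)
    let ?N = "U \<inter> V \<inter> W"
    have o: "open ?N" using U triv_open[OF W] chart_open(1)[OF V(1)] by auto
    have N: "?N \<subseteq> V \<inter> W" "?N \<subseteq> V" by auto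
    have o': "open (c ` ?N)" by (rule chart_image_open'[OF V(1) o N(2)])
    have "smooth_on (c ` ?N) (\<lambda>x. pr \<phi> x (vr Y x))"
      by (rule smooth_on_linear_family[OF o' pr_linear[OF \<phi> N(1)] pr_smooth[OF \<phi> N(1)] vrep_smooth[OF V(1) Y]]) auto
    then have "smooth_on (c ` ?N) (sr (\<lambda>q. \<phi> q (Y q)))"
      by (rule smooth_on_cong[OF o', rotated]) (rule pr_sr[OF \<phi> N(1), symmetric])
    then show "\<exists>V c N. (V, c) \<in> \<A> \<and> open N \<and> p \<in> N \<and> N \<subseteq> V \<and>
        smooth_on (c ` N) (\<lambda>x. \<Phi> (inv_into V c x) (\<phi> (inv_into V c x) (Y (inv_into V c x))))"
      using V o p N(2) unfolding sr_def[abs_def] by blast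
  qed
qed

context bundle_chart
begin

lemma torsion_rep:
  assumes U: "open U" and N: "open N" "N \<subseteq> U \<inter> V \<inter> W" and D: "connection \<A> E \<T> U D"
    and \<Gamma>: "conn_rep U D N \<Gamma>" and \<phi>: "bundle_map \<A> E \<T> \<phi>"
    and X: "X \<in> vector_fields \<A> U" and Y: "Y \<in> vector_fields \<A> U" and x: "x \<in> c ` N"
  shows "sr (\<lambda>p. D X (\<lambda>q. \<phi> q (Y q)) p - D Y (\<lambda>q. \<phi> q (X q)) p - \<phi> p (lie_bracket \<A> X Y p)) x
     = tors \<Gamma> (pr \<phi>) x (vr X x) (vr Y x)"
proof -
  have NV: "N \<subseteq> V" "N \<subseteq> V \<inter> W" using N by auto
  have XYN: "X \<in> vector_fields \<A> N" "Y \<in> vector_fields \<A> N"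
    by (rule vector_fields_subset[OF X] vector_fields_subset[OF Y], use N in auto)+
  interpret coords "c ` N" \<Gamma> by (rule conn_rep_coords[OF \<Gamma> N(1) NV(1)])
  obtain q where q: "q \<in> N" "q \<in> U" "q \<in> V" "q \<in> W" "x = c q" using x N by blast
  have vs: "smooth_on (c ` N) (vr X)" if "X \<in> vector_fields \<A> U" for X
    by (rule vrep_smooth[OF chart that]) (use N in auto)
  have sec: "D X (\<lambda>q. \<phi> q (Y q)) q \<in> E q" if "X \<in> vector_fields \<A> U" "Y \<in> vector_fields \<A> U" for X Y
    by (rule sectionsD(1)[OF connection_section[OF D that(1) bundle_map_section[OF \<phi> U that(2)]] q(2)])
  have pE: "\<phi> q v \<in> E q" for v using \<phi> unfolding bundle_map_def by auto
  have 2: "sr (D X (\<lambda>q. \<phi> q (Y q))) x = cov \<Gamma> (vr X) (\<lambda>y. pr \<phi> y (vr Y y)) x"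
    if "X \<in> vector_fields \<A> U" "Y \<in> vector_fields \<A> U" for X Y
    using conn_repD(3)[OF \<Gamma> that(1) bundle_map_section[OF \<phi> U that(2)] x]
      cov_cong[where e="sr (\<lambda>q. \<phi> q (Y q))" and f="\<lambda>y. pr \<phi> y (vr Y y)", OF S x pr_sr[OF \<phi> NV(2)]] by simp
  have "sr (\<lambda>p. D X (\<lambda>q. \<phi> q (Y q)) p - D Y (\<lambda>q. \<phi> q (X q)) p - \<phi> p (lie_bracket \<A> X Y p)) x
     = sr (D X (\<lambda>q. \<phi> q (Y q))) x - sr (D Y (\<lambda>q. \<phi> q (X q))) x - sr (\<lambda>p. \<phi> p (lie_bracket \<A> X Y p)) x"
    using q sec[OF X Y] sec[OF Y X] pE
    by (simp add: sr_at triv_diff[OF triv q(4)] subspace_diff[OF fibre_subspace])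
  also have "\<dots> = tors \<Gamma> (pr \<phi>) x (vr X x) (vr Y x)"
    unfolding 2[OF X Y] 2[OF Y X] pr_sr[OF \<phi> NV(2) x]
    by (rule cov_tors[where f="pr \<phi>", OF pr_linear[OF \<phi> NV(2)] pr_smooth[OF \<phi> NV(2)] vs[OF X] vs[OF Y] x], assumption)
       (rule vrep_lie_bracket[OF chart N(1) NV(1) x XYN])
  finally show ?thesis .
qed

subsection \<open>Tensors in coordinates\<close>

text \<open>
  Only values on the fibres are constrained: \<open>A q w e\<close> is arbitrary for \<open>e\<close> outside \<open>E q\<close>.
\<close>

definition tensor_rep :: "'a set \<Rightarrow> ('a \<Rightarrow> real ^ 'n \<Rightarrow> 'e \<Rightarrow> real) \<Rightarrow>
    (real ^ 'n \<Rightarrow> real ^ 'n \<Rightarrow> real ^ 'm \<Rightarrow> real) \<Rightarrow> bool" where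
  "tensor_rep N A P \<longleftrightarrow> (\<forall>x\<in>c ` N. bilinear (P x)) \<and> (\<forall>a v. smooth_on (c ` N) (\<lambda>x. P x a v)) \<and>
     (\<forall>q\<in>N. \<forall>w. \<forall>e\<in>E q. A q w e = P (c q) (tderiv \<A> c q w) (\<Phi> q e))"

lemma tensor_repD:
  assumes "tensor_rep N A P"
  shows "x \<in> c ` N \<Longrightarrow> bilinear (P x)" "smooth_on (c ` N) (\<lambda>x. P x a v)"
    "q \<in> N \<Longrightarrow> e \<in> E q \<Longrightarrow> A q w e = P (c q) (tderiv \<A> c q w) (\<Phi> q e)"
  using assms unfolding tensor_rep_def by blast+

lemma tensor_rep_ex:
  assumes A: "A \<in> cotangent_dual_sections \<A> E \<T> UNIV" and N: "N \<subseteq> V \<inter> W"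
  shows "\<exists>P. tensor_rep N A P"
proof
  define P where "P x a v = A (ci x) (coord_field \<A> c a (ci x)) (frame E \<Phi> v (ci x))" for x a v
  have l1: "e \<in> E q \<Longrightarrow> linear (\<lambda>w. A q w e)" and l2: "fibre_linear (E q) (A q w)" for q e w
    using A unfolding cotangent_dual_sections_def by auto
  have "\<forall>(V, c)\<in>\<A>. \<forall>(W, \<Phi>)\<in>\<T>. \<forall>w v. smooth_map \<A> (UNIV \<inter> V \<inter> W) (\<lambda>p. A p (coord_field \<A> c w p) (frame E \<Phi> v p))"
    using A by (simp add: cotangent_dual_sections_def)
  from bspec[OF bspec[OF this chart, simplified] triv]
  have s: "smooth_map \<A> (V \<inter> W) (\<lambda>p. A p (coord_field \<A> c w p) (frame E \<Phi> v p))" for w v by simp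
  have "bilinear (P x)" if x: "x \<in> c ` N" for x
  proof -
    obtain q where q: "q \<in> V" "q \<in> W" "x = c q" using x N by blast
    note fl = frame_linear[OF triv q(2)] and cl = coord_field_tderiv(3)[OF chart q(1)]
    note fE = frame_in[OF triv q(2)]
    have l2': "A q w (e + e') = A q w e + A q w e'" "A q w (k *\<^sub>R e) = k *\<^sub>R A q w e" if "e \<in> E q" "e' \<in> E q" for w e e' k
      using l2[of q w] that unfolding fibre_linear_def by blast+
    show ?thesis
      unfolding bilinear_def P_def q(3) chart_inv(1)[OF chart q(1)]
    proof (intro conjI allI)
      show "linear (\<lambda>v. A q (coord_field \<A> c a q) (frame E \<Phi> v q))" for a
        by (rule linearI) (simp_all add: linear_add[OF fl] linear_scale[OF fl] l2'(1)[OF fE fE] l2'(2)[OF fE fE])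
      show "linear (\<lambda>a. A q (coord_field \<A> c a q) (frame E \<Phi> v q))" for v
        by (rule linearI) (simp_all add: linear_add[OF cl] linear_scale[OF cl] linear_add[OF l1[OF fE]] linear_scale[OF l1[OF fE]])
    qed
  qed
  moreover have "smooth_on (c ` N) (\<lambda>x. P x a v)" for a v
    using smooth_mapD'[OF s chart] N unfolding P_def by blast
  moreover have "A q w e = P (c q) (tderiv \<A> c q w) (\<Phi> q e)" if "q \<in> N" "e \<in> E q" for q w e
  proof -
    have "q \<in> V" "q \<in> W" using that N by auto
    then show ?thesis using that
      by (simp add: P_def chart_inv(1)[OF chart] coord_field_tderiv(2)[OF chart] frame_triv[OF triv])
  qed
  ultimately show "tensor_rep N A P" unfolding tensor_rep_def by blast
qed

lemma tensor_rep_smooth: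
  assumes P: "tensor_rep N A P" and N: "open N" "N \<subseteq> V \<inter> W"
    and X: "X \<in> vector_fields \<A> N" and \<eta>: "\<eta> \<in> sections \<A> E \<T> N"
  shows "smooth_map \<A> N (\<lambda>q. A q (X q) (\<eta> q))"
    "x \<in> c ` N \<Longrightarrow> A (ci x) (X (ci x)) (\<eta> (ci x)) = P x (vr X x) (sr \<eta> x)"
proof -
  have NV: "N \<subseteq> V" using N by auto
  have o: "open (c ` N)" by (rule chart_image_open'[OF chart N(1) NV])
  show eq: "A (ci x) (X (ci x)) (\<eta> (ci x)) = P x (vr X x) (sr \<eta> x)" if "x \<in> c ` N" for x
    using that NV tensor_repD(3)[OF P _ sectionsD(1)[OF \<eta>]]
    by (auto simp: vrep_at[OF chart] sr_at chart_inv(1)[OF chart] subset_iff)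
  have "smooth_on (c ` N) (\<lambda>x. P x (vr X x) (sr \<eta> x))"
    by (rule smooth_on_bilinear_family[OF o tensor_repD(1)[OF P] tensor_repD(2)[OF P] vrep_smooth[OF chart X] sr_smooth[OF \<eta>]])
       (use N in auto)
  then have "smooth_on (c ` N) (\<lambda>x. A (ci x) (X (ci x)) (\<eta> (ci x)))"
    by (rule smooth_on_cong[OF o, rotated]) (rule eq[symmetric])
  then show "smooth_map \<A> N (\<lambda>q. A q (X q) (\<eta> q))"
    by (rule smooth_map_chartI[where f="\<lambda>q. A q (X q) (\<eta> q)", OF chart N(1) NV])
qed

lemma codazzi_rep:
  assumes U: "open U" and N: "open N" "N \<subseteq> U \<inter> V \<inter> W" and D: "connection \<A> E \<T> U D"
    and \<Gamma>: "conn_rep U D N \<Gamma>" and P: "tensor_rep N A P"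
    and X: "X \<in> vector_fields \<A> U" and Y: "Y \<in> vector_fields \<A> U"
    and \<eta>: "\<eta> \<in> sections \<A> E \<T> U" and q: "q \<in> N"
  shows "tderiv \<A> (\<lambda>q. A q (Y q) (\<eta> q)) q (X q) - tderiv \<A> (\<lambda>q. A q (X q) (\<eta> q)) q (Y q)
      - A q (lie_bracket \<A> X Y q) (\<eta> q) - (A q (Y q) (D X \<eta> q) - A q (X q) (D Y \<eta> q))
     = codazzi \<Gamma> P (c q) (vr X (c q)) (vr Y (c q)) (sr \<eta> (c q))"
proof -
  have NV: "N \<subseteq> V" "N \<subseteq> V \<inter> W" "q \<in> V" using N q by auto
  have XYN: "X \<in> vector_fields \<A> N" "Y \<in> vector_fields \<A> N" "\<eta> \<in> sections \<A> E \<T> N"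
    by (rule vector_fields_subset[OF X] vector_fields_subset[OF Y] sections_subset[OF \<eta>], use N in auto)+
  interpret coords "c ` N" \<Gamma> by (rule conn_rep_coords[OF \<Gamma> N(1) NV(1)])
  define x where "x = c q"
  have x: "x \<in> c ` N" using q by (simp add: x_def)
  have ci: "ci x = q" using chart_inv(1)[OF chart NV(3)] by (simp add: x_def)
  have vs: "smooth_on (c ` N) (vr X)" if "X \<in> vector_fields \<A> U" for X
    by (rule vrep_smooth[OF chart that]) (use N in auto)
  have es: "smooth_on (c ` N) (sr \<eta>)" by (rule sr_smooth[OF \<eta> N(2)])
  have 1: "tderiv \<A> (\<lambda>q. A q (Y q) (\<eta> q)) q (X q) = \<partial> (vr X x) (\<lambda>y. P y (vr Y y) (sr \<eta> y)) x"
    if Y: "Y \<in> vector_fields \<A> N" for X Y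
  proof -
    have "tderiv \<A> (\<lambda>q. A q (Y q) (\<eta> q)) q (X q) = \<partial> (vr X x) (\<lambda>y. A (ci y) (Y (ci y)) (\<eta> (ci y))) x"
      using tderiv_vrep[OF chart x N(1) NV(1) tensor_rep_smooth(1)[OF P N(1) NV(2) Y XYN(3)], of X] by (simp add: ci)
    also have "\<dots> = \<partial> (vr X x) (\<lambda>y. P y (vr Y y) (sr \<eta> y)) x"
      by (rule dir_deriv_cong_open[OF S x]) (rule tensor_rep_smooth(2)[OF P N(1) NV(2) Y XYN(3)])
    finally show ?thesis .
  qed
  have 2: "A q (Y q) (D X \<eta> q) = P x (vr Y x) (cov \<Gamma> (vr X) (sr \<eta>) x)"
    if "X \<in> vector_fields \<A> U" "Y \<in> vector_fields \<A> N" for X Y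
    using tensor_rep_smooth(2)[OF P N(1) NV(2) that(2) sections_subset[OF connection_section[OF D that(1) \<eta>]] x] N(2)
      conn_repD(3)[OF \<Gamma> that(1) \<eta> x] by (simp add: ci)
  have 3: "A q (lie_bracket \<A> X Y q) (\<eta> q) = P x (vr (lie_bracket \<A> X Y) x) (sr \<eta> x)"
    using tensor_rep_smooth(2)[OF P N(1) NV(2) lie_bracket_vector_field[OF N(1) XYN(1,2)] XYN(3) x] by (simp add: ci)
  show ?thesis
    unfolding 1[OF XYN(2)] 1[OF XYN(1)] 2[OF X XYN(2)] 2[OF Y XYN(1)] 3 x_def[symmetric]
    by (rule cov_codazzi[where P=P, OF tensor_repD(1)[OF P] tensor_repD(2)[OF P] vs[OF X] vs[OF Y] es x], assumption)
       (rule vrep_lie_bracket[OF chart N(1) NV(1) x XYN(1,2)])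
qed

end

text \<open>
  Local representations may use a different chart and trivialisation near each point; smoothness in the given ones
  follows by evaluating on their coordinate fields and frames.
\<close>

lemma (in vbundle) cotangent_dual_sectionsI:
  fixes A :: "'a \<Rightarrow> real ^ 'n \<Rightarrow> 'e \<Rightarrow> real"
  assumes loc: "\<And>p. \<exists>V c W \<Phi> N P. (V, c) \<in> \<A> \<and> (W, \<Phi>) \<in> \<T> \<and> open N \<and> p \<in> N \<and> N \<subseteq> V \<inter> W \<and>
      bundle_chart.tensor_rep \<A> E c \<Phi> N A P"
  shows "A \<in> cotangent_dual_sections \<A> E \<T> UNIV"
proof -
  have lin: "(\<forall>e\<in>E p. linear (\<lambda>w. A p w e)) \<and> (\<forall>w. fibre_linear (E p) (A p w))" for p
  proof (intro conjI ballI allI)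
  obtain V c W \<Phi> N P where h: "(V, c) \<in> \<A>" "(W, \<Phi>) \<in> \<T>" "open N" "p \<in> N" "N \<subseteq> V \<inter> W"
    "bundle_chart.tensor_rep \<A> E c \<Phi> N A P" using loc[of p] by (elim exE conjE)
  interpret bundle_chart \<A> E \<T> V c W \<Phi> by unfold_locales (use h in auto)
  have p: "p \<in> V" "p \<in> W" "c p \<in> c ` N" using h by auto
  note P = tensor_repD(3)[OF h(6,4)] and b = tensor_repD(1)[OF h(6) p(3)]
  show "linear (\<lambda>w. A p w e)" if e: "e \<in> E p" for e
    by (rule linearI) (simp_all add: P[OF e] linear_add[OF tderiv_chart_bij(1)[OF h(1) p(1)]]
        linear_scale[OF tderiv_chart_bij(1)[OF h(1) p(1)]] bilinear_ladd[OF b] bilinear_lmul[OF b])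
  show "fibre_linear (E p) (A p w)" for w
    unfolding fibre_linear_def
    by (auto simp: P subspace_add[OF fibre_subspace] subspace_scale[OF fibre_subspace] triv_add[OF h(2) p(2)]
        triv_scale[OF h(2) p(2)] bilinear_radd[OF b] bilinear_rmul[OF b])
  qed
  have sm: "smooth_map \<A> (V' \<inter> W') (\<lambda>p. A p (coord_field \<A> c' w p) (frame E \<Psi> v p))"
    if h': "(V', c') \<in> \<A>" "(W', \<Psi>) \<in> \<T>" for V' c' W' \<Psi> w v
  proof (rule smooth_map_local)
    fix p assume p: "p \<in> V' \<inter> W'"
    obtain V c W \<Phi> N P where h: "(V, c) \<in> \<A>" "(W, \<Phi>) \<in> \<T>" "open N" "p \<in> N" "N \<subseteq> V \<inter> W"
      "bundle_chart.tensor_rep \<A> E c \<Phi> N A P" using loc[of p] by (elim exE conjE)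
    interpret bundle_chart \<A> E \<T> V c W \<Phi> by unfold_locales (use h in auto)
    interpret B': bundle_chart \<A> E \<T> V' c' W' \<Psi> by unfold_locales (use h' in auto)
    let ?N = "N \<inter> V' \<inter> W'"
    have o: "open ?N" using h(3) chart_open(1)[OF h'(1)] triv_open[OF h'(2)] by auto
    have P: "tensor_rep ?N A P"
      using h(6) unfolding tensor_rep_def by (auto intro: smooth_on_subset[where S="c ` N"])
    have "smooth_map \<A> ?N (\<lambda>p. A p (coord_field \<A> c' w p) (frame E \<Psi> v p))"
      by (rule tensor_rep_smooth(1)[OF P o _ B'.coord_field_vf[OF o] B'.frame_section[OF o]]) (use h(5) in auto)
    then show "\<exists>N. open N \<and> p \<in> N \<and> smooth_map \<A> N (\<lambda>p. A p (coord_field \<A> c' w p) (frame E \<Psi> v p))"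
      using o p h(4) by blast
  qed
  show ?thesis
    unfolding cotangent_dual_sections_def using lin sm by auto
qed

context bundle_chart
begin

lemma dual_sectionsI:
  assumes N: "open N" "N \<subseteq> V \<inter> W" and r: "\<And>x. x \<in> c ` N \<Longrightarrow> linear (r x)" "\<And>v. smooth_on (c ` N) (\<lambda>x. r x v)"
  shows "(\<lambda>q e. r (c q) (\<Phi> q e)) \<in> dual_sections \<A> E \<T> N"
proof -
  have lin: "fibre_linear (E p) (\<lambda>e. r (c p) (\<Phi> p e))" if p: "p \<in> N" for p
  proof -
  from p have pW: "p \<in> W" and l: "linear (r (c p))" using N r by auto
  show ?thesis
    unfolding fibre_linear_def by (simp add: triv_add[OF triv pW] triv_scale[OF triv pW] linear_add[OF l] linear_scale[OF l])
  qed
  have sm: "smooth_map \<A> (N \<inter> W') (\<lambda>p. r (c p) (\<Phi> p (frame E \<Psi> v p)))" if h': "(W', \<Psi>) \<in> \<T>" for W' \<Psi> v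
  proof -
  let ?N = "N \<inter> W'"
  interpret B': bundle_chart \<A> E \<T> V c W' \<Psi> by unfold_locales (use h' chart in auto)
  have o: "open ?N" using N triv_open[OF h'] by auto
  have NV: "?N \<subseteq> V" using N by auto
  have o': "open (c ` ?N)" by (rule chart_image_open'[OF chart o NV])
  have "frame E \<Psi> v \<in> sections \<A> E \<T> ?N" by (rule B'.frame_section[OF o]) auto
  then have "smooth_on (c ` ?N) (sr (frame E \<Psi> v))" by (rule sr_smooth) (use N in auto)
  then have "smooth_on (c ` ?N) (\<lambda>x. r x (sr (frame E \<Psi> v) x))"
    by (rule smooth_on_linear_family[OF o', rotated 2]) (auto intro: r(1) smooth_on_subset[OF r(2)])
  then have "smooth_on (c ` ?N) (\<lambda>x. r (c (ci x)) (\<Phi> (ci x) (frame E \<Psi> v (ci x))))"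
    by (rule smooth_on_cong[OF o', rotated]) (use NV in \<open>auto simp: sr_at chart_inv(1)[OF chart] subset_iff\<close>)
  then show ?thesis
    by (rule smooth_map_chartI[where f="\<lambda>p. r (c p) (\<Phi> p (frame E \<Psi> v p))", OF chart o NV])
  qed
  show ?thesis
    unfolding dual_sections_def using lin sm by auto
qed

end

section \<open>Traces\<close>

text \<open>
  The trace in an abstract basis of the fibre agrees with the trace in coordinates: writing the components with respect to
  the abstract basis as linear functionals on the standard fibre, both are the same double sum.
\<close>

lemma fibre_trace_eq:
  fixes h :: "'e::real_vector \<Rightarrow> real ^ 'm::finite"
  assumes F: "subspace F" and h: "fibre_linear F h" "bij_betw h F UNIV"
    and L: "\<And>e. e \<in> F \<Longrightarrow> L e \<in> F \<and> h (L e) = M (h e)" and M: "linear M"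
  shows "fibre_trace F L = (\<Sum>i\<in>Basis. M i \<bullet> i)"
proof -
  define B where "B = (SOME B. B \<subseteq> F \<and> independent B \<and> F \<subseteq> span B)"
  obtain B0 where "B0 \<subseteq> F" "independent B0" "F \<subseteq> span B0"
    by (rule real_vector.maximal_independent_subset[of F])
  then have "B \<subseteq> F \<and> independent B \<and> F \<subseteq> span B"
    unfolding B_def by (intro someI[where P="\<lambda>B. B \<subseteq> F \<and> independent B \<and> F \<subseteq> span B" and x=B0] conjI)
  then have B: "B \<subseteq> F" "independent B" "F \<subseteq> span B" by auto
  define g where "g v = inv_into F h v" for v
  have gF: "g v \<in> F" and hg: "h (g v) = v" for v
    unfolding g_def using h(2) by (auto simp: bij_betw_def intro!: inv_into_into f_inv_into_f)
  have gh: "g (h e) = e" if "e \<in> F" for e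
    unfolding g_def using h(2) that by (simp add: bij_betw_inv_into_left)
  have hadd: "h (x + y) = h x + h y" and hscale: "h (k *\<^sub>R x) = k *\<^sub>R h x" if "x \<in> F" "y \<in> F" for x y k
    using h(1) that unfolding fibre_linear_def by blast+
  have inj: "x = y" if "x \<in> F" "y \<in> F" "h x = h y" for x y using gh that by metis
  have g: "linear g"
    by (rule linearI; rule inj) (simp_all add: gF hg hadd hscale[OF gF gF] subspace_add[OF F] subspace_scale[OF F])
  have hsum: "h (\<Sum>b\<in>I. k b *\<^sub>R b) = (\<Sum>b\<in>I. k b *\<^sub>R h b)" if "I \<subseteq> F" for k I
  proof -
    have "h 0 = 0" using hscale[OF subspace_0[OF F] subspace_0[OF F], of 0] by simp
    then show ?thesis using that
      by (induction I rule: infinite_finite_induct)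
         (auto simp: hadd hscale subspace_sum[OF F] subspace_scale[OF F] subset_iff)
  qed
  have "F \<subseteq> span (g ` Basis)"
  proof
    fix e assume "e \<in> F"
    have "e = g (\<Sum>i\<in>Basis. (h e \<bullet> i) *\<^sub>R i)" using gh[OF \<open>e \<in> F\<close>] by (simp add: euclidean_representation)
    also have "\<dots> = (\<Sum>i\<in>Basis. (h e \<bullet> i) *\<^sub>R g i)" by (simp add: linear_sum[OF g] linear_scale[OF g])
    also have "\<dots> \<in> span (g ` Basis)" by (intro span_sum span_scale span_base) auto
    finally show "e \<in> span (g ` Basis)" .
  qed
  then have finB: "finite B" using real_vector.independent_span_bound[of "g ` Basis" B] B by auto
  have gs: "g v \<in> span B" for v using gF B(3) by blast
  have lin: "linear (\<lambda>v. representation B (g v) b)" for b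
    by (rule linearI) (simp_all add: linear_add[OF g] linear_scale[OF g] real_vector.representation_add[OF B(2) gs gs]
        real_vector.representation_scale[OF B(2) gs])
  have rep: "(\<Sum>b\<in>B. representation B (g v) b *\<^sub>R h b) = v" for v
    using hsum[OF B(1), of "representation B (g v)"] real_vector.sum_representation_eq[OF B(2) gs finB order_refl, of v] hg by simp
  have "representation B (L b) b = (\<Sum>i\<in>Basis. (h b \<bullet> i) * representation B (g (M i)) b)" if "b \<in> B" for b
  proof -
    have "L b = g (M (h b))" using L[of b] gh B(1) that by (metis subsetD)
    then show ?thesis
      using linear_expand[OF linear_compose[OF M lin[of b]], of "h b"] by (simp add: o_def)
  qed
  then have "(\<Sum>b\<in>B. representation B (L b) b) = (\<Sum>b\<in>B. \<Sum>i\<in>Basis. (h b \<bullet> i) * representation B (g (M i)) b)"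
    by (rule sum.cong[OF refl])
  also have "\<dots> = (\<Sum>i\<in>Basis. (\<Sum>b\<in>B. representation B (g (M i)) b *\<^sub>R h b) \<bullet> i)"
    by (subst sum.swap) (simp add: inner_sum_left mult.commute)
  also have "\<dots> = (\<Sum>i\<in>Basis. M i \<bullet> i)" by (simp add: rep)
  finally show ?thesis unfolding fibre_trace_def Let_def B_def[symmetric] .
qed

lemma trace_rank_one:
  fixes p :: "'u::euclidean_space \<Rightarrow> real"
  assumes "linear p"
  shows "(\<Sum>i\<in>Basis. (p i *\<^sub>R w) \<bullet> i) = p w"
  using linear_expand[OF assms, of w] by (simp add: mult.commute)

section \<open>Projective changes in coordinates\<close>

lemma scaleR_twice: "(2 * k) *\<^sub>R v = k *\<^sub>R v + k *\<^sub>R (v::'u::real_vector)"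
  by (simp add: scaleR_left_distrib[symmetric])

locale projective_coords = coords S \<Gamma>
  for S :: "'v::euclidean_space set" and \<Gamma> :: "'v \<Rightarrow> 'v \<Rightarrow> 'u::euclidean_space \<Rightarrow> 'u" +
  fixes f :: "'v \<Rightarrow> 'v \<Rightarrow> 'u"
  assumes f_lin: "\<And>x. x \<in> S \<Longrightarrow> linear (f x)" and f_sm: "\<And>a. smooth_on S (\<lambda>x. f x a)"
    and tors0: "\<And>x a b. x \<in> S \<Longrightarrow> tors \<Gamma> f x a b = 0"
begin

text \<open>
  In invariant terms this is \<open>(\<nabla>\<^sub>a r)(v) - r(f a) r(v)\<close>.
\<close>

definition rho_tensor :: "('v \<Rightarrow> 'u \<Rightarrow> real) \<Rightarrow> 'v \<Rightarrow> 'v \<Rightarrow> 'u \<Rightarrow> real" where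
  "rho_tensor r x a v = \<partial> a (\<lambda>y. r y v) x - r x (\<Gamma> x a v) - r x (f x a) * r x v"

definition proj_change :: "('v \<Rightarrow> 'u \<Rightarrow> real) \<Rightarrow> 'v \<Rightarrow> 'v \<Rightarrow> 'u \<Rightarrow> 'u" where
  "proj_change r x a v = \<Gamma> x a v + r x (f x a) *\<^sub>R v + r x v *\<^sub>R f x a"

lemma tors_swap:
  assumes "x \<in> S"
  shows "\<partial> a (\<lambda>y. f y b) x = \<partial> b (\<lambda>y. f y a) x + \<Gamma> x b (f x a) - \<Gamma> x a (f x b)"
  using tors0[OF assms, of a b] by (simp add: tors_def algebra_simps)

context
  fixes r :: "'v \<Rightarrow> 'u \<Rightarrow> real"
  assumes r_lin: "\<And>x. x \<in> S \<Longrightarrow> linear (r x)" and r_sm: "\<And>v. smooth_on S (\<lambda>x. r x v)"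
begin

lemma r_add: "x \<in> S \<Longrightarrow> r x (v + w) = r x v + r x w" using r_lin linear_add by blast
lemma r_diff: "x \<in> S \<Longrightarrow> r x (v - w) = r x v - r x w" using r_lin linear_diff by blast
lemma r_scale: "x \<in> S \<Longrightarrow> r x (k *\<^sub>R v) = k * r x v" using r_lin linear_scale by (metis real_scaleR_def)
lemma f_add: "x \<in> S \<Longrightarrow> f x (v + w) = f x v + f x w" using f_lin linear_add by blast
lemma f_scale: "x \<in> S \<Longrightarrow> f x (k *\<^sub>R v) = k *\<^sub>R f x v" using f_lin linear_scale by blast
lemma \<Gamma>_add: "x \<in> S \<Longrightarrow> \<Gamma> x a (v + w) = \<Gamma> x a v + \<Gamma> x a w" using bil bilinear_radd by blast
lemma \<Gamma>_scale: "x \<in> S \<Longrightarrow> \<Gamma> x a (k *\<^sub>R v) = k *\<^sub>R \<Gamma> x a v" using bil bilinear_rmul by blast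
lemma \<Gamma>_add1: "x \<in> S \<Longrightarrow> \<Gamma> x (a + b) v = \<Gamma> x a v + \<Gamma> x b v" using bil bilinear_ladd by blast
lemma \<Gamma>_scale1: "x \<in> S \<Longrightarrow> \<Gamma> x (k *\<^sub>R a) v = k *\<^sub>R \<Gamma> x a v" using bil bilinear_lmul by blast

lemma proj_change_bilinear: "x \<in> S \<Longrightarrow> bilinear (proj_change r x)"
  unfolding bilinear_def proj_change_def
  by (auto intro!: linearI simp: r_add r_scale f_add f_scale \<Gamma>_add \<Gamma>_scale \<Gamma>_add1 \<Gamma>_scale1 algebra_simps)

lemma r_f_smooth: "smooth_on S (\<lambda>x. r x (f x a))"
  by (rule smooth_on_linear_family[OF S r_lin r_sm f_sm])

lemma proj_change_smooth: "smooth_on S (\<lambda>x. proj_change r x a v)"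
  unfolding proj_change_def
  by (intro smooth_on_add smooth_on_scaleR S sm r_f_smooth smooth_on_const r_sm f_sm)

lemma proj_change_tors:
  assumes x: "x \<in> S"
  shows "tors (proj_change r) f x a b = 0"
  using tors0[OF x, of a b] by (simp add: tors_def proj_change_def algebra_simps)

lemma dir_deriv_r_f:
  assumes x: "x \<in> S"
  shows "\<partial> a (\<lambda>y. r y (f y b)) x = \<partial> a (\<lambda>y. r y (f x b)) x + r x (\<partial> a (\<lambda>y. f y b) x)"
  by (rule dir_deriv_linear_family[where L=r and f="\<lambda>y. f y b", OF S x r_lin r_sm f_sm])

lemma dir_deriv_proj_change:
  assumes x: "x \<in> S"
  shows "\<partial> a (\<lambda>y. proj_change r y b v) x = \<partial> a (\<lambda>y. \<Gamma> y b v) x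
     + (\<partial> a (\<lambda>y. r y (f x b)) x + r x (\<partial> a (\<lambda>y. f y b) x)) *\<^sub>R v
     + \<partial> a (\<lambda>y. r y v) x *\<^sub>R f x b + r x v *\<^sub>R \<partial> a (\<lambda>y. f y b) x"
proof -
  note d = smooth_onD(1)[OF _ x]
  have "((\<lambda>y. proj_change r y b v) has_derivative (\<lambda>a. \<partial> a (\<lambda>y. \<Gamma> y b v) x
     + \<partial> a (\<lambda>y. r y (f y b)) x *\<^sub>R v
     + (r x v *\<^sub>R \<partial> a (\<lambda>y. f y b) x + \<partial> a (\<lambda>y. r y v) x *\<^sub>R f x b))) (at x)"
    unfolding proj_change_def
    by (rule has_derivative_add has_derivative_scaleR has_derivative_scaleR_left
          has_derivative_dir_deriv d sm r_f_smooth r_sm f_sm)+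
  from dir_deriv_eq[OF this] show ?thesis by (simp add: dir_deriv_r_f[OF x] add_ac)
qed

text \<open>
  The formula for the curvature of the changed connection. The torsion enters through \<open>tors_swap\<close>: it
  expresses the exterior derivative of \<open>r \<circ> f\<close> as the skew part of \<open>rho_tensor\<close>, and it removes the terms with
  derivatives of \<open>f\<close>.
\<close>

lemma curv_proj_change:
  assumes x: "x \<in> S"
  shows "curv (proj_change r) x a b v = curv \<Gamma> x a b v
     + (rho_tensor r x a (f x b) - rho_tensor r x b (f x a)) *\<^sub>R v
     + rho_tensor r x a v *\<^sub>R f x b - rho_tensor r x b v *\<^sub>R f x a"
  unfolding curv_def dir_deriv_proj_change[OF x] rho_tensor_def
  unfolding tors_swap[OF x, of a b]
  by (simp add: scaleR_twice proj_change_def \<Gamma>_add[OF x] \<Gamma>_scale[OF x] r_add[OF x] r_scale[OF x] r_diff[OF x]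
      algebra_simps)

lemma rho_tensor_linear: "x \<in> S \<Longrightarrow> linear (rho_tensor r x a)"
proof -
  assume x: "x \<in> S"
  have 1: "\<partial> a (\<lambda>y. r y (v + w)) x = \<partial> a (\<lambda>y. r y v) x + \<partial> a (\<lambda>y. r y w) x" for v w
    by (subst dir_deriv_cong_open[OF S x, where g="\<lambda>y. r y v + r y w"])
       (auto simp: r_add intro!: dir_deriv_add smooth_onD(1)[OF r_sm x])
  have 2: "\<partial> a (\<lambda>y. r y (k *\<^sub>R v)) x = k * \<partial> a (\<lambda>y. r y v) x" for v k
    by (subst dir_deriv_cong_open[OF S x, where g="\<lambda>y. k * r y v"])
       (simp_all add: r_scale dir_deriv_linear[OF bounded_linear_mult_right smooth_onD(1)[OF r_sm x]])
  show "linear (rho_tensor r x a)"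
    by (rule linearI)
       (simp_all add: rho_tensor_def 1 2 r_add[OF x] r_scale[OF x] \<Gamma>_add[OF x] \<Gamma>_scale[OF x] algebra_simps)
qed

lemma rho_tensor_linear1: "x \<in> S \<Longrightarrow> linear (\<lambda>a. rho_tensor r x a v)"
proof -
  assume x: "x \<in> S"
  note l = linear_dir_deriv[OF smooth_onD(1)[OF r_sm x]]
  show "linear (\<lambda>a. rho_tensor r x a v)"
    by (rule linearI)
       (simp_all add: rho_tensor_def linear_add[OF l] linear_scale[OF l] r_add[OF x] r_scale[OF x] \<Gamma>_add1[OF x] \<Gamma>_scale1[OF x]
          f_add[OF x] f_scale[OF x] algebra_simps)
qed

lemma rho_tensor_smooth: "smooth_on S (\<lambda>x. rho_tensor r x a v)"
  unfolding rho_tensor_def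
  by (intro smooth_on_diff smooth_on_mult S smooth_on_dir_deriv r_sm r_f_smooth
      smooth_on_linear_family[OF S r_lin r_sm sm])

text \<open>
  Taking the trace of \<open>curv_proj_change\<close>: the multiple of the identity contributes the dimension of the fibre, the two
  terms of rank one contribute one more.
\<close>

lemma rho_tensor_symmetric:
  assumes x: "x \<in> S" and flat: "\<And>v. curv (proj_change r) x a b v = 0"
    and tr: "(\<Sum>i\<in>Basis. curv \<Gamma> x a b i \<bullet> i) = 0"
  shows "rho_tensor r x a (f x b) = rho_tensor r x b (f x a)"
proof -
  define d where "d = rho_tensor r x a (f x b) - rho_tensor r x b (f x a)"
  have "0 = (\<Sum>i\<in>Basis. curv (proj_change r) x a b i \<bullet> i)" by (simp add: flat)
  also have "\<dots> = (\<Sum>i\<in>Basis. curv \<Gamma> x a b i \<bullet> i) + (\<Sum>i\<in>(Basis::'u set). d * (i \<bullet> i))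
     + (\<Sum>i\<in>Basis. (rho_tensor r x a i *\<^sub>R f x b) \<bullet> i) - (\<Sum>i\<in>Basis. (rho_tensor r x b i *\<^sub>R f x a) \<bullet> i)"
    unfolding curv_proj_change[OF x] d_def by (simp add: inner_diff_left inner_add_left sum.distrib sum_subtractf)
  also have "\<dots> = (real DIM('u) + 1) * d"
    unfolding tr trace_rank_one[OF rho_tensor_linear[OF x]] by (simp add: d_def inner_Basis algebra_simps)
  finally have "d = 0" by (simp add: add_eq_0_iff)
  then show ?thesis by (simp add: d_def)
qed

text \<open>
  The exterior covariant derivative of \<open>\<nabla> r\<close> is the curvature applied to \<open>r\<close>. Inserting \<open>K\<close>, this cancels
  against the derivative of the quadratic term of \<open>rho_tensor\<close>, up to a multiple of the difference in \<open>sym\<close>.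
\<close>

lemma codazzi_rho_tensor:
  assumes x: "x \<in> S"
    and sym: "rho_tensor r x a (f x b) = rho_tensor r x b (f x a)"
    and K: "curv \<Gamma> x a b v = rho_tensor r x b v *\<^sub>R f x a - rho_tensor r x a v *\<^sub>R f x b"
  shows "codazzi \<Gamma> (rho_tensor r) x a b v = 0"
proof -
  have D: "\<partial> a (\<lambda>y. rho_tensor r y b v) x = \<partial> a (\<lambda>y. \<partial> b (\<lambda>z. r z v) y) x
      - (\<partial> a (\<lambda>y. r y (\<Gamma> x b v)) x + r x (\<partial> a (\<lambda>y. \<Gamma> y b v) x))
      - ((\<partial> a (\<lambda>y. r y (f x b)) x + r x (\<partial> a (\<lambda>y. f y b) x)) * r x v + r x (f x b) * \<partial> a (\<lambda>y. r y v) x)" for a b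
  proof -
    note d = smooth_onD(1)[OF _ x]
    have s: "smooth_on S (\<lambda>y. r y (\<Gamma> y b v))"
      by (rule smooth_on_linear_family[OF S r_lin r_sm sm])
    have "((\<lambda>y. rho_tensor r y b v) has_derivative (\<lambda>a. \<partial> a (\<lambda>y. \<partial> b (\<lambda>z. r z v) y) x
       - \<partial> a (\<lambda>y. r y (\<Gamma> y b v)) x
       - (r x (f x b) * \<partial> a (\<lambda>y. r y v) x + \<partial> a (\<lambda>y. r y (f y b)) x * r x v))) (at x)"
      unfolding rho_tensor_def
      by (rule has_derivative_diff has_derivative_mult
          has_derivative_dir_deriv d smooth_on_dir_deriv s r_f_smooth r_sm)+
    moreover have "\<partial> a (\<lambda>y. r y (\<Gamma> y b v)) x = \<partial> a (\<lambda>y. r y (\<Gamma> x b v)) x + r x (\<partial> a (\<lambda>y. \<Gamma> y b v) x)"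
      by (rule dir_deriv_linear_family[where L=r and f="\<lambda>y. \<Gamma> y b v", OF S x r_lin r_sm sm])
    ultimately show ?thesis by (simp add: dir_deriv_eq dir_deriv_r_f[OF x])
  qed
  have rK: "r x (curv \<Gamma> x a b v) = rho_tensor r x b v * r x (f x a) - rho_tensor r x a v * r x (f x b)"
    unfolding K by (simp add: r_diff[OF x] r_scale[OF x])
  have rK': "r x (\<partial> a (\<lambda>y. \<Gamma> y b v) x) = r x (\<partial> b (\<lambda>y. \<Gamma> y a v) x) - r x (\<Gamma> x a (\<Gamma> x b v)) + r x (\<Gamma> x b (\<Gamma> x a v))
      + rho_tensor r x b v * r x (f x a) - rho_tensor r x a v * r x (f x b)"
    using rK by (simp add: curv_def r_diff[OF x] r_add[OF x])
  have sym': "\<partial> a (\<lambda>y. r y (f x b)) x = \<partial> b (\<lambda>y. r y (f x a)) x + r x (\<Gamma> x a (f x b)) - r x (\<Gamma> x b (f x a))"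
    using sym by (simp add: rho_tensor_def)
  have rF: "r x (\<partial> a (\<lambda>y. f y b) x) = r x (\<partial> b (\<lambda>y. f y a) x) + r x (\<Gamma> x b (f x a)) - r x (\<Gamma> x a (f x b))"
    unfolding tors_swap[OF x, of a b] by (simp add: r_diff[OF x] r_add[OF x])
  show ?thesis
    unfolding codazzi_def D[of a b] D[of b a] dir_deriv_commute[OF S r_sm x, where a=a and b=b] rK' sym' rF
    by (simp add: rho_tensor_def algebra_simps)
qed

end

text \<open>
  The quadratic equation \<open>rho_tensor r = P\<close> becomes linear for the pair \<open>(\<tau>, g)\<close> with
  \<open>r x v = - (\<tau> x \<bullet> v) / g x\<close>, namely \<open>\<partial> a (\<tau> \<bullet> v) = \<tau> \<bullet> \<Gamma> a v - g P a v\<close> and \<open>\<partial> a g = \<tau> \<bullet> f a\<close>.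
  The first component of the integrability condition of this system is equivalent to \<open>K\<close> and \<open>cod\<close>, the second one to
  the vanishing of the torsion together with \<open>sym\<close>.
\<close>

lemma rho_exists:
  assumes P: "\<And>x. x \<in> S \<Longrightarrow> bilinear (P x)" "\<And>a v. smooth_on S (\<lambda>x. P x a v)"
    and sym: "\<And>x a b. x \<in> S \<Longrightarrow> P x a (f x b) = P x b (f x a)"
    and K: "\<And>x a b v. x \<in> S \<Longrightarrow> curv \<Gamma> x a b v = P x b v *\<^sub>R f x a - P x a v *\<^sub>R f x b"
    and cod: "\<And>x a b v. x \<in> S \<Longrightarrow> codazzi \<Gamma> P x a b v = 0"
    and x0: "x0 \<in> S"
  obtains r e where "e > 0" "ball x0 e \<subseteq> S" "\<And>x. linear (r x)" "\<And>v. smooth_on (ball x0 e) (\<lambda>x. r x v)"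
    "\<And>x a v. x \<in> ball x0 e \<Longrightarrow> rho_tensor r x a v = P x a v"
proof -
  \<comment> \<open>The right-hand side of the linear system; the first component is characterised by its inner products \<open>Bv\<close>.\<close>
  define B :: "'v \<Rightarrow> 'v \<Rightarrow> 'u \<times> real \<Rightarrow> 'u \<times> real" where
    "B x a z = (\<Sum>b\<in>Basis. (fst z \<bullet> \<Gamma> x a b - snd z * P x a b) *\<^sub>R b, fst z \<bullet> f x a)" for x a z
  have linP: "linear (P x a)" "linear (\<Gamma> x a)" if "x \<in> S" for x a
    using P(1)[OF that] bil[OF that] by (auto simp: bilinear_def)
  have Bb: "fst (B x a z) \<bullet> b = fst z \<bullet> \<Gamma> x a b - snd z * P x a b" if "b \<in> Basis" for x a z b
    using that by (simp add: B_def inner_sum_left_Basis)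
  have Bv: "fst (B x a z) \<bullet> v = fst z \<bullet> \<Gamma> x a v - snd z * P x a v" if x: "x \<in> S" for x a z v
  proof -
    have l: "linear (\<lambda>v. fst z \<bullet> \<Gamma> x a v - snd z * P x a v)"
      by (rule linearI) (simp_all add: linear_add[OF linP(1)[OF x]] linear_add[OF linP(2)[OF x]]
          linear_scale[OF linP(1)[OF x]] linear_scale[OF linP(2)[OF x]] inner_add_right algebra_simps)
    have "fst (B x a z) \<bullet> v = (\<Sum>b\<in>Basis. (v \<bullet> b) * (fst (B x a z) \<bullet> b))"
      by (subst euclidean_inner) (simp add: mult.commute)
    also have "\<dots> = (\<Sum>b\<in>Basis. (v \<bullet> b) *\<^sub>R (fst z \<bullet> \<Gamma> x a b - snd z * P x a b))"
      by (rule sum.cong) (simp_all add: Bb)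
    also have "\<dots> = fst z \<bullet> \<Gamma> x a v - snd z * P x a v" by (rule linear_expand[OF l, symmetric])
    finally show ?thesis .
  qed
  have Bs: "snd (B x a z) = fst z \<bullet> f x a" for x a z by (simp add: B_def)
  have Bsm: "smooth_on S (\<lambda>x. B x a z)" for a z
    unfolding B_def by (intro smooth_intros S sm P(2) f_sm)
  have Bbil: "bilinear (B x)" if x: "x \<in> S" for x
  proof -
    note g = bilinear_ladd[OF bil[OF x]] bilinear_lmul[OF bil[OF x]] bilinear_ladd[OF P(1)[OF x]] bilinear_lmul[OF P(1)[OF x]]
    have 1: "B x (a + a') z = B x a z + B x a' z" "B x (k *\<^sub>R a) z = k *\<^sub>R B x a z" for a a' z k
      by (simp_all add: B_def g linear_add[OF f_lin[OF x]] linear_scale[OF f_lin[OF x]] inner_add_right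
          scaleR_sum_right flip: sum.distrib) (simp_all add: algebra_simps)
    have 2: "B x a (z + z') = B x a z + B x a z'" "B x a (k *\<^sub>R z) = k *\<^sub>R B x a z" for a z z' k
      by (simp_all add: B_def inner_add_left scaleR_sum_right flip: sum.distrib) (simp_all add: algebra_simps)
    show ?thesis unfolding bilinear_def by (auto intro!: linearI 1 2)
  qed
  have flatB: "\<partial> h (\<lambda>y. B y k w) x + B x k (B x h w) = \<partial> k (\<lambda>y. B y h w) x + B x h (B x k w)"
    if x: "x \<in> S" for x h k w
  proof -
    define t s where "t = fst w" and "s = snd w"
    note dB = smooth_onD(1)[OF Bsm x]
    have 1: "fst (\<partial> h (\<lambda>y. B y k w) x) \<bullet> b = t \<bullet> \<partial> h (\<lambda>y. \<Gamma> y k b) x - s * \<partial> h (\<lambda>y. P y k b) x"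
      if b: "b \<in> Basis" for h k b
    proof -
      have bl: "bounded_linear (\<lambda>z::'u \<times> real. fst z \<bullet> b)"
        by (rule bounded_linear_compose[OF bounded_linear_inner_left bounded_linear_fst])
      have "fst (\<partial> h (\<lambda>y. B y k w) x) \<bullet> b = \<partial> h (\<lambda>y. fst (B y k w) \<bullet> b) x"
        by (rule dir_deriv_linear[OF bl dB, symmetric])
      also have "\<dots> = \<partial> h (\<lambda>y. t \<bullet> \<Gamma> y k b - s * P y k b) x" by (simp add: Bb[OF b] t_def s_def)
      also have "\<dots> = t \<bullet> \<partial> h (\<lambda>y. \<Gamma> y k b) x - s * \<partial> h (\<lambda>y. P y k b) x"
        by (rule dir_deriv_eq[OF has_derivative_diff[OF has_derivative_inner_right[OF has_derivative_dir_deriv[OF smooth_onD(1)[OF sm x]]]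
              has_derivative_mult_right[OF has_derivative_dir_deriv[OF smooth_onD(1)[OF P(2) x]]]]])
      finally show ?thesis .
    qed
    have 2: "fst (B x k (B x h w)) \<bullet> b = t \<bullet> \<Gamma> x h (\<Gamma> x k b) - s * P x h (\<Gamma> x k b) - (t \<bullet> f x h) * P x k b" for h k b
      by (simp add: Bv[OF x] Bs t_def s_def)
    have "(\<partial> h (\<lambda>y. \<Gamma> y k b) x + \<Gamma> x h (\<Gamma> x k b)) - (\<partial> k (\<lambda>y. \<Gamma> y h b) x + \<Gamma> x k (\<Gamma> x h b))
       = P x k b *\<^sub>R f x h - P x h b *\<^sub>R f x k" for b
      using K[OF x, of h k b] by (simp add: curv_def algebra_simps)
    from arg_cong[OF this, of "\<lambda>z. t \<bullet> z"]
    have Kt: "t \<bullet> \<partial> h (\<lambda>y. \<Gamma> y k b) x + t \<bullet> \<Gamma> x h (\<Gamma> x k b) - (t \<bullet> \<partial> k (\<lambda>y. \<Gamma> y h b) x + t \<bullet> \<Gamma> x k (\<Gamma> x h b))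
       = P x k b * (t \<bullet> f x h) - P x h b * (t \<bullet> f x k)" for b
      by (simp add: inner_diff_right inner_add_right)
    have Cs: "s * \<partial> h (\<lambda>y. P y k b) x = s * \<partial> k (\<lambda>y. P y h b) x + s * P x k (\<Gamma> x h b) - s * P x h (\<Gamma> x k b)" for b
      using arg_cong[OF cod[OF x, of h k b], of "\<lambda>z. s * z"] by (simp add: codazzi_def algebra_simps)
    have F: "fst (\<partial> h (\<lambda>y. B y k w) x + B x k (B x h w)) = fst (\<partial> k (\<lambda>y. B y h w) x + B x h (B x k w))"
    proof (rule euclidean_eqI)
      fix b :: 'u assume b: "b \<in> Basis"
      show "fst (\<partial> h (\<lambda>y. B y k w) x + B x k (B x h w)) \<bullet> b = fst (\<partial> k (\<lambda>y. B y h w) x + B x h (B x k w)) \<bullet> b"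
        using Kt[of b] Cs[of b] by (simp add: inner_add_left 1[OF b] 2 algebra_simps)
    qed
    have 3: "snd (\<partial> h (\<lambda>y. B y k w) x) = t \<bullet> \<partial> h (\<lambda>y. f y k) x" for h k
    proof -
      have "snd (\<partial> h (\<lambda>y. B y k w) x) = \<partial> h (\<lambda>y. snd (B y k w)) x"
        by (rule dir_deriv_linear[OF bounded_linear_snd dB, symmetric])
      also have "\<dots> = \<partial> h (\<lambda>y. t \<bullet> f y k) x" by (simp add: Bs t_def)
      also have "\<dots> = t \<bullet> \<partial> h (\<lambda>y. f y k) x"
        by (rule dir_deriv_eq[OF has_derivative_inner_right[OF has_derivative_dir_deriv[OF smooth_onD(1)[OF f_sm x]]]])
      finally show ?thesis .
    qed
    have 4: "snd (B x k (B x h w)) = t \<bullet> \<Gamma> x h (f x k) - s * P x h (f x k)" for h k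
      by (simp add: Bs Bv[OF x] t_def s_def)
    have G: "snd (\<partial> h (\<lambda>y. B y k w) x + B x k (B x h w)) = snd (\<partial> k (\<lambda>y. B y h w) x + B x h (B x k w))"
      using arg_cong[OF tors_swap[OF x, of h k], of "\<lambda>z. t \<bullet> z"]
      by (simp add: 3 4 sym[OF x, of h k] inner_add_right inner_diff_right)
    show ?thesis using F G by (rule prod_eqI)
  qed
  obtain e u where e: "e > 0" "ball x0 e \<subseteq> S" and u0: "u x0 = (0, 1)" and us: "smooth_on (ball x0 e) u"
    and u: "\<And>x. x \<in> ball x0 e \<Longrightarrow> (u has_derivative (\<lambda>h. B x h (u x))) (at x)"
    by (rule linear_total_differential_equation[where B=B and ?w0.0="(0, 1)", OF S x0 Bbil Bsm flatB],
        assumption, assumption, rule that)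
  define g where "g x = snd (u x)" for x
  define \<tau> where "\<tau> x = fst (u x)" for x
  have gs: "smooth_on (ball x0 e) g" unfolding g_def by (rule smooth_on_snd[OF open_ball us])
  have \<tau>s: "smooth_on (ball x0 e) \<tau>" unfolding \<tau>_def by (rule smooth_on_fst[OF open_ball us])
  have "open (g -` {0<..} \<inter> ball x0 e)"
    using iffD1[OF continuous_on_open_vimage[OF open_ball] smooth_onD(3)[OF gs]] by simp
  moreover have "x0 \<in> g -` {0<..} \<inter> ball x0 e" using e u0 by (simp add: g_def)
  ultimately obtain e' where e': "e' > 0" "ball x0 e' \<subseteq> g -` {0<..} \<inter> ball x0 e" using openE by blast
  have sub: "ball x0 e' \<subseteq> ball x0 e" and pos: "\<And>x. x \<in> ball x0 e' \<Longrightarrow> g x > 0" using e' by auto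
  define r where "r x v = - (\<tau> x \<bullet> v) * inverse (g x)" for x v
  show ?thesis
  proof
    show "e' > 0" "ball x0 e' \<subseteq> S" using e' sub e by auto
    show "linear (r x)" for x
      by (rule linearI) (simp_all add: r_def inner_add_right algebra_simps)
    show "smooth_on (ball x0 e') (\<lambda>x. r x v)" for v
      unfolding r_def using pos
      by (intro smooth_on_mult smooth_on_minus smooth_on_inner smooth_on_inverse smooth_on_const open_ball
          smooth_on_subset[OF gs sub] smooth_on_subset[OF \<tau>s sub]) force
    fix x a v assume x': "x \<in> ball x0 e'"
    then have x: "x \<in> ball x0 e" and xS: "x \<in> S" and gx: "g x \<noteq> 0" using sub e pos by (auto simp: less_imp_neq[symmetric])
    have dg: "(g has_derivative (\<lambda>a. \<tau> x \<bullet> f x a)) (at x)"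
      using has_derivative_snd[OF u[OF x]] by (simp add: g_def[abs_def] Bs \<tau>_def)
    have dt: "((\<lambda>y. \<tau> y \<bullet> v) has_derivative (\<lambda>a. \<tau> x \<bullet> \<Gamma> x a v - g x * P x a v)) (at x)"
      using has_derivative_inner_left[OF has_derivative_fst[OF u[OF x]], of v] by (simp add: g_def \<tau>_def[abs_def] Bv[OF xS])
    have "((\<lambda>y. - (\<tau> y \<bullet> v) * inverse (g y)) has_derivative
        (\<lambda>a. - (\<tau> x \<bullet> v) * - (inverse (g x) * (\<tau> x \<bullet> f x a) * inverse (g x))
           + - (\<tau> x \<bullet> \<Gamma> x a v - g x * P x a v) * inverse (g x))) (at x)"
      by (rule has_derivative_mult[OF has_derivative_minus[OF dt] Deriv.has_derivative_inverse[OF gx dg]])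
    from dir_deriv_eq[OF this, of a]
    have dr: "\<partial> a (\<lambda>y. r y v) x = (\<tau> x \<bullet> v) * (inverse (g x) * (\<tau> x \<bullet> f x a) * inverse (g x))
           - (\<tau> x \<bullet> \<Gamma> x a v) * inverse (g x) + P x a v"
      using gx by (simp add: r_def field_simps)
    show "rho_tensor r x a v = P x a v"
      unfolding rho_tensor_def dr by (simp add: r_def)
  qed
qed

end

section \<open>Coherent tangent bundles\<close>

lemma codazzi_scale:
  assumes P: "\<And>a v. (\<lambda>y. P y a v) differentiable (at x)"
  shows "codazzi \<Gamma> (\<lambda>x a v. k * P x a v) x a b v = k * codazzi \<Gamma> P x a b v"
  unfolding codazzi_def dir_deriv_linear[OF bounded_linear_mult_right P] by (simp add: algebra_simps)

lemma curv_cong: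
  assumes S: "open S" "x \<in> S" and eq: "\<And>y a v. y \<in> S \<Longrightarrow> \<Gamma> y a v = \<Gamma>' y a v"
  shows "curv \<Gamma> x a b v = curv \<Gamma>' x a b v"
proof -
  have "\<partial> a (\<lambda>y. \<Gamma> y b v) x = \<partial> a (\<lambda>y. \<Gamma>' y b v) x" for a b
    by (rule dir_deriv_cong_open[OF S]) (rule eq)
  then show ?thesis unfolding curv_def by (simp add: eq[OF S(2)])
qed

lemma (in coords) curv_linear:
  assumes x: "x \<in> S" shows "linear (curv \<Gamma> x a b)"
proof -
  have b': "bilinear (\<lambda>c v. \<partial> a (\<lambda>y. \<Gamma> y c v) x)" for a
    by (rule bilinear_dir_deriv_family[OF S x bil sm])
  note r = bilinear_radd[OF b'] bilinear_rmul[OF b'] bilinear_radd[OF bil[OF x]] bilinear_rmul[OF bil[OF x]]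
  show ?thesis by (rule linearI) (simp_all add: curv_def r algebra_simps)
qed

locale coherent = vbundle \<A> E \<T>
  for \<A> :: "('a::{t2_space, second_countable_topology}, 'n::finite) chart set"
    and E :: "'a \<Rightarrow> 'e::real_vector set" and \<T> :: "('a, 'e, 'n) triv set" +
  fixes \<phi> :: "'a \<Rightarrow> real ^ 'n \<Rightarrow> 'e"
    and D :: "('a \<Rightarrow> real ^ 'n) \<Rightarrow> ('a \<Rightarrow> 'e) \<Rightarrow> 'a \<Rightarrow> 'e"
  assumes coherent: "coherent_tangent_bundle \<A> E \<T> \<phi> D"
begin

lemma bm: "bundle_map \<A> E \<T> \<phi>" and con: "connection \<A> E \<T> UNIV D" and rtf: "relatively_torsion_free \<A> UNIV \<phi> D"
  using coherent by (auto simp: coherent_tangent_bundle_def)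

lemma phi_in: "\<phi> q w \<in> E q" and phi_linear: "linear (\<phi> q)"
  using bm by (auto simp: bundle_map_def)

text \<open>
  The identities for curvature and covariant derivative are local, so they are considered one point at a time; this
  makes it possible to state them for tensors defined only near \<open>p\<close>.
\<close>

definition gauss_codazzi :: "('a \<Rightarrow> real ^ 'n \<Rightarrow> 'e \<Rightarrow> real) \<Rightarrow> 'a \<Rightarrow> bool" where
  "gauss_codazzi A p \<longleftrightarrow> (\<forall>X\<in>vector_fields \<A> UNIV. \<forall>Y\<in>vector_fields \<A> UNIV. \<forall>\<eta>\<in>sections \<A> E \<T> UNIV.
     curvature \<A> D X Y \<eta> p =
       (1 / (real CARD('n) - 1)) *\<^sub>R (A p (Y p) (\<eta> p) *\<^sub>R \<phi> p (X p) - A p (X p) (\<eta> p) *\<^sub>R \<phi> p (Y p)) \<and>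
     tderiv \<A> (\<lambda>q. A q (Y q) (\<eta> q)) p (X p) - tderiv \<A> (\<lambda>q. A q (X q) (\<eta> q)) p (Y p)
         - A p (lie_bracket \<A> X Y p) (\<eta> p) =
       A p (Y p) (D X \<eta> p) - A p (X p) (D Y \<eta> p))"

end

locale coherent_chart = coherent \<A> E \<T> \<phi> D + bundle_chart \<A> E \<T> V c W \<Phi>
  for \<A> :: "('a::{t2_space, second_countable_topology}, 'n::finite) chart set"
    and E :: "'a \<Rightarrow> 'e::real_vector set" and \<T> :: "('a, 'e, 'n) triv set"
    and \<phi> D V c W \<Phi>
begin

lemma const_extE:
  assumes "const_ext N" "N \<subseteq> U"
  obtains X where "X \<in> vector_fields \<A> UNIV" "X \<in> vector_fields \<A> U" "\<And>x. x \<in> c ` N \<Longrightarrow> vr X x = w"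
  using assms vector_fields_subset[OF _ subset_UNIV] unfolding const_ext_def by metis

lemma const_extE':
  assumes "const_ext N" "N \<subseteq> U"
  obtains \<eta> where "\<eta> \<in> sections \<A> E \<T> UNIV" "\<eta> \<in> sections \<A> E \<T> U" "\<And>x. x \<in> c ` N \<Longrightarrow> sr \<eta> x = v"
  using assms sections_subset[OF _ subset_UNIV] unfolding const_ext_def by metis

lemma curvature_in:
  assumes U: "open U" and con: "connection \<A> E \<T> U D1" and X: "X \<in> vector_fields \<A> U" and Y: "Y \<in> vector_fields \<A> U"
    and \<eta>: "\<eta> \<in> sections \<A> E \<T> U" and q: "q \<in> U"
  shows "curvature \<A> D1 X Y \<eta> q \<in> E q"
proof -
  have s: "D1 X \<eta> \<in> sections \<A> E \<T> U" if "X \<in> vector_fields \<A> U" "\<eta> \<in> sections \<A> E \<T> U" for X \<eta>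
    by (rule connection_section[OF con that])
  show ?thesis
    unfolding curvature_def
    by (rule subspace_diff[OF fibre_subspace subspace_diff[OF fibre_subspace]])
       (rule sectionsD(1)[OF s[OF X s[OF Y \<eta>]] q] sectionsD(1)[OF s[OF Y s[OF X \<eta>]] q]
         sectionsD(1)[OF s[OF lie_bracket_vector_field[OF U X Y] \<eta>] q])+
qed

context
  fixes U N D1 \<Gamma>
  assumes U: "open U" and N: "open N" "N \<subseteq> U \<inter> V \<inter> W" and con1: "connection \<A> E \<T> U D1"
    and rep: "conn_rep U D1 N \<Gamma>"
begin

lemma chart_point: "x \<in> c ` N \<Longrightarrow> \<exists>q. q \<in> N \<and> q \<in> U \<and> q \<in> V \<and> q \<in> W \<and> x = c q \<and> ci x = q"
proof -
  assume "x \<in> c ` N"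
  then obtain q where q: "q \<in> N" "x = c q" by blast
  then have "q \<in> U" "q \<in> V" "q \<in> W" using N by auto
  then show ?thesis using q chart_inv(1)[OF chart] by blast
qed

lemma tors_zero:
  assumes ext: "const_ext N" and rtf1: "relatively_torsion_free \<A> U \<phi> D1" and x: "x \<in> c ` N"
  shows "tors \<Gamma> (pr \<phi>) x a b = 0"
proof -
  have NU: "N \<subseteq> U" using N by auto
  obtain X where X: "X \<in> vector_fields \<A> U" "vr X x = a" using const_extE[OF ext NU] x by metis
  obtain Y where Y: "Y \<in> vector_fields \<A> U" "vr Y x = b" using const_extE[OF ext NU] x by metis
  obtain q where q: "q \<in> N" "q \<in> U" "q \<in> V" "q \<in> W" "x = c q" "ci x = q" using chart_point[OF x] by blast
  have "D1 X (\<lambda>q. \<phi> q (Y q)) q - D1 Y (\<lambda>q. \<phi> q (X q)) q - \<phi> q (lie_bracket \<A> X Y q) = 0"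
    using rtf1 X(1) Y(1) q(2) unfolding relatively_torsion_free_def by blast
  then show ?thesis
    using torsion_rep[OF U N con1 rep bm X(1) Y(1) x] triv_0[OF triv q(4)] by (simp add: sr_def q(6) X Y)
qed

lemma curv_zero_of_flat:
  assumes ext: "const_ext N" and fl: "flat \<A> E \<T> U D1" and x: "x \<in> c ` N"
  shows "curv \<Gamma> x a b v = 0"
proof -
  have NU: "N \<subseteq> U" using N by auto
  obtain X where X: "X \<in> vector_fields \<A> U" "vr X x = a" using const_extE[OF ext NU] x by metis
  obtain Y where Y: "Y \<in> vector_fields \<A> U" "vr Y x = b" using const_extE[OF ext NU] x by metis
  obtain \<eta> where \<eta>: "\<eta> \<in> sections \<A> E \<T> U" "sr \<eta> x = v" using const_extE'[OF ext NU] x by metis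
  obtain q where q: "q \<in> N" "q \<in> U" "q \<in> V" "q \<in> W" "x = c q" "ci x = q" using chart_point[OF x] by blast
  have "curvature \<A> D1 X Y \<eta> q = 0"
    using fl X(1) Y(1) \<eta>(1) q(2) unfolding flat_def by blast
  then show ?thesis
    using curvature_rep[OF U N con1 rep X(1) Y(1) \<eta>(1) x] triv_0[OF triv q(4)] by (simp add: sr_def[of "curvature \<A> D1 X Y \<eta>"] q(6) X Y \<eta>)
qed

end

context
  fixes N \<Gamma>
  assumes N: "open N" "N \<subseteq> V \<inter> W" and rep: "conn_rep UNIV D N \<Gamma>" and ext: "const_ext N"
begin

lemma N_subset: "N \<subseteq> UNIV \<inter> V \<inter> W" "N \<subseteq> V" using N by auto

lemma trace_zero:
  assumes tr: "\<forall>X\<in>vector_fields \<A> UNIV. \<forall>Y\<in>vector_fields \<A> UNIV. \<forall>p.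
           fibre_trace (E p) (curvature_endo \<A> E \<T> D X Y p) = 0" and x: "x \<in> c ` N"
  shows "(\<Sum>i\<in>Basis. curv \<Gamma> x a b i \<bullet> i) = 0"
proof -
  interpret coords "c ` N" \<Gamma> by (rule conn_rep_coords[OF rep N(1) N_subset(2)])
  obtain X where X: "X \<in> vector_fields \<A> UNIV" "vr X x = a" using const_extE[OF ext subset_UNIV] x by metis
  obtain Y where Y: "Y \<in> vector_fields \<A> UNIV" "vr Y x = b" using const_extE[OF ext subset_UNIV] x by metis
  obtain q where q: "q \<in> N" "q \<in> V" "q \<in> W" "x = c q" "ci x = q" using chart_point[OF open_UNIV N(1) N_subset(1) con rep x] by blast
  have "fibre_trace (E q) (curvature_endo \<A> E \<T> D X Y q) = (\<Sum>i\<in>Basis. curv \<Gamma> x a b i \<bullet> i)"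
  proof (rule fibre_trace_eq[OF fibre_subspace triv_fibre_linear[OF triv q(3)] triv_bij[OF triv q(3)] _ curv_linear[OF x]])
    fix e assume e: "e \<in> E q"
    obtain \<eta>0 where \<eta>0: "\<eta>0 \<in> sections \<A> E \<T> UNIV" "sr \<eta>0 x = \<Phi> q e"
      using const_extE'[OF ext subset_UNIV] x by metis
    have "\<Phi> q (\<eta>0 q) = \<Phi> q e" using \<eta>0(2) by (simp add: sr_def q(5))
    then have "\<eta>0 q = e" using triv_inject[OF triv q(3) sectionsD(1)[OF \<eta>0(1)] e] by simp
    define \<eta> where "\<eta> = (SOME \<eta>. \<eta> \<in> sections \<A> E \<T> UNIV \<and> \<eta> q = e)"
    have "\<eta> \<in> sections \<A> E \<T> UNIV \<and> \<eta> q = e"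
      unfolding \<eta>_def by (rule someI[of _ \<eta>0]) (use \<eta>0 \<open>\<eta>0 q = e\<close> in auto)
    then have \<eta>: "\<eta> \<in> sections \<A> E \<T> UNIV" "\<eta> q = e" by auto
    have ce: "curvature_endo \<A> E \<T> D X Y q e = curvature \<A> D X Y \<eta> q"
      by (simp add: curvature_endo_def \<eta>_def)
    have "\<Phi> q (curvature \<A> D X Y \<eta> q) = curv \<Gamma> x a b (\<Phi> q e)"
      using curvature_rep[OF open_UNIV N(1) N_subset(1) con rep X(1) Y(1) \<eta>(1) x] by (simp add: sr_def q(5) X Y \<eta>)
    then show "curvature_endo \<A> E \<T> D X Y q e \<in> E q \<and> \<Phi> q (curvature_endo \<A> E \<T> D X Y q e) = curv \<Gamma> x a b (\<Phi> q e)"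
      unfolding ce using curvature_in[OF open_UNIV con X(1) Y(1) \<eta>(1)] by simp
  qed
  then show ?thesis using tr X(1) Y(1) by simp
qed

text \<open>
  Both identities are tensorial, so they can be tested on constant fields in coordinates.
\<close>

lemma gauss_codazzi_rep:
  assumes P: "tensor_rep N A P" and q: "q \<in> N"
  shows "gauss_codazzi A q \<longleftrightarrow> (\<forall>a b v.
     curv \<Gamma> (c q) a b v = (1 / (real CARD('n) - 1)) *\<^sub>R (P (c q) b v *\<^sub>R pr \<phi> (c q) a - P (c q) a v *\<^sub>R pr \<phi> (c q) b) \<and>
     codazzi \<Gamma> P (c q) a b v = 0)" (is "_ \<longleftrightarrow> (\<forall>a b v. ?K a b v \<and> ?C a b v)")
proof -
  have x: "c q \<in> c ` N" using q by blast
  have qV: "q \<in> V" "q \<in> W" using q N by auto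
  have eq: "(curvature \<A> D X Y \<eta> q =
       (1 / (real CARD('n) - 1)) *\<^sub>R (A q (Y q) (\<eta> q) *\<^sub>R \<phi> q (X q) - A q (X q) (\<eta> q) *\<^sub>R \<phi> q (Y q)) \<and>
     tderiv \<A> (\<lambda>q. A q (Y q) (\<eta> q)) q (X q) - tderiv \<A> (\<lambda>q. A q (X q) (\<eta> q)) q (Y q)
         - A q (lie_bracket \<A> X Y q) (\<eta> q) =
       A q (Y q) (D X \<eta> q) - A q (X q) (D Y \<eta> q)) \<longleftrightarrow>
     ?K (vr X (c q)) (vr Y (c q)) (sr \<eta> (c q)) \<and> ?C (vr X (c q)) (vr Y (c q)) (sr \<eta> (c q))"
    if X: "X \<in> vector_fields \<A> UNIV" and Y: "Y \<in> vector_fields \<A> UNIV" and \<eta>: "\<eta> \<in> sections \<A> E \<T> UNIV" for X Y \<eta>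
  proof -
    have \<eta>q: "\<eta> q \<in> E q" by (rule sectionsD(1)[OF \<eta>]) simp
    have Aq: "A q (X q) (\<eta> q) = P (c q) (vr X (c q)) (sr \<eta> (c q))" for X
      by (simp add: tensor_repD(3)[OF P q \<eta>q] vrep_at[OF chart qV(1)] sr_at[OF qV(1)])
    have pq: "\<Phi> q (\<phi> q (X q)) = pr \<phi> (c q) (vr X (c q))" for X
      by (simp add: pr_at[OF bm N(2) q] vrep_at[OF chart qV(1)])
    let ?R = "(1 / (real CARD('n) - 1)) *\<^sub>R (A q (Y q) (\<eta> q) *\<^sub>R \<phi> q (X q) - A q (X q) (\<eta> q) *\<^sub>R \<phi> q (Y q))"
    have RE: "?R \<in> E q"
      by (intro subspace_scale[OF fibre_subspace] subspace_diff[OF fibre_subspace] phi_in)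
    have "\<Phi> q ?R = (1 / (real CARD('n) - 1)) *\<^sub>R (P (c q) (vr Y (c q)) (sr \<eta> (c q)) *\<^sub>R pr \<phi> (c q) (vr X (c q))
       - P (c q) (vr X (c q)) (sr \<eta> (c q)) *\<^sub>R pr \<phi> (c q) (vr Y (c q)))"
      by (simp add: triv_scale[OF triv qV(2)] triv_diff[OF triv qV(2)] subspace_scale[OF fibre_subspace]
          subspace_diff[OF fibre_subspace] phi_in Aq pq)
    moreover have "\<Phi> q (curvature \<A> D X Y \<eta> q) = curv \<Gamma> (c q) (vr X (c q)) (vr Y (c q)) (sr \<eta> (c q))"
      using curvature_rep[OF open_UNIV N(1) N_subset(1) con rep X Y \<eta> x] by (simp add: sr_at[OF qV(1)])
    ultimately have "curvature \<A> D X Y \<eta> q = ?R \<longleftrightarrow> ?K (vr X (c q)) (vr Y (c q)) (sr \<eta> (c q))"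
      using triv_inject[OF triv qV(2) curvature_in[OF open_UNIV con X Y \<eta>] RE] by auto
    then show ?thesis
      using codazzi_rep[OF open_UNIV N(1) N_subset(1) con rep P X Y \<eta> q] by auto
  qed
  show ?thesis
  proof
    assume g: "gauss_codazzi A q"
    show "\<forall>a b v. ?K a b v \<and> ?C a b v"
    proof (intro allI)
      fix a b v
      obtain X where X: "X \<in> vector_fields \<A> UNIV" "vr X (c q) = a" using const_extE[OF ext subset_UNIV] x by metis
      obtain Y where Y: "Y \<in> vector_fields \<A> UNIV" "vr Y (c q) = b" using const_extE[OF ext subset_UNIV] x by metis
      obtain \<eta> where \<eta>: "\<eta> \<in> sections \<A> E \<T> UNIV" "sr \<eta> (c q) = v" using const_extE'[OF ext subset_UNIV] x by metis
      show "?K a b v \<and> ?C a b v"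
        using g[unfolded gauss_codazzi_def, rule_format, OF X(1) Y(1) \<eta>(1)] unfolding eq[OF X(1) Y(1) \<eta>(1)] X(2) Y(2) \<eta>(2) .
    qed
  next
    assume "\<forall>a b v. ?K a b v \<and> ?C a b v"
    then show "gauss_codazzi A q" unfolding gauss_codazzi_def using eq by blast
  qed
qed

end

end

section \<open>Projective flatness and the curvature identities\<close>

lemma bilinear_mult_left:
  fixes f :: "'x::real_vector \<Rightarrow> 'y::real_vector \<Rightarrow> real"
  assumes "bilinear f"
  shows "bilinear (\<lambda>a v. k * f a v)"
  unfolding bilinear_def
  by (auto intro!: linearI simp: bilinear_ladd[OF assms] bilinear_radd[OF assms] bilinear_lmul[OF assms]
      bilinear_rmul[OF assms] algebra_simps)

context coherent_chart
begin

text \<open>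
  The coordinate data of a flat projective change define actual connections over \<open>N\<close>: the restriction of
  \<open>D\<close>, which has the coefficients \<open>\<Gamma>\<close>, and its projective change.
\<close>

lemma conn_of_flat_change:
  assumes N: "open N" "N \<subseteq> V \<inter> W" and rep: "conn_rep UNIV D N \<Gamma>"
    and tors: "\<And>x a b. x \<in> c ` N \<Longrightarrow> tors \<Gamma> (pr \<phi>) x a b = 0"
    and r: "\<And>x. x \<in> c ` N \<Longrightarrow> linear (r x)" "\<And>v. smooth_on (c ` N) (\<lambda>x. r x v)"
    and flat0: "\<And>x a b v. x \<in> c ` N \<Longrightarrow> curv (projective_coords.proj_change \<Gamma> (pr \<phi>) r) x a b v = 0"
  shows "\<exists>D\<^sub>U D'. restricts_to \<A> E \<T> N D D\<^sub>U \<and> projectively_equivalent \<A> E \<T> \<phi> N D\<^sub>U D' \<and> flat \<A> E \<T> N D'"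
proof -
  have NV: "N \<subseteq> V" "N \<subseteq> N \<inter> V \<inter> W" using N by auto
  interpret projective_coords "c ` N" \<Gamma> "pr \<phi>"
    unfolding projective_coords_def projective_coords_axioms_def
    using conn_rep_coords[OF rep N(1) NV(1)] pr_linear[OF bm N(2)] pr_smooth[OF bm N(2)] tors by blast
  define \<Gamma>' where "\<Gamma>' = proj_change r"
  have bil': "\<And>x. x \<in> c ` N \<Longrightarrow> bilinear (\<Gamma>' x)" and sm': "\<And>a v. smooth_on (c ` N) (\<lambda>x. \<Gamma>' x a v)"
    unfolding \<Gamma>'_def by (rule proj_change_bilinear[OF r], assumption+) (rule proj_change_smooth[OF r], assumption)
  note con0 = conn_of_connection[OF N bil sm] and con1 = conn_of_connection[OF N bil' sm']
  let ?D0 = "conn_of \<Gamma>" and ?D1 = "conn_of \<Gamma>'"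
  have at: "q \<in> V" "q \<in> W" "c q \<in> c ` N" "ci (c q) = q" if "q \<in> N" for q
    using that N chart_inv(1)[OF chart] by auto
  have "restricts_to \<A> E \<T> N D ?D0"
    unfolding restricts_to_def
  proof (intro conjI ballI con0(1))
    fix X \<eta> q assume X: "X \<in> vector_fields \<A> UNIV" and \<eta>: "\<eta> \<in> sections \<A> E \<T> UNIV" and q: "q \<in> N"
    have "D X \<eta> q \<in> E q" using sectionsD(1)[OF connection_section[OF con X \<eta>]] by simp
    from frame_triv[OF triv at(2)[OF q] this] show "?D0 X \<eta> q = D X \<eta> q"
      using conn_repD(3)[OF rep X \<eta> at(3)[OF q]] by (simp add: conn_of_def sr_at[OF at(1)[OF q]])
  qed
  moreover have rtf_of: "relatively_torsion_free \<A> N \<phi> D2"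
    if con2: "connection \<A> E \<T> N D2" and rep2: "conn_rep N D2 N \<Gamma>2"
      and t2: "\<And>x a b. x \<in> c ` N \<Longrightarrow> tors \<Gamma>2 (pr \<phi>) x a b = 0" for D2 \<Gamma>2
    unfolding relatively_torsion_free_def
  proof (intro ballI)
    fix X Y q assume X: "X \<in> vector_fields \<A> N" and Y: "Y \<in> vector_fields \<A> N" and q: "q \<in> N"
    let ?T = "D2 X (\<lambda>q. \<phi> q (Y q)) q - D2 Y (\<lambda>q. \<phi> q (X q)) q - \<phi> q (lie_bracket \<A> X Y q)"
    have sec: "D2 X (\<lambda>q. \<phi> q (Y q)) q \<in> E q" if "X \<in> vector_fields \<A> N" "Y \<in> vector_fields \<A> N" for X Y
      by (rule sectionsD(1)[OF connection_section[OF con2 that(1) bundle_map_section[OF bm N(1) that(2)]] q])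
    have TE: "?T \<in> E q"
      by (intro subspace_diff[OF fibre_subspace] sec X Y phi_in)
    have "\<Phi> q ?T = 0"
      using torsion_rep[OF N(1) N(1) NV(2) con2 rep2 bm X Y at(3)[OF q]] t2[OF at(3)[OF q]]
      by (simp add: sr_at[OF at(1)[OF q]])
    then show "?T = 0"
      using triv_inject[OF triv at(2)[OF q] TE subspace_0[OF fibre_subspace]] triv_0[OF triv at(2)[OF q]] by simp
  qed
  have rtf0: "relatively_torsion_free \<A> N \<phi> ?D0" by (rule rtf_of[OF con0 tors])
  have rtf1: "relatively_torsion_free \<A> N \<phi> ?D1"
  proof (rule rtf_of[OF con1])
    fix x a b assume x: "x \<in> c ` N"
    show "tors \<Gamma>' (pr \<phi>) x a b = 0"
      unfolding \<Gamma>'_def by (rule proj_change_tors[OF _ _ x]) (fact r)+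
  qed
  define \<rho> where "\<rho> q e = r (c q) (\<Phi> q e)" for q e
  have \<rho>: "\<rho> \<in> dual_sections \<A> E \<T> N"
    unfolding \<rho>_def[abs_def] by (rule dual_sectionsI[OF N r])
  have "projectively_equivalent \<A> E \<T> \<phi> N ?D0 ?D1"
    unfolding projectively_equivalent_def
  proof (intro conjI con0(1) con1(1) rtf0 rtf1 bexI[OF _ \<rho>] ballI)
    fix X \<eta> q assume X: "X \<in> vector_fields \<A> N" and \<eta>: "\<eta> \<in> sections \<A> E \<T> N" and q: "q \<in> N"
    note at = at[OF q]
    have \<eta>q: "\<eta> q \<in> E q" by (rule sectionsD(1)[OF \<eta> q])
    have p: "\<Phi> q (\<phi> q (X q)) = pr \<phi> (c q) (vr X (c q))"
      by (simp add: pr_at[OF bm N(2) q] vrep_at[OF chart at(1)])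
    have s: "\<Phi> q (\<eta> q) = sr \<eta> (c q)" by (simp add: sr_at[OF at(1)])
    have "cov \<Gamma>' (vr X) (sr \<eta>) (c q) = cov \<Gamma> (vr X) (sr \<eta>) (c q)
        + \<rho> q (\<phi> q (X q)) *\<^sub>R \<Phi> q (\<eta> q) + \<rho> q (\<eta> q) *\<^sub>R \<Phi> q (\<phi> q (X q))"
      unfolding cov_def \<Gamma>'_def proj_change_def \<rho>_def p s by simp
    then show "?D1 X \<eta> q = ?D0 X \<eta> q + \<rho> q (\<phi> q (X q)) *\<^sub>R \<eta> q + \<rho> q (\<eta> q) *\<^sub>R \<phi> q (X q)"
      by (simp add: conn_of_def linear_add[OF frame_linear[OF triv at(2)]] linear_scale[OF frame_linear[OF triv at(2)]]
          frame_triv[OF triv at(2)] \<eta>q phi_in)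
  qed
  moreover have "flat \<A> E \<T> N ?D1"
    unfolding flat_def
  proof (intro ballI)
    fix X Y \<eta> q assume X: "X \<in> vector_fields \<A> N" and Y: "Y \<in> vector_fields \<A> N"
      and \<eta>: "\<eta> \<in> sections \<A> E \<T> N" and q: "q \<in> N"
    have "\<Phi> q (curvature \<A> ?D1 X Y \<eta> q) = 0"
      using curvature_rep[OF N(1) N(1) NV(2) con1 X Y \<eta> at(3)[OF q]] flat0[OF at(3)[OF q]]
      by (simp add: sr_at[OF at(1)[OF q]] \<Gamma>'_def)
    then show "curvature \<A> ?D1 X Y \<eta> q = 0"
      using triv_inject[OF triv at(2)[OF q] curvature_in[OF N(1) con1(1) X Y \<eta> q] subspace_0[OF fibre_subspace]]
        triv_0[OF triv at(2)[OF q]] by simp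
  qed
  ultimately show ?thesis by blast
qed

end

context coherent
begin

lemma coherent_chartI: "(V, c) \<in> \<A> \<Longrightarrow> (W, \<Phi>) \<in> \<T> \<Longrightarrow> coherent_chart \<A> E \<T> \<phi> D V c W \<Phi>"
  by unfold_locales

abbreviation trace_free :: bool where
  "trace_free \<equiv> \<forall>X\<in>vector_fields \<A> UNIV. \<forall>Y\<in>vector_fields \<A> UNIV. \<forall>p.
           fibre_trace (E p) (curvature_endo \<A> E \<T> D X Y p) = 0"

text \<open>
  Near a point, \<open>P = A / (n - 1)\<close> in coordinates satisfies the hypotheses of \<open>rho_exists\<close>, where the symmetry comes from
  the trace of the curvature identity. By \<open>curv_proj_change\<close> the resulting change is flat.
\<close>

lemma projectively_flat_if_gauss_codazzi:
  assumes tr: trace_free and A: "A \<in> cotangent_dual_sections \<A> E \<T> UNIV" and GC: "\<And>p. gauss_codazzi A p"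
  shows "projectively_flat \<A> E \<T> \<phi> D"
  unfolding projectively_flat_def
proof
  fix p
  obtain V c where V: "(V, c) \<in> \<A>" "p \<in> V" by (rule chart_ex)
  obtain W \<Phi> where W: "(W, \<Phi>) \<in> \<T>" "p \<in> W" by (rule triv_ex)
  interpret coherent_chart \<A> E \<T> \<phi> D V c W \<Phi> by (rule coherent_chartI[OF V(1) W(1)])
  have o: "open (V \<inter> W)" using chart_open(1)[OF chart] triv_open[OF triv] by auto
  obtain N where N: "open N" "p \<in> N" "N \<subseteq> V \<inter> W" "const_ext N"
    and ex: "\<And>U D. open U \<Longrightarrow> V \<inter> W \<subseteq> U \<Longrightarrow> connection \<A> E \<T> U D \<Longrightarrow> \<exists>\<Gamma>. conn_rep U D N \<Gamma>"
    by (rule local_rep[OF o _ order_refl, of p]) (use V W in auto)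
  obtain \<Gamma> where \<Gamma>: "conn_rep UNIV D N \<Gamma>" using ex[OF open_UNIV subset_UNIV con] by blast
  have N': "N \<subseteq> UNIV \<inter> V \<inter> W" "N \<subseteq> V" using N by auto
  obtain P0 where P0: "tensor_rep N A P0" using tensor_rep_ex[OF A N(3)] by blast
  interpret projective_coords "c ` N" \<Gamma> "pr \<phi>"
    unfolding projective_coords_def projective_coords_axioms_def
    using conn_rep_coords[OF \<Gamma> N(1) N'(2)] pr_linear[OF bm N(3)] pr_smooth[OF bm N(3)]
      tors_zero[OF open_UNIV N(1) N'(1) con \<Gamma> N(4) rtf] by blast
  define k where "k = 1 / (real CARD('n) - 1)"
  define P where "P x a v = k * P0 x a v" for x a v
  have gc: "curv \<Gamma> x a b v = k *\<^sub>R (P0 x b v *\<^sub>R pr \<phi> x a - P0 x a v *\<^sub>R pr \<phi> x b)" "codazzi \<Gamma> P0 x a b v = 0"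
    if "x \<in> c ` N" for x a b v
    using that GC gauss_codazzi_rep[OF N(1,3) \<Gamma> N(4) P0] unfolding k_def by auto
  have bilP: "bilinear (P x)" if "x \<in> c ` N" for x
    using bilinear_mult_left[OF tensor_repD(1)[OF P0 that]] by (simp add: P_def[abs_def])
  have smP: "smooth_on (c ` N) (\<lambda>x. P x a v)" for a v
    unfolding P_def by (intro smooth_on_mult smooth_on_const S tensor_repD(2)[OF P0])
  have K: "curv \<Gamma> x a b v = P x b v *\<^sub>R pr \<phi> x a - P x a v *\<^sub>R pr \<phi> x b" if "x \<in> c ` N" for x a b v
    using gc(1)[OF that] by (simp add: P_def scaleR_diff_right)
  have C: "codazzi \<Gamma> P x a b v = 0" if "x \<in> c ` N" for x a b v
    unfolding P_def[abs_def] codazzi_scale[OF smooth_onD(1)[OF tensor_repD(2)[OF P0] that]] gc(2)[OF that] by simp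
  have sym: "P x a (pr \<phi> x b) = P x b (pr \<phi> x a)" if x: "x \<in> c ` N" for x a b
  proof -
    have l: "linear (P x a)" for a using bilP[OF x] by (simp add: bilinear_def)
    have "(\<Sum>i\<in>Basis. curv \<Gamma> x a b i \<bullet> i) = P x b (pr \<phi> x a) - P x a (pr \<phi> x b)"
      unfolding K[OF x] inner_diff_left sum_subtractf trace_rank_one[OF l] ..
    then show ?thesis using trace_zero[OF N(1,3) \<Gamma> N(4) tr x, of a b] by simp
  qed
  have cp: "c p \<in> c ` N" using N by auto
  obtain r e where e: "e > 0" "ball (c p) e \<subseteq> c ` N" and r: "\<And>x. linear (r x)" "\<And>v. smooth_on (ball (c p) e) (\<lambda>x. r x v)"
    and rP: "\<And>x a v. x \<in> ball (c p) e \<Longrightarrow> rho_tensor r x a v = P x a v"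
    by (rule rho_exists[where P=P, OF bilP smP sym K C cp], assumption, assumption, assumption, assumption, rule that)
  define N1 where "N1 = {q \<in> V. c q \<in> ball (c p) e}"
  have N1: "open N1" "p \<in> N1" "c ` N1 \<subseteq> ball (c p) e"
    using chart_preimage_open[OF chart open_ball] V e by (auto simp: N1_def)
  have N1N: "N1 \<subseteq> N"
  proof
    fix q assume q: "q \<in> N1"
    then obtain q' where "q' \<in> N" "c q = c q'" using e(2) unfolding N1_def by blast
    then show "q \<in> N" using q chart_inv(1)[OF chart] N'(2) unfolding N1_def by (metis (mono_tags, lifting) mem_Collect_eq subsetD)
  qed
  then have N1W: "N1 \<subseteq> V \<inter> W" using N by auto
  have inN: "x \<in> ball (c p) e" "x \<in> c ` N" if "x \<in> c ` N1" for x using that N1 N1N by auto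
  have "\<exists>D\<^sub>U D'. restricts_to \<A> E \<T> N1 D D\<^sub>U \<and> projectively_equivalent \<A> E \<T> \<phi> N1 D\<^sub>U D' \<and> flat \<A> E \<T> N1 D'"
  proof (rule conn_of_flat_change[OF N1(1) N1W conn_rep_mono[OF \<Gamma> N1N]])
    show "tors \<Gamma> (pr \<phi>) x a b = 0" if "x \<in> c ` N1" for x a b using tors0[OF inN(2)[OF that]] .
    show "linear (r x)" for x by (rule r)
    show r': "smooth_on (c ` N1) (\<lambda>x. r x v)" for v by (rule smooth_on_subset[OF r(2) N1(3)])
    fix x a b v assume x: "x \<in> c ` N1"
    interpret p1: projective_coords "c ` N1" \<Gamma> "pr \<phi>"
    proof (intro projective_coords.intro projective_coords_axioms.intro)
      show "coords (c ` N1) \<Gamma>" by (rule conn_rep_coords[OF conn_rep_mono[OF \<Gamma> N1N] N1(1)]) (use N1W in auto)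
    qed (rule pr_linear[OF bm N1W] pr_smooth[OF bm N1W] tors0[OF inN(2)], assumption?)+
    show "curv (proj_change r) x a b v = 0"
      unfolding p1.curv_proj_change[OF r(1) r' x] rP[OF inN(1)[OF x]] K[OF inN(2)[OF x]] sym[OF inN(2)[OF x], of a b] by simp
  qed
  then show "\<exists>U. open U \<and> p \<in> U \<and> (\<exists>D\<^sub>U D'. restricts_to \<A> E \<T> U D D\<^sub>U \<and>
           projectively_equivalent \<A> E \<T> \<phi> U D\<^sub>U D' \<and> flat \<A> E \<T> U D')"
    using N1 by blast
qed

definition local_tensor :: "'a set \<Rightarrow> ('a \<Rightarrow> real ^ 'n \<Rightarrow> 'e \<Rightarrow> real) \<Rightarrow> bool" where
  "local_tensor N A \<longleftrightarrow> open N \<and> (\<exists>V c W \<Phi> P. (V, c) \<in> \<A> \<and> (W, \<Phi>) \<in> \<T> \<and> N \<subseteq> V \<inter> W \<and>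
     bundle_chart.tensor_rep \<A> E c \<Phi> N A P)"

text \<open>
  The local tensor is \<open>(n - 1)\<close> times \<open>rho_tensor\<close>. The given connections act on fields over \<open>U\<close>; evaluating
  them on constant fields identifies the coefficients of the flat connection with the projective change of those of
  \<open>D\<close>.
\<close>

lemma local_tensor_if_projectively_flat:
  assumes tr: trace_free and card: "CARD('n) \<ge> 2" and pf: "projectively_flat \<A> E \<T> \<phi> D"
  shows "\<exists>N A. local_tensor N A \<and> p \<in> N \<and> (\<forall>q\<in>N. gauss_codazzi A q)"
proof -
  obtain U D0 D1 where U: "open U" "p \<in> U" and res: "restricts_to \<A> E \<T> U D D0"
    and pe: "projectively_equivalent \<A> E \<T> \<phi> U D0 D1" and fl: "flat \<A> E \<T> U D1"
    using pf unfolding projectively_flat_def by blast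
  obtain \<rho> where \<rho>: "\<rho> \<in> dual_sections \<A> E \<T> U"
    and D1: "\<And>X \<eta> q. X \<in> vector_fields \<A> U \<Longrightarrow> \<eta> \<in> sections \<A> E \<T> U \<Longrightarrow> q \<in> U \<Longrightarrow>
       D1 X \<eta> q = D0 X \<eta> q + \<rho> q (\<phi> q (X q)) *\<^sub>R \<eta> q + \<rho> q (\<eta> q) *\<^sub>R \<phi> q (X q)"
    using pe unfolding projectively_equivalent_def by blast
  have con1: "connection \<A> E \<T> U D1" using pe unfolding projectively_equivalent_def by blast
  obtain V c where V: "(V, c) \<in> \<A>" "p \<in> V" by (rule chart_ex)
  obtain W \<Phi> where W: "(W, \<Phi>) \<in> \<T>" "p \<in> W" by (rule triv_ex)
  interpret coherent_chart \<A> E \<T> \<phi> D V c W \<Phi> by (rule coherent_chartI[OF V(1) W(1)])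
  let ?M = "U \<inter> V \<inter> W"
  have M: "open ?M" "p \<in> ?M" "?M \<subseteq> V \<inter> W" "?M \<subseteq> U"
    using chart_open(1)[OF chart] triv_open[OF triv] U V W by auto
  obtain N where N: "open N" "p \<in> N" "N \<subseteq> ?M" "const_ext N"
    and ex: "\<And>U D. open U \<Longrightarrow> ?M \<subseteq> U \<Longrightarrow> connection \<A> E \<T> U D \<Longrightarrow> \<exists>\<Gamma>. conn_rep U D N \<Gamma>"
    by (rule local_rep[OF M(1-3)]) (rule that)
  obtain \<Gamma> where \<Gamma>: "conn_rep UNIV D N \<Gamma>" using ex[OF open_UNIV subset_UNIV con] by blast
  obtain \<Gamma>1 where \<Gamma>1: "conn_rep U D1 N \<Gamma>1" using ex[OF U(1) M(4) con1] by blast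
  have N': "N \<subseteq> UNIV \<inter> V \<inter> W" "N \<subseteq> V" "N \<subseteq> V \<inter> W" "N \<subseteq> U" using N by auto
  interpret projective_coords "c ` N" \<Gamma> "pr \<phi>"
    unfolding projective_coords_def projective_coords_axioms_def
    using conn_rep_coords[OF \<Gamma> N(1) N'(2)] pr_linear[OF bm N'(3)] pr_smooth[OF bm N'(3)]
      tors_zero[OF open_UNIV N(1) N'(1) con \<Gamma> N(4) rtf] by blast
  define r where "r x v = \<rho> (ci x) (frame E \<Phi> v (ci x))" for x v
  have at: "\<exists>q. q \<in> N \<and> q \<in> U \<and> q \<in> V \<and> q \<in> W \<and> x = c q \<and> ci x = q" if "x \<in> c ` N" for x
    using chart_point[OF open_UNIV N(1) N'(1) con \<Gamma> that] N'(4) by blast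
  have \<rho>l: "\<rho> q (x + y) = \<rho> q x + \<rho> q y" "\<rho> q (k *\<^sub>R x) = k *\<^sub>R \<rho> q x" if "q \<in> U" "x \<in> E q" "y \<in> E q" for q x y k
  proof -
    have "fibre_linear (E q) (\<rho> q)" using \<rho> that(1) unfolding dual_sections_def by auto
    then show "\<rho> q (x + y) = \<rho> q x + \<rho> q y" "\<rho> q (k *\<^sub>R x) = k *\<^sub>R \<rho> q x"
      using that(2,3) unfolding fibre_linear_def by blast+
  qed
  have r_lin: "linear (r x)" if x: "x \<in> c ` N" for x
  proof -
    obtain q where q: "q \<in> U" "q \<in> W" "ci x = q" using at[OF x] by blast
    note fl = frame_linear[OF triv q(2)] and fE = frame_in[OF triv q(2)]
    show ?thesis unfolding r_def q(3)
      by (rule linearI) (simp_all add: linear_add[OF fl] linear_scale[OF fl] \<rho>l(1)[OF q(1) fE fE] \<rho>l(2)[OF q(1) fE fE])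
  qed
  have r_sm: "smooth_on (c ` N) (\<lambda>x. r x v)" for v
  proof -
    have "\<forall>(V, \<Phi>)\<in>\<T>. \<forall>v. smooth_map \<A> (U \<inter> V) (\<lambda>p. \<rho> p (frame E \<Phi> v p))"
      using \<rho> by (simp add: dual_sections_def)
    from bspec[OF this triv] have "smooth_map \<A> (U \<inter> W) (\<lambda>p. \<rho> p (frame E \<Phi> v p))" by simp
    from smooth_mapD'[OF this chart, of N] N(3) show ?thesis unfolding r_def by blast
  qed
  have \<Gamma>1_eq: "\<Gamma>1 x a v = proj_change r x a v" if x: "x \<in> c ` N" for x a v
  proof -
    obtain q where q: "q \<in> N" "q \<in> U" "q \<in> V" "q \<in> W" "x = c q" "ci x = q" using at[OF x] by blast
    obtain X where X: "X \<in> vector_fields \<A> UNIV" "X \<in> vector_fields \<A> U" "\<And>x. x \<in> c ` N \<Longrightarrow> vr X x = a"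
      by (rule const_extE[where w=a, OF N(4) N'(4)]) (rule that)
    obtain \<eta> where \<eta>: "\<eta> \<in> sections \<A> E \<T> UNIV" "\<eta> \<in> sections \<A> E \<T> U" "\<And>x. x \<in> c ` N \<Longrightarrow> sr \<eta> x = v"
      by (rule const_extE'[where v=v, OF N(4) N'(4)]) (rule that)
    have "\<partial> a (sr \<eta>) x = \<partial> a (\<lambda>y. v) x" by (rule dir_deriv_cong_open[OF S x]) (rule \<eta>(3))
    then have d0: "\<partial> a (sr \<eta>) x = 0" by simp
    have \<eta>q: "\<eta> q \<in> E q" "D X \<eta> q \<in> E q"
      using sectionsD(1)[OF \<eta>(1)] sectionsD(1)[OF connection_section[OF con X(1) \<eta>(1)]] by auto
    have "D0 X \<eta> q = D X \<eta> q" using res X(1) \<eta>(1) q(2) unfolding restricts_to_def by blast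
    then have e: "D1 X \<eta> q = D X \<eta> q + \<rho> q (\<phi> q (X q)) *\<^sub>R \<eta> q + \<rho> q (\<eta> q) *\<^sub>R \<phi> q (X q)"
      using D1[OF X(2) \<eta>(2) q(2)] by simp
    have "\<Gamma>1 x a v = sr (D1 X \<eta>) x"
      using conn_repD(3)[OF \<Gamma>1 X(2) \<eta>(2) x] by (simp add: cov_def X(3)[OF x] \<eta>(3)[OF x] d0)
    also have "\<dots> = \<Phi> q (D X \<eta> q) + \<rho> q (\<phi> q (X q)) *\<^sub>R \<Phi> q (\<eta> q) + \<rho> q (\<eta> q) *\<^sub>R \<Phi> q (\<phi> q (X q))"
      by (simp add: sr_def q(6) e triv_add[OF triv q(4)] triv_scale[OF triv q(4)] \<eta>q phi_in
          subspace_add[OF fibre_subspace] subspace_scale[OF fibre_subspace])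
    also have "\<Phi> q (D X \<eta> q) = \<Gamma> x a v"
      using conn_repD(3)[OF \<Gamma> X(1) \<eta>(1) x] by (simp add: sr_def[of "D X \<eta>"] q(6) cov_def X(3)[OF x] \<eta>(3)[OF x] d0)
    also have "\<Phi> q (\<eta> q) = v" using \<eta>(3)[OF x] by (simp add: sr_def q(6))
    also have "\<Phi> q (\<phi> q (X q)) = pr \<phi> x a"
      using pr_at[OF bm N'(3) q(1)] X(3)[OF x] by (simp add: q(5) vrep_at[OF chart q(3)])
    also have "\<rho> q (\<eta> q) = r x v"
      using \<eta>(3)[OF x] frame_triv[OF triv q(4) \<eta>q(1)] by (simp add: r_def sr_def q(6))
    also have "\<rho> q (\<phi> q (X q)) = r x (pr \<phi> x a)"
      using pr_at[OF bm N'(3) q(1)] X(3)[OF x] frame_triv[OF triv q(4) phi_in[of q "X q"]]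
      by (simp add: r_def q(6)) (simp add: q(5) vrep_at[OF chart q(3)])
    finally show ?thesis by (simp add: proj_change_def)
  qed
  have flat1: "curv (proj_change r) x a b v = 0" if x: "x \<in> c ` N" for x a b v
    using curv_cong[OF S x, of \<Gamma>1 "proj_change r"] \<Gamma>1_eq
      curv_zero_of_flat[OF U(1) N(1,3) con1 \<Gamma>1 N(4) fl x] by simp
  define P where "P = rho_tensor r"
  have sym: "P x a (pr \<phi> x b) = P x b (pr \<phi> x a)" if x: "x \<in> c ` N" for x a b
    unfolding P_def by (rule rho_tensor_symmetric[OF r_lin r_sm x flat1[OF x] trace_zero[OF N(1) N'(3) \<Gamma> N(4) tr x]])
  have K: "curv \<Gamma> x a b v = P x b v *\<^sub>R pr \<phi> x a - P x a v *\<^sub>R pr \<phi> x b" if x: "x \<in> c ` N" for x a b v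
    using curv_proj_change[OF r_lin r_sm x, of a b v] flat1[OF x, of a b v] sym[OF x, of a b]
    by (simp add: P_def algebra_simps)
  have C: "codazzi \<Gamma> P x a b v = 0" if x: "x \<in> c ` N" for x a b v
    unfolding P_def by (rule codazzi_rho_tensor[OF r_lin r_sm x sym[OF x, unfolded P_def] K[OF x, unfolded P_def]])
  define k where "k = real CARD('n) - 1"
  have k: "k \<noteq> 0" using card by (simp add: k_def)
  define Q where "Q x a v = k * P x a v" for x a v
  define A where "A q w e = Q (c q) (tderiv \<A> c q w) (\<Phi> q e)" for q w e
  have rep: "tensor_rep N A Q"
    unfolding tensor_rep_def
  proof (intro conjI ballI allI)
    show "bilinear (Q x)" if x: "x \<in> c ` N" for x
    proof -
      have "bilinear (rho_tensor r x)"
        using rho_tensor_linear[OF r_lin r_sm x] rho_tensor_linear1[OF r_lin r_sm x] by (simp add: bilinear_def)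
      from bilinear_mult_left[OF this] show ?thesis by (simp add: Q_def[abs_def] P_def)
    qed
    show "smooth_on (c ` N) (\<lambda>x. Q x a v)" for a v
      unfolding Q_def P_def by (intro smooth_on_mult smooth_on_const S rho_tensor_smooth[OF r_lin r_sm])
  qed (simp add: A_def)
  have "gauss_codazzi A q" if q: "q \<in> N" for q
  proof -
    have x: "c q \<in> c ` N" using q by blast
    have "codazzi \<Gamma> Q (c q) a b v = 0" for a b v
      unfolding Q_def[abs_def]
      by (subst codazzi_scale) (use smooth_onD(1)[OF rho_tensor_smooth[OF r_lin r_sm] x] C[OF x] in \<open>auto simp: P_def\<close>)
    then show ?thesis
      unfolding gauss_codazzi_rep[OF N(1) N'(3) \<Gamma> N(4) rep q] k_def[symmetric]
      using k by (simp add: K[OF x] Q_def scaleR_diff_right)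
  qed
  moreover have "local_tensor N A"
    unfolding local_tensor_def using N(1) chart triv N'(3) rep by blast
  ultimately show ?thesis using N(2) by blast
qed

subsection \<open>Gluing\<close>

lemma vector_field_through: "\<exists>X\<in>vector_fields \<A> UNIV. X q = w"
  and section_through: "e \<in> E q \<Longrightarrow> \<exists>\<eta>\<in>sections \<A> E \<T> UNIV. \<eta> q = e"
proof -
  obtain V c where V: "(V, c) \<in> \<A>" "q \<in> V" by (rule chart_ex)
  obtain W \<Phi> where W: "(W, \<Phi>) \<in> \<T>" "q \<in> W" by (rule triv_ex)
  interpret coherent_chart \<A> E \<T> \<phi> D V c W \<Phi> by (rule coherent_chartI[OF V(1) W(1)])
  have o: "open (V \<inter> W)" "q \<in> V \<inter> W" using chart_open(1)[OF chart] triv_open[OF triv] V W by auto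
  obtain N where N: "q \<in> N" "const_ext N" by (rule local_rep[OF o order_refl]) (rule that)
  have x: "c q \<in> c ` N" using N by auto
  obtain X where X: "X \<in> vector_fields \<A> UNIV" "\<And>x. x \<in> c ` N \<Longrightarrow> vr X x = tderiv \<A> c q w"
    by (rule const_extE[where w="tderiv \<A> c q w", OF N(2) subset_UNIV]) (rule that)
  have "tderiv \<A> c q (X q) = tderiv \<A> c q w" using X(2)[OF x] by (simp add: vrep_at[OF V])
  then have "X q = w" using coord_field_tderiv(2)[OF V] by metis
  then show "\<exists>X\<in>vector_fields \<A> UNIV. X q = w" using X(1) by blast
  show "\<exists>\<eta>\<in>sections \<A> E \<T> UNIV. \<eta> q = e" if e: "e \<in> E q"
  proof -
    obtain \<eta> where \<eta>: "\<eta> \<in> sections \<A> E \<T> UNIV" "\<And>x. x \<in> c ` N \<Longrightarrow> sr \<eta> x = \<Phi> q e"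
      by (rule const_extE'[where v="\<Phi> q e", OF N(2) subset_UNIV]) (rule that)
    have "\<Phi> q (\<eta> q) = \<Phi> q e" using \<eta>(2)[OF x] by (simp add: sr_at[OF V(2)])
    then have "\<eta> q = e" using triv_inject[OF W sectionsD(1)[OF \<eta>(1)] e] by simp
    then show ?thesis using \<eta>(1) by blast
  qed
qed

lemma local_tensor_smooth:
  assumes A: "local_tensor N A" and X: "X \<in> vector_fields \<A> UNIV" and \<eta>: "\<eta> \<in> sections \<A> E \<T> UNIV"
  shows "smooth_map \<A> N (\<lambda>q. A q (X q) (\<eta> q))"
proof -
  obtain V c W \<Phi> P where h: "(V, c) \<in> \<A>" "(W, \<Phi>) \<in> \<T>" "N \<subseteq> V \<inter> W" "bundle_chart.tensor_rep \<A> E c \<Phi> N A P"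
    using A unfolding local_tensor_def by (elim exE conjE)
  interpret coherent_chart \<A> E \<T> \<phi> D V c W \<Phi> by (rule coherent_chartI[OF h(1,2)])
  have N: "open N" using A by (simp add: local_tensor_def)
  show ?thesis
    by (rule tensor_rep_smooth(1)[OF h(4) N h(3) vector_fields_subset[OF X subset_UNIV] sections_subset[OF \<eta> subset_UNIV]])
qed

lemma smooth_map_nonzero_open:
  fixes f :: "'a \<Rightarrow> real"
  assumes "open U" "smooth_map \<A> U f"
  shows "open {q \<in> U. f q \<noteq> 0}"
proof (subst open_subopen, intro ballI)
  fix q assume q: "q \<in> {q \<in> U. f q \<noteq> 0}"
  obtain V c where V: "(V, c) \<in> \<A>" "q \<in> V" by (rule chart_ex)
  let ?S = "c ` (U \<inter> V)"
  have o: "open ?S" by (rule chart_image_open[OF V(1) assms(1)])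
  let ?g = "\<lambda>x. f (inv_into V c x)"
  have "open (?g -` (- {0}) \<inter> ?S)"
    using iffD1[OF continuous_on_open_vimage[OF o] smooth_onD(3)[OF smooth_mapD[OF assms(2) V(1)]]] by blast
  from chart_preimage_open[OF V(1) this]
  have "open {r \<in> V. c r \<in> ?g -` (- {0}) \<inter> ?S}" .
  moreover have "q \<in> {r \<in> V. c r \<in> ?g -` (- {0}) \<inter> ?S}" using q V chart_inv(1)[OF V(1)] by auto
  moreover have "{r \<in> V. c r \<in> ?g -` (- {0}) \<inter> ?S} \<subseteq> {q \<in> U. f q \<noteq> 0}"
  proof
    fix r assume r: "r \<in> {r \<in> V. c r \<in> ?g -` (- {0}) \<inter> ?S}"
    then obtain r' where r': "r' \<in> U" "r' \<in> V" "c r = c r'" by blast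
    have rV: "r \<in> V" "f (inv_into V c (c r)) \<noteq> 0" using r by auto
    have "r = r'" using chart_inv(1)[OF V(1) rV(1)] chart_inv(1)[OF V(1) r'(2)] r'(3) by metis
    then show "r \<in> {q \<in> U. f q \<noteq> 0}" using r'(1) rV chart_inv(1)[OF V(1) rV(1)] by simp
  qed
  ultimately show "\<exists>T. open T \<and> q \<in> T \<and> T \<subseteq> {q \<in> U. f q \<noteq> 0}" by blast
qed

lemma null_subset_avoid:
  assumes "null_subset \<A> Z" "open T" "q \<in> T"
  shows "\<exists>r\<in>T. r \<notin> Z"
proof (rule ccontr)
  assume "\<not> (\<exists>r\<in>T. r \<notin> Z)"
  then have TZ: "T \<subseteq> Z" by blast
  obtain V c where V: "(V, c) \<in> \<A>" "q \<in> V" by (rule chart_ex)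
  have "negligible (c ` (V \<inter> Z))" using assms(1) V(1) unfolding null_subset_def by blast
  then have "negligible (c ` (T \<inter> V))" by (rule negligible_subset) (use TZ in auto)
  moreover have "c ` (T \<inter> V) \<noteq> {}" using V assms by blast
  ultimately show False using open_not_negligible[OF chart_image_open[OF V(1) assms(2)]] by blast
qed

text \<open>
  If \<open>B x\<close> were nonzero, all values of \<open>\<phi> r\<close> would be multiples of \<open>\<phi> r x\<close>.
\<close>

lemma rank_two_zero:
  fixes B :: "real ^ 'n \<Rightarrow> real"
  assumes rk: "dim (range (\<phi> r)) \<ge> 2" and B: "\<And>x y. B y *\<^sub>R \<phi> r x = B x *\<^sub>R \<phi> r y"
  shows "B x = 0"
proof (rule ccontr)
  assume Bx: "B x \<noteq> 0"
  have "\<phi> r y = (B y / B x) *\<^sub>R \<phi> r x" for y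
    using arg_cong[OF B[of y x], of "\<lambda>v. (1 / B x) *\<^sub>R v"] Bx by simp
  then have "\<phi> r y \<in> span {\<phi> r x}" for y by (metis span_base span_scale singletonI)
  then have "range (\<phi> r) \<subseteq> span {\<phi> r x}" by blast
  from real_vector.dim_le_card[OF this] rk show False by simp
qed

context
  assumes ae: "null_subset \<A> {p. \<not> dim (range (\<phi> p)) \<ge> 2}"
begin

lemma dimension_ge_2: "CARD('n) \<ge> 2"
proof -
  obtain r where r: "dim (range (\<phi> r)) \<ge> 2" using null_subset_avoid[OF ae open_UNIV UNIV_I] by auto
  have "\<phi> r w \<in> span (\<phi> r ` Basis)" for w
    by (subst linear_expand[OF phi_linear]) (intro span_sum span_scale span_base imageI)
  then have "range (\<phi> r) \<subseteq> span (\<phi> r ` Basis)" by blast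
  from real_vector.dim_le_card[OF this] have "dim (range (\<phi> r)) \<le> card (\<phi> r ` Basis)" by simp
  also have "\<dots> \<le> card (Basis :: (real ^ 'n) set)" by (rule card_image_le) simp
  finally show ?thesis using r by simp
qed

text \<open>
  At a point of rank at least 2, \<open>rank_two_zero\<close> applies to the difference of the two tensors. The points where
  the difference is nonzero on given fields form an open set, which must contain such a point unless it is empty.
\<close>

lemma local_tensor_unique:
  assumes A1: "local_tensor N1 A1" "\<And>q. q \<in> N1 \<Longrightarrow> gauss_codazzi A1 q"
    and A2: "local_tensor N2 A2" "\<And>q. q \<in> N2 \<Longrightarrow> gauss_codazzi A2 q"
    and q: "q \<in> N1" "q \<in> N2" and e: "e \<in> E q"
  shows "A1 q w e = A2 q w e"
proof (rule ccontr)
  assume ne: "A1 q w e \<noteq> A2 q w e"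
  obtain X where X: "X \<in> vector_fields \<A> UNIV" "X q = w" using vector_field_through by blast
  obtain \<eta> where \<eta>: "\<eta> \<in> sections \<A> E \<T> UNIV" "\<eta> q = e" using section_through[OF e] by blast
  define d where "d r = A1 r (X r) (\<eta> r) + (- 1) *\<^sub>R A2 r (X r) (\<eta> r)" for r
  have o: "open (N1 \<inter> N2)" using A1 A2 unfolding local_tensor_def by auto
  have "smooth_map \<A> (N1 \<inter> N2) d"
    unfolding d_def
    by (rule smooth_map_add[OF o smooth_map_subset[OF local_tensor_smooth[OF A1(1) X(1) \<eta>(1)]]
          smooth_map_scaleR[OF o smooth_map_const smooth_map_subset[OF local_tensor_smooth[OF A2(1) X(1) \<eta>(1)]]]]) auto
  from null_subset_avoid[OF ae smooth_map_nonzero_open[OF o this], of q]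
  obtain r where r: "r \<in> N1" "r \<in> N2" "d r \<noteq> 0" "dim (range (\<phi> r)) \<ge> 2"
    using q ne by (auto simp: d_def X \<eta>)
  define k where "k = 1 / (real CARD('n) - 1)"
  have k: "k \<noteq> 0" using dimension_ge_2 by (simp add: k_def)
  define B where "B v = A1 r v (\<eta> r) - A2 r v (\<eta> r)" for v
  have "B y *\<^sub>R \<phi> r x = B x *\<^sub>R \<phi> r y" for x y
  proof -
    obtain X' where X': "X' \<in> vector_fields \<A> UNIV" "X' r = x" using vector_field_through by blast
    obtain Y' where Y': "Y' \<in> vector_fields \<A> UNIV" "Y' r = y" using vector_field_through by blast
    have "k *\<^sub>R (A1 r y (\<eta> r) *\<^sub>R \<phi> r x - A1 r x (\<eta> r) *\<^sub>R \<phi> r y) = curvature \<A> D X' Y' \<eta> r"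
      using A1(2)[OF r(1)] X' Y' \<eta>(1) unfolding gauss_codazzi_def k_def by auto
    also have "\<dots> = k *\<^sub>R (A2 r y (\<eta> r) *\<^sub>R \<phi> r x - A2 r x (\<eta> r) *\<^sub>R \<phi> r y)"
      using A2(2)[OF r(2)] X' Y' \<eta>(1) unfolding gauss_codazzi_def k_def by auto
    finally have "A1 r y (\<eta> r) *\<^sub>R \<phi> r x - A1 r x (\<eta> r) *\<^sub>R \<phi> r y = A2 r y (\<eta> r) *\<^sub>R \<phi> r x - A2 r x (\<eta> r) *\<^sub>R \<phi> r y"
      using k by simp
    then show ?thesis by (simp add: B_def algebra_simps)
  qed
  from rank_two_zero[OF r(4) this, of "X r"] r(3) show False by (simp add: B_def d_def)
qed

lemma gauss_codazzi_cong:
  assumes N: "open N" "q \<in> N" and eq: "\<And>r w e. r \<in> N \<Longrightarrow> e \<in> E r \<Longrightarrow> A r w e = B r w e" and A: "gauss_codazzi A q"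
  shows "gauss_codazzi B q"
  unfolding gauss_codazzi_def
proof (intro ballI)
  fix X Y \<eta> assume X: "X \<in> vector_fields \<A> UNIV" and Y: "Y \<in> vector_fields \<A> UNIV" and \<eta>: "\<eta> \<in> sections \<A> E \<T> UNIV"
  have t: "tderiv \<A> (\<lambda>q. B q (Z q) (\<eta> q)) q w = tderiv \<A> (\<lambda>q. A q (Z q) (\<eta> q)) q w" for Z w
    by (rule tderiv_cong[OF N]) (rule eq[symmetric], auto intro: sectionsD(1)[OF \<eta>])
  have in': "\<eta> q \<in> E q" "D X \<eta> q \<in> E q" "D Y \<eta> q \<in> E q"
    using sectionsD(1)[OF \<eta>] sectionsD(1)[OF connection_section[OF con X \<eta>]] sectionsD(1)[OF connection_section[OF con Y \<eta>]] by auto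
  show "curvature \<A> D X Y \<eta> q =
       (1 / (real CARD('n) - 1)) *\<^sub>R (B q (Y q) (\<eta> q) *\<^sub>R \<phi> q (X q) - B q (X q) (\<eta> q) *\<^sub>R \<phi> q (Y q)) \<and>
     tderiv \<A> (\<lambda>q. B q (Y q) (\<eta> q)) q (X q) - tderiv \<A> (\<lambda>q. B q (X q) (\<eta> q)) q (Y q)
         - B q (lie_bracket \<A> X Y q) (\<eta> q) =
       B q (Y q) (D X \<eta> q) - B q (X q) (D Y \<eta> q)"
    using A[unfolded gauss_codazzi_def, rule_format, OF X Y \<eta>]
    by (simp only: t eq[OF N(2) in'(1)] eq[OF N(2) in'(2)] eq[OF N(2) in'(3)])
qed

text \<open>
  At each point take the value of the local tensor chosen there. By uniqueness it coincides near each point with one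
  single local tensor, and so inherits smoothness and the two identities.
\<close>

lemma gauss_codazzi_if_projectively_flat:
  assumes tr: trace_free and pf: "projectively_flat \<A> E \<T> \<phi> D"
  shows "\<exists>A\<in>cotangent_dual_sections \<A> E \<T> UNIV. \<forall>p. gauss_codazzi A p"
proof -
  have "\<forall>p. \<exists>N A. local_tensor N A \<and> p \<in> N \<and> (\<forall>q\<in>N. gauss_codazzi A q)"
    using local_tensor_if_projectively_flat[OF tr dimension_ge_2 pf] by blast
  then obtain N A0 where h: "\<And>p. local_tensor (N p) (A0 p)" "\<And>p. p \<in> N p" "\<And>p q. q \<in> N p \<Longrightarrow> gauss_codazzi (A0 p) q"
    by metis
  define A where "A q w e = A0 q q w e" for q w e
  have eq: "A0 p q w e = A q w e" if "q \<in> N p" "e \<in> E q" for p q w e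
    unfolding A_def by (rule local_tensor_unique[OF h(1) h(3) h(1) h(3) that(1) h(2) that(2)])
  have "A \<in> cotangent_dual_sections \<A> E \<T> UNIV"
  proof (rule cotangent_dual_sectionsI)
    fix p
    obtain V c W \<Phi> P where k: "(V, c) \<in> \<A>" "(W, \<Phi>) \<in> \<T>" "N p \<subseteq> V \<inter> W" "bundle_chart.tensor_rep \<A> E c \<Phi> (N p) (A0 p) P"
      using h(1)[of p] unfolding local_tensor_def by (elim exE conjE)
    interpret coherent_chart \<A> E \<T> \<phi> D V c W \<Phi> by (rule coherent_chartI[OF k(1,2)])
    have "tensor_rep (N p) A P"
      using k(4) eq unfolding tensor_rep_def by simp
    moreover have "open (N p)" using h(1)[of p] by (simp add: local_tensor_def)
    ultimately show "\<exists>V c W \<Phi> N P. (V, c) \<in> \<A> \<and> (W, \<Phi>) \<in> \<T> \<and> open N \<and> p \<in> N \<and> N \<subseteq> V \<inter> W \<and>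
      bundle_chart.tensor_rep \<A> E c \<Phi> N A P"
      using k(1-3) h(2)[of p] by blast
  qed
  moreover have "gauss_codazzi A p" for p
    by (rule gauss_codazzi_cong[OF _ h(2) eq h(3)[OF h(2)]]) (use h(1)[of p] in \<open>auto simp: local_tensor_def\<close>)
  ultimately show ?thesis by blast
qed

end

end

theorem theorem3p12:
  fixes \<A> :: "('a::{t2_space, second_countable_topology}, 'n::finite) chart set"
    and E :: "'a \<Rightarrow> 'e::real_vector set"
    and \<T> :: "('a, 'e, 'n) triv set"
    and \<phi> :: "'a \<Rightarrow> real ^ 'n \<Rightarrow> 'e"
    and D :: "('a \<Rightarrow> real ^ 'n) \<Rightarrow> ('a \<Rightarrow> 'e) \<Rightarrow> 'a \<Rightarrow> 'e"
  assumes "smooth_manifold \<A>"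
    and "coherent_tangent_bundle \<A> E \<T> \<phi> D"
    and "null_subset \<A> {p. \<not> dim (range (\<phi> p)) \<ge> 2}"
    and "\<forall>X\<in>vector_fields \<A> UNIV. \<forall>Y\<in>vector_fields \<A> UNIV. \<forall>p.
           fibre_trace (E p) (curvature_endo \<A> E \<T> D X Y p) = 0"
  shows "projectively_flat \<A> E \<T> \<phi> D \<longleftrightarrow>
    (\<exists>A\<in>cotangent_dual_sections \<A> E \<T> UNIV.
       \<forall>X\<in>vector_fields \<A> UNIV. \<forall>Y\<in>vector_fields \<A> UNIV. \<forall>\<eta>\<in>sections \<A> E \<T> UNIV. \<forall>p.
         curvature \<A> D X Y \<eta> p =
           (1 / (real CARD('n) - 1)) *\<^sub>R (A p (Y p) (\<eta> p) *\<^sub>R \<phi> p (X p) - A p (X p) (\<eta> p) *\<^sub>R \<phi> p (Y p)) \<and>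
         tderiv \<A> (\<lambda>q. A q (Y q) (\<eta> q)) p (X p) - tderiv \<A> (\<lambda>q. A q (X q) (\<eta> q)) p (Y p)
             - A p (lie_bracket \<A> X Y p) (\<eta> p) =
           A p (Y p) (D X \<eta> p) - A p (X p) (D Y \<eta> p))"
proof -
  interpret coherent \<A> E \<T> \<phi> D
    by unfold_locales (use assms(1,2) in \<open>auto simp: coherent_tangent_bundle_def\<close>)
  have "projectively_flat \<A> E \<T> \<phi> D \<longleftrightarrow> (\<exists>A\<in>cotangent_dual_sections \<A> E \<T> UNIV. \<forall>p. gauss_codazzi A p)"
    using gauss_codazzi_if_projectively_flat[OF assms(3,4)] projectively_flat_if_gauss_codazzi[OF assms(4)] by blast
  then show ?thesis unfolding gauss_codazzi_def by blast
qed

end
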